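(* Let $A,B$ be linear operators on $\mathbb{R}^n$ such that $\lambda A+B$ is a regular pencil of index not higher than $1$, with spectral projectors $P_1,P_2,Q_1,Q_2$, subspaces $X_j=P_j\mathbb{R}^n$, $Y_j=Q_j\mathbb{R}^n$ ($j=1,2$) and operator $G=A+BP_2$. Let $f\in C([0,\infty)\times\mathbb{R}^n,\mathbb{R}^n)$ with $\frac{\partial f}{\partial x}\in C([0,\infty)\times\mathbb{R}^n,L(\mathbb{R}^n))$ (no further smoothness of $f$ is required), and put $L_0=\{(t,x)\in[0,\infty)\times\mathbb{R}^n : Q_2[Bx-f(t,x)]=0\}$. Assume: (i) for any $t\ge 0$ and any $x_{p_1}\in X_1$ there exists $x_{p_2}\in X_2$ such that $(t,x_{p_1}+x_{p_2})\in L_0$; (ii) for any $t_*\ge 0$, $x_{p_1}^*\in X_1$ and any $x_{p_2}^1,x_{p_2}^2\in X_2$ such that $(t_*,x_{p_1}^*+x_{p_2}^i)\in L_0$, $i=1,2$, the operator function $\Phi\colon X_2\to L(X_2,Y_2)$, $\Phi(x_{p_2})=\left[\frac{\partial (Q_2f)}{\partial x}(t_*,x_{p_1}^*+x_{p_2})-B\right]P_2$, is basis invertible on $[x_{p_2}^1,x_{p_2}^2]$; (iii) at least one of the following holds: (a) there exists a self-adjoint positive operator $H\in L(X_1)$ and for each $T'>0$ there exists $R_{T'}>0$ such that $(HP_1x,G^{-1}Q_1f(t,x))\le 0$ for all $(t,x)\in L_0$ with $0\le t\le T'$ and $\|P_1x\|\ge R_{T'}$; (b) $Q_1f(t,x)=S_1(t)P_1x+\psi(t,x)+\Pi(x)e(t)$,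 where $S_1\in C([0,\infty),L(X_1,Y_1))$, $\psi\in C([0,\infty)\times\mathbb{R}^n,Y_1)$, $\frac{\partial\psi}{\partial x}\in C([0,\infty)\times\mathbb{R}^n,L(\mathbb{R}^n,Y_1))$, $e\in C([0,\infty),\mathbb{R}^n)$, $\Pi\in C^1(\mathbb{R}^n,L(\mathbb{R}^n,Y_1))$, there exist $C,r>0$ such that $\|\Pi(x)\|\le C$ for all $x$ with $\|P_1x\|\ge r$, and there exists a self-adjoint positive operator $H\in L(X_1)$ and for each $T'>0$ there exists $R_{T'}>0$ such that $(HP_1x,G^{-1}\psi(t,x))\le 0$ for all $(t,x)\in L_0$ with $0\le t\le T'$ and $\|P_1x\|\ge R_{T'}$; (c) for some self-adjoint positive operator $H\in L(X_1)$ and some number $R>0$ there exist functions $k\in C([0,\infty),\mathbb{R})$ and $U\in C((0,\infty),(0,\infty))$ such that $\int_c^{+\infty}\frac{dv}{U(v)}=+\infty$ ($c>0$) and $\big(HP_1x,G^{-1}[-BP_1x+Q_1f(t,x)]\big)\le k(t)\,U\big(\tfrac12(HP_1x,P_1x)\big)$ for all $(t,x)\in L_0$ with $\|P_1x\|\ge R$. Let $(t_0,x_0)\in L_0$ and $T>t_0$. Let, additionally, the operator $\left[\frac{\partial (Q_2f)}{\partial x}(t,z+u)-B\right]P_2\in L(X_2,Y_2)$ be invertible for all $t\in[t_0,T]$, $z\in X_1$, $u\in X_2$. Let $x(t)$ be the unique global solution (which exists under these hypotheses) of $$\frac{d}{dt}[Ax]+Bx=f(t,x),\qquad x(t_0)=x_0,$$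 and put $z(t)=P_1x(t)$, $u(t)=P_2x(t)$. For $N\in\mathbb{N}$ let $h=(T-t_0)/N$, $t_i=t_0+ih$ ($i=0,\dots,N$), $z_0=P_1x_0$, $u_0=P_2x_0$. Then the method $$x_0=z_0+u_0,\qquad z_1=(I-hG^{-1}B)z_0+hG^{-1}Q_1f(t_0,z_0+u_0),$$ $$u_{i+1}=u_i-\Big[I-G^{-1}\tfrac{\partial (Q_2f)}{\partial x}(t_{i+1},z_{i+1}+u_i)\Big]^{-1}\big[u_i-G^{-1}Q_2f(t_{i+1},z_{i+1}+u_i)\big],\quad i=0,\dots,N-1,$$ $$z_{i+1}=z_{i-1}+2hG^{-1}[Q_1f(t_i,z_i+u_i)-Bz_i],\quad i=1,\dots,N-1,$$ $$x_{i+1}=z_{i+1}+u_{i+1},\quad i=0,\dots,N-1,$$ converges: $$\max_{0\le i\le N}\|z(t_i)-z_i\|\to 0,\qquad \max_{0\le i\le N}\|u(t_i)-u_i\|\to 0\qquad (h\to 0).$$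
   Context: $L(X,Y)$ is the space of (continuous) linear operators from $X$ to $Y$, $L(X)=L(X,X)$, and $I$ is the identity. $A$ and $B$ may be noninvertible. $(\cdot,\cdot)$ is the inner product on $\mathbb{R}^n$; a self-adjoint operator $H\in L(X_1)$ is positive if $(Hx,x)>0$ for all $x\in X_1$, $x\neq 0$. Pencil. The pencil $\lambda A+B$ ($\lambda$ a complex parameter) is regular if $\det(\lambda_0A+B)\ne 0$ for some $\lambda_0$. A regular pencil has index not higher than $1$ if there are constants $C_1,C_2>0$ with $\|(\lambda A+B)^{-1}\|\le C_1$ for all $|\lambda|\ge C_2$. In that case the spectral projectors are $$P_1=\frac{1}{2\pi i}\oint_{|\lambda|=C_2}(\lambda A+B)^{-1}A\,d\lambda,\quad P_2=I-P_1,\quad Q_1=\frac{1}{2\pi i}\oint_{|\lambda|=C_2}A(\lambda A+B)^{-1}d\lambda,\quad Q_2=I-Q_1.$$ They are real and give direct decompositions $\mathbb{R}^n=X_1\dot+X_2=Y_1\dot+Y_2$, with $X_j=P_j\mathbb{R}^n$, $Y_j=Q_j\mathbb{R}^n$. $A$ and $B$ map $X_j$ into $Y_j$, $A|_{X_2}=0$, and $A|_{X_1}\colon X_1\to Y_1$, $B|_{X_2}\colon X_2\to Y_2$ are invertible. The operator $G=A+BP_2=A+Q_2B\in L(\mathbb{R}^n)$ is invertible and $GX_j=Y_j$. If $A$ is invertible (index $0$), then $P_2=Q_2=0$, $P_1=Q_1=I$, and the conditions involving $X_2$ and $\Phi$ are vacuous. Solutions. A solution of the initial value problem on $[t_0,t_1)$,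 $t_1\le\infty$, is a function $x\in C([t_0,t_1),\mathbb{R}^n)$ with $Ax\in C^1([t_0,t_1),\mathbb{R}^n)$ satisfying the equation on $[t_0,t_1)$ and the initial condition. It is global if $t_1=\infty$. Basis invertibility. Let $W,Z$ be $s$-dimensional linear spaces, $D\subset W$, $\hat w,\tilde w\in D$, and $[\hat w,\tilde w]=\{\alpha\tilde w+(1-\alpha)\hat w:\alpha\in[0,1]\}$. An additive resolution of the identity in $Z$ is a family $\{\Theta_k\}_{k=1}^s$ of one-dimensional projectors in $Z$ with $\Theta_i\Theta_j=\delta_{ij}\Theta_i$ and $\sum_{k=1}^s\Theta_k=I_Z$. A mapping $\Phi\colon D\to L(W,Z)$ is basis invertible on $[\hat w,\tilde w]$ if for some additive resolution of the identity $\{\Theta_k\}_{k=1}^s$ in $Z$ and for any set of vectors $\{w^k\}_{k=1}^s\subset[\hat w,\tilde w]$ the operator $\Lambda=\sum_{k=1}^s\Theta_k\Phi(w^k)\in L(W,Z)$ has an inverse $\Lambda^{-1}\in L(Z,W)$. *)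

theory Defs
  imports "HOL-Complex_Analysis.Complex_Analysis"
begin

text \<open>
  Operators on the whole of \<open>\<real>\<^sup>n\<close> are matrices \<open>real^'n^'n\<close>.  An operator between subspaces
  \<open>W\<close> and \<open>Z\<close> is a function on the ambient space of which only the restriction to \<open>W\<close> matters;
  boundedness is automatic in finite dimension.
\<close>

definition linop_on ::
  "'a::real_vector set \<Rightarrow> 'b::real_vector set \<Rightarrow> ('a \<Rightarrow> 'b) \<Rightarrow> bool" where
  "linop_on W Z F \<longleftrightarrow>
     (\<forall>x\<in>W. F x \<in> Z) \<and>
     (\<forall>x\<in>W. \<forall>y\<in>W. F (x + y) = F x + F y) \<and>
     (\<forall>c. \<forall>x\<in>W. F (c *\<^sub>R x) = c *\<^sub>R F x)"

definition invertible_op ::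
  "'a::real_vector set \<Rightarrow> 'b::real_vector set \<Rightarrow> ('a \<Rightarrow> 'b) \<Rightarrow> bool" where
  "invertible_op W Z F \<longleftrightarrow>
     linop_on W Z F \<and>
     (\<exists>F'. linop_on Z W F' \<and> (\<forall>w\<in>W. F' (F w) = w) \<and> (\<forall>z\<in>Z. F (F' z) = z))"

definition positive_selfadjoint_on :: "'a::real_inner set \<Rightarrow> ('a \<Rightarrow> 'a) \<Rightarrow> bool" where
  "positive_selfadjoint_on W H \<longleftrightarrow>
     linop_on W W H \<and>
     (\<forall>x\<in>W. \<forall>y\<in>W. H x \<bullet> y = x \<bullet> H y) \<and>
     (\<forall>x\<in>W. x \<noteq> 0 \<longrightarrow> H x \<bullet> x > 0)"

definition additive_resolution ::
  "'b::euclidean_space set \<Rightarrow> nat \<Rightarrow> (nat \<Rightarrow> 'b \<Rightarrow> 'b) \<Rightarrow> bool" where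
  "additive_resolution Z s \<Theta> \<longleftrightarrow>
     (\<forall>k\<in>{1..s}. linop_on Z Z (\<Theta> k) \<and> dim (\<Theta> k ` Z) = 1) \<and>
     (\<forall>i\<in>{1..s}. \<forall>j\<in>{1..s}. \<forall>z\<in>Z. \<Theta> i (\<Theta> j z) = (if i = j then \<Theta> i z else 0)) \<and>
     (\<forall>z\<in>Z. (\<Sum>k=1..s. \<Theta> k z) = z)"

definition basis_invertible ::
  "'a::euclidean_space set \<Rightarrow> 'b::euclidean_space set \<Rightarrow> ('a \<Rightarrow> 'a \<Rightarrow> 'b) \<Rightarrow> 'a \<Rightarrow> 'a \<Rightarrow> bool" where
  "basis_invertible W Z \<Phi> w\<^sub>1 w\<^sub>2 \<longleftrightarrow>
     (\<exists>\<Theta>. additive_resolution Z (dim Z) \<Theta> \<and>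
        (\<forall>w. (\<forall>k\<in>{1..dim Z}. w k \<in> closed_segment w\<^sub>1 w\<^sub>2) \<longrightarrow>
             invertible_op W Z (\<lambda>v. \<Sum>k=1..dim Z. \<Theta> k (\<Phi> (w k) v))))"

definition pencil :: "real^'n^'n \<Rightarrow> real^'n^'n \<Rightarrow> complex \<Rightarrow> complex^'n^'n" where
  "pencil A B \<mu> = (\<chi> i j. \<mu> * complex_of_real (A $ i $ j) + complex_of_real (B $ i $ j))"

definition regular_pencil :: "real^'n^'n \<Rightarrow> real^'n^'n \<Rightarrow> bool" where
  "regular_pencil A B \<longleftrightarrow> (\<exists>\<mu>\<^sub>0. det (pencil A B \<mu>\<^sub>0) \<noteq> 0)"

text \<open>
  Index at most 1, with the constants made explicit.  Invertibility has to be stated since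
  \<^const>\<open>matrix_inv\<close> is total.
\<close>

definition index_le_one_with :: "real^'n^'n \<Rightarrow> real^'n^'n \<Rightarrow> real \<Rightarrow> real \<Rightarrow> bool" where
  "index_le_one_with A B C\<^sub>1 C\<^sub>2 \<longleftrightarrow>
     0 < C\<^sub>1 \<and> 0 < C\<^sub>2 \<and>
     (\<forall>\<mu>. C\<^sub>2 \<le> cmod \<mu> \<longrightarrow>
        invertible (pencil A B \<mu>) \<and> onorm ((*v) (matrix_inv (pencil A B \<mu>))) \<le> C\<^sub>1)"

text \<open>
  The contour integrals are taken entrywise.  The resulting matrices are real, so \<^const>\<open>Re\<close>
  only changes the type.
\<close>

definition spectral_P\<^sub>1 :: "real^'n^'n \<Rightarrow> real^'n^'n \<Rightarrow> real \<Rightarrow> real^'n^'n" where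
  "spectral_P\<^sub>1 A B C\<^sub>2 = (\<chi> i j. Re (1 / (2 * of_real pi * \<i>) *
     contour_integral (circlepath 0 C\<^sub>2)
       (\<lambda>\<mu>. (matrix_inv (pencil A B \<mu>) ** map_matrix complex_of_real A) $ i $ j)))"

definition spectral_Q\<^sub>1 :: "real^'n^'n \<Rightarrow> real^'n^'n \<Rightarrow> real \<Rightarrow> real^'n^'n" where
  "spectral_Q\<^sub>1 A B C\<^sub>2 = (\<chi> i j. Re (1 / (2 * of_real pi * \<i>) *
     contour_integral (circlepath 0 C\<^sub>2)
       (\<lambda>\<mu>. (map_matrix complex_of_real A ** matrix_inv (pencil A B \<mu>)) $ i $ j)))"

definition d_dx :: "(real \<Rightarrow> real^'n \<Rightarrow> real^'m) \<Rightarrow> real \<Rightarrow> real^'n \<Rightarrow> real^'n^'m" where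
  "d_dx F t x = jacobian (F t) (at x)"

definition cont_with_d_dx :: "(real \<Rightarrow> real^'n \<Rightarrow> real^'m) \<Rightarrow> bool" where
  "cont_with_d_dx F \<longleftrightarrow>
     continuous_on ({0..} \<times> UNIV) (\<lambda>(t, x). F t x) \<and>
     (\<forall>t\<ge>0. \<forall>x. F t differentiable (at x)) \<and>
     continuous_on ({0..} \<times> UNIV) (\<lambda>(t, x). d_dx F t x)"

definition C1_map :: "('a::real_normed_vector \<Rightarrow> 'b::real_normed_vector) \<Rightarrow> bool" where
  "C1_map F \<longleftrightarrow>
     (\<exists>F'. (\<forall>x. (F has_derivative blinfun_apply (F' x)) (at x)) \<and> continuous_on UNIV F')"

definition dae_solution_on ::
  "real^'n^'n \<Rightarrow> real^'n^'n \<Rightarrow> (real \<Rightarrow> real^'n \<Rightarrow> real^'n) \<Rightarrow> real \<Rightarrow> real^'n \<Rightarrow> real set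
     \<Rightarrow> (real \<Rightarrow> real^'n) \<Rightarrow> bool" where
  "dae_solution_on A B f t\<^sub>0 x\<^sub>0 J x \<longleftrightarrow>
     continuous_on J x \<and>
     (\<exists>y. continuous_on J y \<and>
        (\<forall>t\<in>J. ((\<lambda>\<tau>. A *v x \<tau>) has_vector_derivative y t) (at t within J) \<and>
               y t + B *v x t = f t (x t))) \<and>
     x t\<^sub>0 = x\<^sub>0"

abbreviation dae_global_solution ::
  "real^'n^'n \<Rightarrow> real^'n^'n \<Rightarrow> (real \<Rightarrow> real^'n \<Rightarrow> real^'n) \<Rightarrow> real \<Rightarrow> real^'n
     \<Rightarrow> (real \<Rightarrow> real^'n) \<Rightarrow> bool" where
  "dae_global_solution A B f t\<^sub>0 x\<^sub>0 x \<equiv> dae_solution_on A B f t\<^sub>0 x\<^sub>0 {t\<^sub>0..} x"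

definition step_size :: "real \<Rightarrow> real \<Rightarrow> nat \<Rightarrow> real" where
  "step_size t\<^sub>0 T N = (T - t\<^sub>0) / real N"

definition grid_point :: "real \<Rightarrow> real \<Rightarrow> nat \<Rightarrow> nat \<Rightarrow> real" where
  "grid_point t\<^sub>0 T N i = t\<^sub>0 + real i * step_size t\<^sub>0 T N"

text \<open>
  The sequences \<open>z\<close>, \<open>u\<close>, \<open>x\<close> are produced by the method with \<open>N\<close> steps; their values at
  indices beyond \<open>N\<close> are irrelevant.
\<close>

definition method_seqs ::
  "real^'n^'n \<Rightarrow> real^'n^'n \<Rightarrow> real^'n^'n \<Rightarrow> real^'n^'n \<Rightarrow> real^'n^'n \<Rightarrow> real^'n^'n
     \<Rightarrow> (real \<Rightarrow> real^'n \<Rightarrow> real^'n) \<Rightarrow> real \<Rightarrow> real \<Rightarrow> real^'n \<Rightarrow> nat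
     \<Rightarrow> (nat \<Rightarrow> real^'n) \<Rightarrow> (nat \<Rightarrow> real^'n) \<Rightarrow> (nat \<Rightarrow> real^'n) \<Rightarrow> bool" where
  "method_seqs B P\<^sub>1 P\<^sub>2 Q\<^sub>1 Q\<^sub>2 G f t\<^sub>0 T x\<^sub>0 N z u x \<longleftrightarrow>
     (let h = step_size t\<^sub>0 T N; t = grid_point t\<^sub>0 T N; G' = matrix_inv G in
      z 0 = P\<^sub>1 *v x\<^sub>0 \<and> u 0 = P\<^sub>2 *v x\<^sub>0 \<and> x 0 = z 0 + u 0 \<and>
      z 1 = (mat 1 - h *\<^sub>R (G' ** B)) *v z 0 + h *\<^sub>R (G' *v (Q\<^sub>1 *v f t\<^sub>0 (z 0 + u 0))) \<and>
      (\<forall>i<N. u (i + 1) = u i -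
         matrix_inv (mat 1 - G' ** d_dx (\<lambda>\<tau> y. Q\<^sub>2 *v f \<tau> y) (t (i + 1)) (z (i + 1) + u i)) *v
           (u i - G' *v (Q\<^sub>2 *v f (t (i + 1)) (z (i + 1) + u i)))) \<and>
      (\<forall>i. 1 \<le> i \<and> i < N \<longrightarrow>
         z (i + 1) = z (i - 1) + (2 * h) *\<^sub>R (G' *v (Q\<^sub>1 *v f (t i) (z i + u i) - B *v z i))) \<and>
      (\<forall>i<N. x (i + 1) = z (i + 1) + u (i + 1)))"

end

theory Submission
  imports Defs
begin

text \<open>
  Multiplying the equation by the inverse of \<open>G\<close> and splitting with the spectral projectors turns it
  into a semi-explicit system
    \<open>z' = \<gamma>(t, z + u)\<close>, \<open>u = \<phi>(t, z + u)\<close>  with  \<open>\<phi> = G\<^sup>-\<^sup>1 Q\<^sub>2 f\<close>, \<open>\<gamma> = G\<^sup>-\<^sup>1 (Q\<^sub>1 f - B P\<^sub>1 x)\<close>,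
  where \<open>z = P\<^sub>1 x\<close> and \<open>u = P\<^sub>2 x\<close>; the algebraic equation just says \<open>x - \<phi>(t, x) = z\<close>.  So everything
  is about the map \<open>x \<mapsto> x - \<phi>(t, x)\<close> on the whole space: the scheme is one Newton step for it per
  time step, combined with the explicit midpoint rule for \<open>z\<close>.

  The algebra behind this (\<open>A P\<^sub>1 = A = Q\<^sub>1 A\<close>, \<open>Q\<^sub>1 B = B P\<^sub>1\<close>, \<open>G\<close> invertible) has to be extracted from the
  contour integrals.  A pencil with bounded inverse at infinity admits two projectors with these
  properties, built from the group inverse of \<open>(c A + B)\<^sup>-\<^sup>1 A\<close>; the two integrands equal these projectors
  divided by \<open>\<lambda>\<close> up to terms of order \<open>\<lambda>\<^sup>-\<^sup>2\<close>, and blowing up the circle identifies the integrals with them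
  (\<open>spectral_projections\<close>).

  Existence and uniqueness.  Basis invertibility along a segment yields uniqueness of \<open>u\<close>, by Rolle's
  theorem applied to one coordinate at a time (\<open>basis_invertible_imp_injective\<close>); on the diagonal it
  makes the linearisation invertible, so \<open>x\<close> is a continuous and locally Lipschitz function of
  \<open>(t, z)\<close> (\<open>implicit_function_global\<close>) and \<open>z\<close> solves an ordinary differential equation.  Each growth
  condition bounds the derivative of \<open>V = (H z, z) / 2\<close> along solutions by \<open>K U(V)\<close> with \<open>1 / U\<close> not
  integrable at infinity, which excludes blow-up (\<open>lyapunov_a_priori_bound\<close>, \<open>ode_global_solution\<close>).

  Convergence.  Near the solution, which is compact on \<open>[t\<^sub>0, T]\<close>, a Newton step started at the previous
  \<open>u\<^sub>i\<close> halves the error in \<open>u\<close> up to a multiple of the error in \<open>z\<close> (\<open>newton_step_error\<close>); as \<open>u\<close> is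
  uniformly continuous, passing from \<open>t\<^sub>i\<close> to \<open>t\<^sub>i\<^sub>+\<^sub>1\<close> costs little.  The midpoint rule has local error
  \<open>o(h)\<close> because \<open>z\<close> is continuously differentiable.  The resulting pair of recursive inequalities is
  closed by induction, which also shows that the iterates never leave the neighbourhood
  (\<open>coupled_error_recursion\<close>, \<open>midpoint_newton_scheme_converges\<close>).
\<close>

no_notation fps_nth (infixl \<open>$\<close> 75)

section \<open>Continuity and compactness\<close>

lemma continuous_on_case_prod:
  assumes "continuous_on S (\<lambda>(t, x). F t x)" "continuous_on T a" "continuous_on T b"
    and "\<And>s. s \<in> T \<Longrightarrow> (a s, b s) \<in> S"
  shows "continuous_on T (\<lambda>s. F (a s) (b s))"
proof -
  have "continuous_on T ((\<lambda>(t, x). F t x) \<circ> (\<lambda>s. (a s, b s)))"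
    by (intro continuous_on_compose continuous_on_Pair assms(2,3) continuous_on_subset[OF assms(1)])
      (use assms(4) in auto)
  then show ?thesis by (simp add: comp_def)
qed

lemma compact_level_set:
  fixes f :: "real \<Rightarrow> 'a::t1_space"
  assumes "continuous_on {a..b} f"
  shows "compact {t \<in> {a..b}. f t = c}"
proof -
  have "closed {t \<in> {a..b}. f t = c}"
    by (intro continuous_closed_preimage_constant assms) simp
  then show ?thesis unfolding compact_eq_bounded_closed
    by (auto intro: bounded_subset[of "{a..b}"])
qed

lemma compact_image_norm_bound:
  assumes "compact J" "continuous_on J F"
  obtains m where "m \<ge> 0" "\<And>t. t \<in> J \<Longrightarrow> norm (F t) \<le> m"
proof -
  have "bounded (F ` J)"
    using assms by (intro compact_imp_bounded compact_continuous_image)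
  then obtain m where "\<forall>y\<in>F ` J. norm y \<le> m" by (auto simp: bounded_iff)
  then show thesis using that[of "max m 0"] by force
qed

section \<open>Regular pencils of index at most one\<close>

lemma invertible_matrix_inv:
  fixes M :: "'a::semiring_1^'n^'n"
  assumes "invertible M"
  shows "M ** matrix_inv M = mat 1" "matrix_inv M ** M = mat 1"
  using assms unfolding invertible_def matrix_inv_def by (metis (mono_tags, lifting) someI_ex)+

lemma matrix_diff_rdistrib: "(M - N) ** K = M ** K - N ** (K :: 'a::ring_1^'n^'m)"
  by (simp add: vec_eq_iff matrix_matrix_mult_def left_diff_distrib sum_subtractf)

lemma matrix_diff_ldistrib: "K ** (M - N) = K ** M - K ** (N :: 'a::ring_1^'n^'m)"
  by (simp add: vec_eq_iff matrix_matrix_mult_def right_diff_distrib sum_subtractf)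

lemma matrix_add_rdistrib: "(M + N) ** K = M ** K + N ** (K :: 'a::ring_1^'n^'m)"
  by (simp add: vec_eq_iff matrix_matrix_mult_def distrib_right sum.distrib)

lemma scaleR_matrix_mult: "(c *\<^sub>R M) ** N = c *\<^sub>R (M ** N)" "M ** (c *\<^sub>R N) = c *\<^sub>R (M ** N)"
  for M N :: "real^'n^'n"
  by (simp_all add: vec_eq_iff matrix_matrix_mult_def sum_distrib_left mult_ac)

lemma matrix_vector_mult_axis: "(N *v axis j 1) $ i = (N :: 'a::semiring_1^'n^'m) $ i $ j"
proof -
  have "(\<Sum>k\<in>UNIV. N $ i $ k * axis j 1 $ k) = (\<Sum>k\<in>UNIV. if k = j then N $ i $ k else 0)"
    by (rule sum.cong) (auto simp: axis_def)
  then show ?thesis by (simp add: matrix_vector_mult_def)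
qed

lemma matrix_range_factor:
  fixes M N :: "'a::field^'n^'n"
  assumes "\<And>v. \<exists>w. N *v v = M *v w"
  obtains Y where "N = M ** Y"
proof -
  have "\<forall>j. \<exists>w. N *v axis j 1 = M *v w" using assms by blast
  from choice[OF this] obtain w where w: "\<And>j. N *v axis j 1 = M *v w j" by blast
  define Y :: "'a^'n^'n" where "Y = (\<chi> i j. w j $ i)"
  have "N $ i $ j = (M ** Y) $ i $ j" for i j
  proof -
    have "N $ i $ j = (N *v axis j 1) $ i"
      by (simp add: matrix_vector_mult_axis)
    also have "\<dots> = (M *v w j) $ i" by (simp add: w)
    also have "\<dots> = (M ** Y) $ i $ j"
      by (simp add: matrix_vector_mult_def matrix_matrix_mult_def Y_def)
    finally show ?thesis .
  qed
  then have "N = M ** Y" by (simp add: vec_eq_iff)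
  then show thesis by (rule that)
qed

text \<open>
  If \<open>ker E\<^sup>2 = ker E\<close> then the space is the direct sum of \<open>ker E\<close> and the range of \<open>E\<close>: \<open>P\<close> is the
  projector of this decomposition and \<open>X\<close> inverts \<open>E\<close> on its range.  With \<open>E = E\<^sup>2 Y\<close>, which exists since
  \<open>E\<close> is injective on its own range, \<open>P = E Y\<close> and \<open>X = E Y\<^sup>2\<close>; one factor \<open>E\<close> may be cancelled in
  identities beginning with \<open>E\<^sup>2\<close>, and this gives all the equations.
\<close>

lemma group_inverse_exists:
  fixes E :: "real^'n^'n"
  assumes ker: "\<And>v. E *v (E *v v) = 0 \<Longrightarrow> E *v v = 0"
  obtains P X where "E ** X = P" "X ** E = P" "P ** E = E" "E ** P = E" "P ** X = X"
proof -
  have "\<exists>w. E *v v = (E ** E) *v w" for v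
  proof -
    let ?R = "range ((*v) E)"
    have sub: "subspace ?R"
      by (simp add: linear_subspace_image)
    have inj: "inj_on ((*v) E) ?R"
    proof (rule inj_onI)
      fix x y assume "x \<in> ?R" "y \<in> ?R" and eq: "E *v x = E *v y"
      then obtain a b where ab: "x = E *v a" "y = E *v b" by auto
      have "E *v (E *v (a - b)) = 0"
        using eq ab by (simp add: matrix_vector_mult_diff_distrib)
      from ker[OF this] show "x = y" using ab by (simp add: matrix_vector_mult_diff_distrib)
    qed
    have "dim ((*v) E ` ?R) = dim ?R"
      using dim_image_eq[of "(*v) E" ?R] inj sub by (simp add: span_eq_iff[THEN iffD2])
    moreover have "(*v) E ` ?R \<subseteq> ?R" by auto
    ultimately have "(*v) E ` ?R = ?R"
      using sub by (metis linear_subspace_image matrix_vector_mul_linear order_refl subspace_dim_equal)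
    then have "E *v v \<in> (*v) E ` ?R" by blast
    then show ?thesis by (auto simp: matrix_vector_mul_assoc)
  qed
  then obtain Y where Y: "E = (E ** E) ** Y" using matrix_range_factor by metis
  have cancel: "E ** M = E ** N" if "(E ** E) ** M = (E ** E) ** N" for M N :: "real^'n^'n"
  proof -
    have "E *v (E *v ((M - N) *v v)) = 0" for v
      using that by (metis matrix_vector_mul_assoc matrix_vector_mult_diff_distrib
          matrix_vector_mult_diff_rdistrib right_minus_eq)
    then have "E *v ((M - N) *v v) = 0" for v using ker by blast
    then have "E *v (M *v v) = E *v (N *v v)" for v
      by (metis eq_iff_diff_eq_0 matrix_vector_mult_diff_distrib matrix_vector_mult_diff_rdistrib)
    then show ?thesis by (simp add: matrix_eq matrix_vector_mul_assoc)
  qed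
  have Y': "E ** (E ** (Y ** M)) = E ** M" for M using Y by (metis matrix_mul_assoc)
  have Y2: "E ** (E ** Y) = E" using Y by (metis matrix_mul_assoc)
  have 1: "E ** (Y ** E) = E"
    using cancel[of "Y ** E" "mat 1"] by (simp add: matrix_mul_assoc[symmetric] Y')
  have 2: "E ** (E ** (Y ** Y)) = E ** Y" by (simp add: Y')
  have 3: "E ** (Y ** (Y ** E)) = E ** Y"
    using cancel[of "Y ** (Y ** E)" "Y"] by (simp add: matrix_mul_assoc[symmetric] Y' 1 Y2)
  show thesis
  proof (rule that[of "E ** (Y ** Y)" "E ** Y"])
    show "E ** (E ** (Y ** Y)) = E ** Y" by (rule 2)
    show "(E ** (Y ** Y)) ** E = E ** Y" by (simp add: matrix_mul_assoc[symmetric] 3)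
    show "(E ** Y) ** E = E" by (simp add: matrix_mul_assoc[symmetric] 1)
    show "E ** (E ** Y) = E" by (rule Y2)
    show "(E ** Y) ** (E ** (Y ** Y)) = E ** (Y ** Y)"
      by (metis 1 matrix_mul_assoc)
  qed
qed

definition cvec :: "real^'n \<Rightarrow> complex^'n" where
  "cvec v = (\<chi> i. complex_of_real (v $ i))"

lemma norm_cvec [simp]: "norm (cvec v) = norm v"
  by (simp add: cvec_def norm_vec_def L2_set_def)

lemma pencil_cvec: "pencil A B (complex_of_real s) *v cvec v = cvec ((s *\<^sub>R A + B) *v v)"
  by (simp add: vec_eq_iff pencil_def cvec_def matrix_vector_mult_def)

lemma index_le_one_bound:
  assumes "index_le_one_with A B c1 c2" "c2 \<le> cmod \<mu>"
  shows "norm (matrix_inv (pencil A B \<mu>) *v y) \<le> c1 * norm y"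
proof -
  have "norm (matrix_inv (pencil A B \<mu>) *v y) \<le> onorm ((*v) (matrix_inv (pencil A B \<mu>))) * norm y"
    by (rule onorm[OF matrix_vector_mul_bounded_linear])
  also have "\<dots> \<le> c1 * norm y"
    using assms by (intro mult_right_mono) (auto simp: index_le_one_with_def)
  finally show ?thesis .
qed

lemma index_le_one_real_bound:
  assumes ind: "index_le_one_with A B c1 c2" and s: "c2 \<le> s"
  shows "norm v \<le> c1 * norm ((s *\<^sub>R A + B) *v v)"
proof -
  have c: "c2 \<le> cmod (complex_of_real s)" using s by simp
  have inv: "invertible (pencil A B (of_real s))" using ind c by (auto simp: index_le_one_with_def)
  have "cvec v = matrix_inv (pencil A B (of_real s)) *v (pencil A B (of_real s) *v cvec v)"
    by (simp add: matrix_vector_mul_assoc invertible_matrix_inv[OF inv])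
  then have "norm v = norm (matrix_inv (pencil A B (of_real s)) *v cvec ((s *\<^sub>R A + B) *v v))"
    by (metis norm_cvec pencil_cvec)
  also have "\<dots> \<le> c1 * norm ((s *\<^sub>R A + B) *v v)"
    using index_le_one_bound[OF ind c] by (metis norm_cvec)
  finally show ?thesis .
qed

text \<open>
  Index at most one excludes nilpotent blocks: with \<open>S = c A + B\<close> and \<open>E = S\<^sup>-\<^sup>1 A\<close>, a vector with
  \<open>E\<^sup>2 v = 0\<close> satisfies \<open>((s + c) A + B) (v - s E v) = S v\<close> for all \<open>s\<close>, which contradicts boundedness of
  the inverse as \<open>s\<close> grows unless \<open>E v = 0\<close>.  The group inverse of \<open>E\<close> then supplies everything,
  including the factors \<open>N\<close> and \<open>N'\<close>, on which the computation of the contour integrals rests.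
\<close>

lemma index_le_one_structure:
  fixes A B :: "real^'n^'n"
  assumes ind: "index_le_one_with A B c1 c2"
  obtains P Q N N' :: "real^'n^'n" where
    "P ** P = P" "Q ** Q = Q" "A ** P = A" "Q ** A = A" "Q ** B = B ** P"
    "B ** P = A ** N" "Q ** B = N' ** A" "invertible (A + B ** (mat 1 - P))"
proof -
  define S where "S = c2 *\<^sub>R A + B"
  have c: "c1 > 0" "c2 > 0" using ind by (auto simp: index_le_one_with_def)
  have "invertible S"
    unfolding invertible_left_inverse matrix_left_invertible_ker
  proof (intro allI impI)
    fix x assume "S *v x = 0"
    then show "x = 0" using index_le_one_real_bound[OF ind order_refl, of x, folded S_def] by simp
  qed
  then obtain S' where S': "S ** S' = mat 1" "S' ** S = mat 1"
    using invertible_matrix_inv by blast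
  define E where "E = S' ** A"
  have SE: "S ** E = A" by (simp add: E_def matrix_mul_assoc S')
  have ker: "E *v v = 0" if v: "E *v (E *v v) = 0" for v
  proof (rule ccontr)
    assume nz: "E *v v \<noteq> 0"
    have AE: "A *v (E *v v) = 0" using v
      by (metis SE matrix_vector_mul_assoc matrix_vector_mult_0_right)
    have *: "s * norm (E *v v) \<le> c1 * norm (S *v v) + norm v" if "s \<ge> 0" for s
    proof -
      have "S *v (E *v v) = A *v v" by (simp add: matrix_vector_mul_assoc SE)
      moreover have "((s + c2) *\<^sub>R A + B) *v w = S *v w + s *\<^sub>R (A *v w)" for w
        by (simp add: S_def algebra_simps matrix_vector_mult_add_rdistrib scaleR_matrix_vector_assoc)
      ultimately have "((s + c2) *\<^sub>R A + B) *v (v - s *\<^sub>R (E *v v)) = S *v v"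
        by (simp add: matrix_vector_mult_diff_distrib matrix_vector_mult_scaleR AE)
      then have "norm (v - s *\<^sub>R (E *v v)) \<le> c1 * norm (S *v v)"
        using index_le_one_real_bound[OF ind, of "s + c2" "v - s *\<^sub>R (E *v v)"] that by simp
      moreover have "norm (s *\<^sub>R (E *v v)) \<le> norm (v - s *\<^sub>R (E *v v)) + norm v"
        by (metis norm_minus_commute norm_triangle_sub add.commute)
      ultimately show ?thesis using that by simp
    qed
    define K where "K = c1 * norm (S *v v) + norm v"
    have "K \<ge> 0" using c by (simp add: K_def)
    have "(K + 1) / norm (E *v v) * norm (E *v v) \<le> K"
      unfolding K_def by (rule *) (use \<open>K \<ge> 0\<close> in \<open>simp add: K_def\<close>)
    then show False using nz by simp
  qed
  obtain P X where X: "E ** X = P" "X ** E = P" "P ** E = E" "E ** P = E" "P ** X = X"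
    using group_inverse_exists[OF ker] by metis
  have PP: "P ** P = P" by (metis X matrix_mul_assoc)
  have Bdef: "B = S - c2 *\<^sub>R A" by (simp add: S_def)
  have AP: "A ** P = A" by (metis SE X(4) matrix_mul_assoc)
  have AX: "A ** X = S ** P" by (metis SE X(1) matrix_mul_assoc)
  define Q where "Q = S ** P ** S'"
  have QS: "Q ** S = S ** P" by (simp add: Q_def matrix_mul_assoc[symmetric] S')
  have QA: "Q ** A = A" unfolding Q_def
    by (metis AP SE S'(2) X(3) E_def matrix_mul_assoc)
  have QQ: "Q ** Q = Q" unfolding Q_def
    by (metis PP QS Q_def matrix_mul_assoc)
  have BP: "B ** P = S ** P - c2 *\<^sub>R A"
    by (simp add: Bdef matrix_diff_rdistrib AP scaleR_matrix_mult)
  have QB: "Q ** B = S ** P - c2 *\<^sub>R A"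
    by (simp add: Bdef matrix_diff_ldistrib QA QS scaleR_matrix_mult)
  show thesis
  proof (rule that[OF PP QQ AP QA])
    show "Q ** B = B ** P" by (simp add: BP QB)
    show "B ** P = A ** (X - c2 *\<^sub>R mat 1)"
      by (simp add: BP matrix_diff_ldistrib AX scaleR_matrix_mult)
    have "S ** P = S ** X ** S' ** A" by (metis E_def X(2) matrix_mul_assoc)
    then show "Q ** B = (S ** X ** S' - c2 *\<^sub>R mat 1) ** A"
      by (simp add: QB matrix_diff_rdistrib scaleR_matrix_mult)
    have XP: "X ** P = X" by (metis X(1,2,5) matrix_mul_assoc)
    have "A + B ** (mat 1 - P) = S ** (E + mat 1 - P)"
      by (simp add: matrix_diff_ldistrib matrix_add_ldistrib BP SE) (simp add: Bdef)
    then have "((mat 1 - P + X) ** S') ** (A + B ** (mat 1 - P))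
      = (mat 1 - P + X) ** ((S' ** S) ** (E + mat 1 - P))"
      by (simp add: matrix_mul_assoc)
    also have "\<dots> = mat 1"
      by (simp add: S' matrix_diff_ldistrib matrix_diff_rdistrib matrix_add_ldistrib
          matrix_add_rdistrib X PP XP)
    finally show "invertible (A + B ** (mat 1 - P))"
      unfolding invertible_left_inverse by blast
  qed
qed

subsection \<open>The contour integrals\<close>

lemma contour_integral_circlepath_expand:
  assumes S: "open S" "w holomorphic_on S" "{\<mu>. r \<le> cmod \<mu>} \<subseteq> S" and r: "0 < r" "r \<le> r'"
  shows "contour_integral (circlepath 0 r) w = contour_integral (circlepath 0 r') w"
proof (rule Cauchy_theorem_homotopic_loops[OF _ S(1,2)])
  have seg: "closed_segment (circlepath 0 r t) (circlepath 0 r' t) \<subseteq> S" for t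
  proof
    fix y assume "y \<in> closed_segment (circlepath 0 r t) (circlepath 0 r' t)"
    then obtain a where a: "0 \<le> a" "a \<le> 1"
      and y: "y = (1 - a) *\<^sub>R circlepath 0 r t + a *\<^sub>R circlepath 0 r' t"
      by (auto simp: closed_segment_def)
    define e where "e = exp (2 * complex_of_real pi * \<i> * complex_of_real t)"
    have "cmod e = 1"
      unfolding e_def by (simp add: norm_exp_eq_Re)
    moreover have "y = of_real ((1 - a) * r + a * r') * e"
      by (simp add: y circlepath e_def scaleR_conv_of_real algebra_simps)
    moreover have "r \<le> (1 - a) * r + a * r'"
      using a r mult_left_mono[of r r' a] by (simp add: algebra_simps)
    ultimately have "r \<le> cmod y"
      by (simp only: norm_mult norm_of_real) simp
    then show "y \<in> S" using S by auto
  qed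
  then show "homotopic_loops S (circlepath 0 r) (circlepath 0 r')"
    by (intro homotopic_loops_linear) auto
qed auto

text \<open>
  The integral does not depend on the radius, and on large circles the remainder of order \<open>\<mu>\<^sup>-\<^sup>2\<close>
  contributes only \<open>O(1 / s)\<close>.
\<close>

lemma contour_integral_eq_coeff_at_infinity:
  assumes S: "open S" "w holomorphic_on S" "{\<mu>. r \<le> cmod \<mu>} \<subseteq> S" and r: "0 < r"
    and bnd: "\<And>\<mu>. r \<le> cmod \<mu> \<Longrightarrow> cmod (w \<mu> - p / \<mu>) \<le> K / (cmod \<mu>)\<^sup>2"
  shows "contour_integral (circlepath 0 r) w = 2 * of_real pi * \<i> * p"
proof -
  define I where "I = contour_integral (circlepath 0 r) w"
  have K: "K \<ge> 0"
  proof -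
    have "0 \<le> K / (cmod (of_real r))\<^sup>2" using bnd[of "of_real r"] r norm_ge_zero order_trans by (smt (verit) norm_of_real)
    then show ?thesis using r by (simp add: zero_le_divide_iff)
  qed
  have est: "cmod (I - 2 * of_real pi * \<i> * p) \<le> 2 * pi * K / s" if s: "r \<le> s" for s
  proof -
    have s0: "s > 0" using r s by simp
    have sub: "path_image (circlepath 0 s) \<subseteq> S" using S(3) s s0 by auto
    have "w contour_integrable_on circlepath 0 s"
      using contour_integrable_holomorphic_simple[OF S(2,1) _ sub] by simp
    then have 1: "(w has_contour_integral I) (circlepath 0 s)"
      unfolding I_def contour_integral_circlepath_expand[OF S r s]
      by (rule has_contour_integral_integral)
    have "((\<lambda>\<mu>. 1 / (\<mu> - 0)) has_contour_integral 2 * of_real pi * \<i>) (circlepath 0 s)"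
      unfolding contour_integral_circlepath[OF s0, of 0, symmetric] using s0
      by (intro has_contour_integral_integral contour_integrable_continuous_circlepath continuous_intros) auto
    from has_contour_integral_rmul[OF this, of p]
    have 2: "((\<lambda>\<mu>. p / \<mu>) has_contour_integral 2 * of_real pi * \<i> * p) (circlepath 0 s)"
      by simp
    have "cmod (I - 2 * of_real pi * \<i> * p) \<le> (K / s\<^sup>2) * (2 * pi * s)"
    proof (rule has_contour_integral_bound_circlepath[OF has_contour_integral_diff[OF 1 2] _ s0])
      show "0 \<le> K / s\<^sup>2" using K by simp
      show "cmod (w x - p / x) \<le> K / s\<^sup>2" if "cmod (x - 0) = s" for x
        using bnd[of x] that s by simp
    qed
    also have "\<dots> = 2 * pi * K / s" using s0 by (simp add: power2_eq_square)
    finally show ?thesis .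
  qed
  have "((\<lambda>s::real. 2 * pi * K / s) \<longlongrightarrow> 0) at_top"
    by (intro tendsto_divide_0[OF tendsto_const] filterlim_at_top_imp_at_infinity filterlim_ident)
  moreover have "\<forall>\<^sub>F s in at_top. cmod (I - 2 * of_real pi * \<i> * p) \<le> 2 * pi * K / s"
    using eventually_ge_at_top[of r] by eventually_elim (rule est)
  ultimately have "cmod (I - 2 * of_real pi * \<i> * p) \<le> 0"
    by (rule tendsto_lowerbound) simp
  then show ?thesis by (simp add: I_def)
qed

text \<open>
  The recursion \<open>\<mu> W = P - L W\<close>, with \<open>L\<close> entrywise bounded, improves its own information: a bounded
  \<open>W\<close> is of order \<open>1 / \<mu>\<close>, hence \<open>W - P / \<mu>\<close> of order \<open>\<mu>\<^sup>-\<^sup>2\<close>.  Here \<open>L\<close> is right or left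
  multiplication by a fixed matrix.
\<close>

lemma contour_integral_matrix_entry:
  fixes W :: "complex \<Rightarrow> complex^'n^'n" and P :: "complex^'n^'n"
  assumes S: "open S" "\<And>i j. (\<lambda>\<mu>. W \<mu> $ i $ j) holomorphic_on S" "{\<mu>. r \<le> cmod \<mu>} \<subseteq> S"
    and r: "0 < r"
    and bnd: "\<And>\<mu> i j. r \<le> cmod \<mu> \<Longrightarrow> cmod (W \<mu> $ i $ j) \<le> K"
    and rec: "\<And>\<mu> i j. r \<le> cmod \<mu> \<Longrightarrow> \<mu> * W \<mu> $ i $ j = P $ i $ j - L (W \<mu>) $ i $ j"
    and L: "\<And>M b i j. (\<And>i j. cmod (M $ i $ j) \<le> b) \<Longrightarrow> cmod (L M $ i $ j) \<le> K0 * b"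
  shows "contour_integral (circlepath 0 r) (\<lambda>\<mu>. W \<mu> $ i $ j) = 2 * of_real pi * \<i> * P $ i $ j"
proof (rule contour_integral_eq_coeff_at_infinity[OF S(1) S(2) S(3) r])
  define p where "p = (\<Sum>i\<in>UNIV. \<Sum>j\<in>UNIV. cmod (P $ i $ j))"
  have p: "cmod (P $ i $ j) \<le> p" for i j
  proof -
    have "cmod (P $ i $ j) \<le> (\<Sum>j\<in>UNIV. cmod (P $ i $ j))" by (rule member_le_sum) auto
    also have "\<dots> \<le> p" unfolding p_def by (rule member_le_sum) (auto intro: sum_nonneg)
    finally show ?thesis .
  qed
  fix \<mu> assume \<mu>: "r \<le> cmod \<mu>"
  then have m0: "cmod \<mu> > 0" "\<mu> \<noteq> 0" using r by auto
  have b1: "cmod (W \<mu> $ i $ j) \<le> (p + K0 * K) / cmod \<mu>" for i j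
  proof -
    have "cmod \<mu> * cmod (W \<mu> $ i $ j) \<le> cmod (P $ i $ j) + cmod (L (W \<mu>) $ i $ j)"
      by (metis \<mu> norm_mult norm_triangle_ineq4 rec)
    also have "\<dots> \<le> p + K0 * K" by (intro add_mono p L bnd \<mu>)
    finally show ?thesis using m0 by (simp add: field_simps)
  qed
  have "W \<mu> $ i $ j - P $ i $ j / \<mu> = - (L (W \<mu>) $ i $ j) / \<mu>"
    unfolding minus_divide_left[symmetric] using rec[OF \<mu>, of i j] m0
    by (auto simp: nonzero_eq_divide_eq diff_divide_distrib algebra_simps minus_equation_iff)
  then have "cmod (W \<mu> $ i $ j - P $ i $ j / \<mu>) = cmod (L (W \<mu>) $ i $ j) / cmod \<mu>"
    by (simp add: norm_divide)
  also have "\<dots> \<le> (K0 * ((p + K0 * K) / cmod \<mu>)) / cmod \<mu>"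
    by (intro divide_right_mono L b1) simp
  also have "\<dots> = K0 * (p + K0 * K) / (cmod \<mu>)\<^sup>2" by (simp add: power2_eq_square)
  finally show "cmod (W \<mu> $ i $ j - P $ i $ j / \<mu>) \<le> K0 * (p + K0 * K) / (cmod \<mu>)\<^sup>2" .
qed

lemma cmod_matrix_mult_entry_le:
  fixes M N :: "complex^'n^'n"
  assumes "\<And>i j. cmod (M $ i $ j) \<le> b"
  shows "cmod ((M ** N) $ i $ j) \<le> (\<Sum>i\<in>UNIV. \<Sum>j\<in>UNIV. cmod (N $ i $ j)) * b" (is ?A)
    and "cmod ((N ** M) $ i $ j) \<le> (\<Sum>i\<in>UNIV. \<Sum>j\<in>UNIV. cmod (N $ i $ j)) * b" (is ?B)
proof -
  have b: "b \<ge> 0" using assms[of i j] norm_ge_zero order_trans by blast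
  have "cmod ((M ** N) $ i $ j) \<le> (\<Sum>k\<in>UNIV. b * cmod (N $ k $ j))"
    unfolding matrix_matrix_mult_def
    by (auto intro!: order_trans[OF norm_sum] sum_mono mult_right_mono assms simp: norm_mult)
  also have "\<dots> \<le> (\<Sum>k\<in>UNIV. b * (\<Sum>j\<in>UNIV. cmod (N $ k $ j)))"
    using b by (intro sum_mono mult_left_mono member_le_sum) auto
  finally show ?A by (simp add: sum_distrib_left[symmetric] mult.commute)
  have "cmod ((N ** M) $ i $ j) \<le> (\<Sum>k\<in>UNIV. cmod (N $ i $ k) * b)"
    unfolding matrix_matrix_mult_def
    by (auto intro!: order_trans[OF norm_sum] sum_mono mult_left_mono assms simp: norm_mult)
  also have "\<dots> = (\<Sum>k\<in>UNIV. cmod (N $ i $ k)) * b" by (simp add: sum_distrib_right)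
  also have "\<dots> \<le> (\<Sum>i\<in>UNIV. \<Sum>k\<in>UNIV. cmod (N $ i $ k)) * b"
    using b by (intro mult_right_mono member_le_sum) (auto intro: sum_nonneg)
  finally show ?B .
qed

text \<open>
  By Cramer's rule.
\<close>

lemma holomorphic_matrix_inv:
  fixes M :: "complex \<Rightarrow> complex^'n^'n"
  assumes M: "\<And>i j. (\<lambda>\<mu>. M \<mu> $ i $ j) holomorphic_on S" and nz: "\<And>\<mu>. \<mu> \<in> S \<Longrightarrow> det (M \<mu>) \<noteq> 0"
  shows "(\<lambda>\<mu>. matrix_inv (M \<mu>) $ i $ j) holomorphic_on S"
proof -
  have det_hol: "(\<lambda>\<mu>. det (F \<mu>)) holomorphic_on S"
    if "\<And>i j. (\<lambda>\<mu>. F \<mu> $ i $ j) holomorphic_on S" for F :: "complex \<Rightarrow> complex^'n^'n"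
    unfolding det_def by (intro holomorphic_intros that)
  have entry: "(\<lambda>\<mu>. if b = i then axis j 1 $ a else M \<mu> $ a $ b) holomorphic_on S" for a b
    by (cases "b = i") (simp_all add: M)
  have "(\<lambda>\<mu>. det (\<chi> a b. if b = i then axis j 1 $ a else M \<mu> $ a $ b) / det (M \<mu>)) holomorphic_on S"
    using nz by (intro holomorphic_on_divide det_hol) (simp_all add: M entry)
  moreover have "matrix_inv (M \<mu>) $ i $ j = det (\<chi> a b. if b = i then axis j 1 $ a else M \<mu> $ a $ b) / det (M \<mu>)"
    if "\<mu> \<in> S" for \<mu>
  proof -
    have "invertible (M \<mu>)" using nz[OF that] by (simp add: invertible_det_nz)
    then have "M \<mu> *v (matrix_inv (M \<mu>) *v axis j 1) = axis j 1"
      by (simp add: matrix_vector_mul_assoc invertible_matrix_inv)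
    then have "(matrix_inv (M \<mu>) *v axis j 1) $ i = det (\<chi> a b. if b = i then axis j 1 $ a else M \<mu> $ a $ b) / det (M \<mu>)"
      by (simp add: cramer[OF nz[OF that]])
    then show ?thesis by (simp add: matrix_vector_mult_axis)
  qed
  ultimately show ?thesis by (simp cong: holomorphic_cong)
qed

lemma matrix_entry_le_norm:
  "cmod ((M ** N) $ i $ j) \<le> norm (M *v (N *v axis j 1))" for M N :: "complex^'n^'n"
proof -
  have "(M ** N) $ i $ j = (M *v (N *v axis j 1)) $ i"
    by (simp add: matrix_vector_mul_assoc matrix_vector_mult_axis)
  then show ?thesis by (simp only: Finite_Cartesian_Product.norm_nth_le)
qed


text \<open>
  For \<open>W = (\<mu> A + B)\<^sup>-\<^sup>1 A\<close> the identity \<open>(\<mu> A + B) P = A (\<mu> + N)\<close> reads \<open>\<mu> W = P - W N\<close>; for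
  \<open>A (\<mu> A + B)\<^sup>-\<^sup>1\<close> one uses \<open>Q (\<mu> A + B) = (\<mu> + N') A\<close> in the same way.
\<close>

lemma spectral_projections:
  fixes A B :: "real^'n^'n"
  assumes ind: "index_le_one_with A B c1 c2"
    and P: "P = spectral_P\<^sub>1 A B c2" and Q: "Q = spectral_Q\<^sub>1 A B c2"
  shows "P ** P = P" "Q ** Q = Q" "A ** P = A" "Q ** A = A" "Q ** B = B ** P"
    "invertible (A + B ** (mat 1 - P))"
proof -
  obtain P' Q' N N' :: "real^'n^'n" where st:
    "P' ** P' = P'" "Q' ** Q' = Q'" "A ** P' = A" "Q' ** A = A" "Q' ** B = B ** P'"
    "B ** P' = A ** N" "Q' ** B = N' ** A" "invertible (A + B ** (mat 1 - P'))"
    using index_le_one_structure[OF ind] by metis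
  define C :: "real^'n^'n \<Rightarrow> complex^'n^'n" where "C = map_matrix complex_of_real"
  have C: "C (M ** M') = C M ** C M'" for M M'
    by (simp add: C_def vec_eq_iff matrix_matrix_mult_def)
  define M where "M = pencil A B"
  define S where "S = {\<mu>. det (M \<mu>) \<noteq> 0}"
  have M: "M \<mu> = (\<chi> i j. \<mu> * C A $ i $ j + C B $ i $ j)" for \<mu>
    by (simp add: M_def pencil_def C_def)
  have mat_entry: "(mat \<mu> ** K) $ i $ j = \<mu> * K $ i $ j" "(K ** mat \<mu>) $ i $ j = \<mu> * K $ i $ j"
    for \<mu> i j and K :: "complex^'n^'n"
    by (simp_all add: matrix_matrix_mult_def mat_def if_distrib[where f = "\<lambda>x. x * _"]
        if_distrib[where f = "\<lambda>x. _ * x"] cong: if_cong)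
  have M_mat: "M \<mu> = mat \<mu> ** C A + C B" "M \<mu> = C A ** mat \<mu> + C B" for \<mu>
    by (simp_all add: vec_eq_iff M mat_entry)
  have Mhol: "(\<lambda>\<mu>. M \<mu> $ i $ j) holomorphic_on X" for X i j
    unfolding M by (simp, intro holomorphic_intros)
  have "continuous_on UNIV (\<lambda>\<mu>. det (M \<mu>))"
    unfolding det_def by (intro continuous_intros holomorphic_on_imp_continuous_on Mhol)
  then have S_open: "open S" unfolding S_def
    by (intro open_Collect_neq) auto
  have c: "c1 > 0" "c2 > 0" using ind by (auto simp: index_le_one_with_def)
  have inv: "invertible (M \<mu>)" if "c2 \<le> cmod \<mu>" for \<mu>
    using ind that by (auto simp: index_le_one_with_def M_def)
  then have sub: "{\<mu>. c2 \<le> cmod \<mu>} \<subseteq> S" by (auto simp: S_def invertible_det_nz)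
  have Rhol: "(\<lambda>\<mu>. matrix_inv (M \<mu>) $ i $ j) holomorphic_on S" for i j
    by (rule holomorphic_matrix_inv) (auto simp: Mhol S_def)
  have Rbd: "norm (matrix_inv (M \<mu>) *v y) \<le> c1 * norm y" if "c2 \<le> cmod \<mu>" for \<mu> y
    using index_le_one_bound[OF ind that] by (simp add: M_def)
  have Rbd': "cmod (matrix_inv (M \<mu>) $ i $ j) \<le> c1" if "c2 \<le> cmod \<mu>" for \<mu> i j
    using matrix_entry_le_norm[of "matrix_inv (M \<mu>)" "mat 1" i j] Rbd[OF that, of "axis j 1"]
    by simp
  define L R where "L = (\<lambda>K :: complex^'n^'n. \<Sum>i\<in>UNIV. \<Sum>j\<in>UNIV. cmod (K $ i $ j))"
    and "R = (\<lambda>\<mu>. matrix_inv (M \<mu>))"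
  have RM: "R \<mu> ** M \<mu> = mat 1" "M \<mu> ** R \<mu> = mat 1" if "c2 \<le> cmod \<mu>" for \<mu>
    using invertible_matrix_inv[OF inv[OF that]] by (auto simp: R_def)
  have int1: "contour_integral (circlepath 0 c2) (\<lambda>\<mu>. (R \<mu> ** C A) $ i $ j)
      = 2 * of_real pi * \<i> * C P' $ i $ j" for i j
  proof (rule contour_integral_matrix_entry[OF S_open _ sub c(2),
        where K = "L (C A) * c1" and L = "\<lambda>W. W ** C N" and ?K0.0 = "L (C N)"])
    show "(\<lambda>\<mu>. (R \<mu> ** C A) $ i $ j) holomorphic_on S" for i j
      unfolding matrix_matrix_mult_def R_def by (simp, intro holomorphic_intros Rhol)
    show "cmod ((R \<mu> ** C A) $ i $ j) \<le> L (C A) * c1" if "c2 \<le> cmod \<mu>" for \<mu> i j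
      unfolding L_def by (rule cmod_matrix_mult_entry_le(1)) (simp add: R_def Rbd' that)
    show "cmod ((K ** C N) $ i $ j) \<le> L (C N) * b" if "\<And>i j. cmod (K $ i $ j) \<le> b" for K :: "complex^'n^'n" and b i j
      unfolding L_def by (rule cmod_matrix_mult_entry_le(1)) (rule that)
    fix \<mu> i j assume \<mu>: "c2 \<le> cmod \<mu>"
    have "M \<mu> ** C P' = C A ** mat \<mu> + C A ** C N"
      by (simp add: M_mat(1) matrix_add_rdistrib matrix_mul_assoc[symmetric] C[symmetric] st)
        (simp add: vec_eq_iff mat_entry)
    then have "R \<mu> ** (M \<mu> ** C P') = (R \<mu> ** C A) ** mat \<mu> + R \<mu> ** C A ** C N"
      by (simp add: matrix_add_ldistrib matrix_mul_assoc)
    then have "C P' = (R \<mu> ** C A) ** mat \<mu> + R \<mu> ** C A ** C N"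
      by (simp add: matrix_mul_assoc RM[OF \<mu>])
    then show "\<mu> * (R \<mu> ** C A) $ i $ j = C P' $ i $ j - (R \<mu> ** C A ** C N) $ i $ j"
      by (simp add: mat_entry)
  qed
  have int2: "contour_integral (circlepath 0 c2) (\<lambda>\<mu>. (C A ** R \<mu>) $ i $ j)
      = 2 * of_real pi * \<i> * C Q' $ i $ j" for i j
  proof (rule contour_integral_matrix_entry[OF S_open _ sub c(2),
        where K = "L (C A) * c1" and L = "\<lambda>W. C N' ** W" and ?K0.0 = "L (C N')"])
    show "(\<lambda>\<mu>. (C A ** R \<mu>) $ i $ j) holomorphic_on S" for i j
      unfolding matrix_matrix_mult_def R_def by (simp, intro holomorphic_intros Rhol)
    show "cmod ((C A ** R \<mu>) $ i $ j) \<le> L (C A) * c1" if "c2 \<le> cmod \<mu>" for \<mu> i j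
      unfolding L_def by (rule cmod_matrix_mult_entry_le(2)) (simp add: R_def Rbd' that)
    show "cmod ((C N' ** K) $ i $ j) \<le> L (C N') * b" if "\<And>i j. cmod (K $ i $ j) \<le> b" for K :: "complex^'n^'n" and b i j
      unfolding L_def by (rule cmod_matrix_mult_entry_le(2)) (rule that)
    fix \<mu> i j assume \<mu>: "c2 \<le> cmod \<mu>"
    have "C Q' ** M \<mu> = mat \<mu> ** C A + C N' ** C A"
      by (simp add: M_mat(2) matrix_add_ldistrib matrix_mul_assoc C[symmetric] st(4,7))
        (simp add: vec_eq_iff mat_entry)
    then have "(C Q' ** M \<mu>) ** R \<mu> = mat \<mu> ** (C A ** R \<mu>) + C N' ** (C A ** R \<mu>)"
      by (simp add: matrix_add_rdistrib matrix_mul_assoc)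
    then have "C Q' = mat \<mu> ** (C A ** R \<mu>) + C N' ** (C A ** R \<mu>)"
      by (simp add: matrix_mul_assoc[symmetric] RM[OF \<mu>])
    then show "\<mu> * (C A ** R \<mu>) $ i $ j = C Q' $ i $ j - (C N' ** (C A ** R \<mu>)) $ i $ j"
      by (simp add: mat_entry)
  qed
  have "P = P'" unfolding P spectral_P\<^sub>1_def
    using int1[unfolded R_def M_def C_def] by (simp add: vec_eq_iff)
  moreover have "Q = Q'" unfolding Q spectral_Q\<^sub>1_def
    using int2[unfolded R_def M_def C_def] by (simp add: vec_eq_iff)
  ultimately show "P ** P = P" "Q ** Q = Q" "A ** P = A" "Q ** A = A" "Q ** B = B ** P"
    "invertible (A + B ** (mat 1 - P))"
    using st by auto
qed

section \<open>Parametrised implicit functions\<close>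

lemma dist_Pair_le: "dist (a, b) (c, d) \<le> dist a c + dist b d"
  by (simp add: dist_Pair_Pair sqrt_sum_squares_le_sum)

text \<open>
  Strict differentiability, uniformly in the parameter: the derivative in \<open>x\<close> is jointly continuous,
  although \<open>\<phi>\<close> need not be differentiable in \<open>t\<close>.
\<close>

lemma C1_linear_approx:
  fixes \<phi> :: "real \<Rightarrow> 'a::real_normed_vector \<Rightarrow> 'b::real_normed_vector"
  assumes der: "\<And>t x. t \<in> J \<Longrightarrow> (\<phi> t has_derivative blinfun_apply (D t x)) (at x)"
    and cont: "continuous_on (J \<times> UNIV) (\<lambda>(t, x). D t x)"
    and t0: "t0 \<in> J" and e: "e > 0"
  obtains \<delta> where "\<delta> > 0"
    "\<And>t x y. t \<in> J \<Longrightarrow> \<bar>t - t0\<bar> \<le> \<delta> \<Longrightarrow> x \<in> cball x0 \<delta> \<Longrightarrow> y \<in> cball x0 \<delta> \<Longrightarrow>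
       norm (\<phi> t x - \<phi> t y - D t0 x0 (x - y)) \<le> e * norm (x - y)"
proof -
  obtain d where d: "d > 0"
    and dd: "\<And>t x. t \<in> J \<Longrightarrow> dist (t, x) (t0, x0) < d \<Longrightarrow> dist (D t x) (D t0 x0) < e"
    using cont t0 e unfolding continuous_on_iff by fastforce
  show thesis
  proof (rule that[of "d / 3"])
    show "d / 3 > 0" using d by simp
    fix t x y assume t: "t \<in> J" "\<bar>t - t0\<bar> \<le> d / 3" and xy: "x \<in> cball x0 (d / 3)" "y \<in> cball x0 (d / 3)"
    define f where "f = (\<lambda>x. \<phi> t x - D t0 x0 x)"
    have "norm (f x - f y) \<le> e * norm (x - y)"
    proof (rule differentiable_bound[of "cball x0 (d / 3)" f "\<lambda>x h. D t x h - D t0 x0 h"])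
      show "convex (cball x0 (d / 3))" by simp
      show "x \<in> cball x0 (d / 3)" "y \<in> cball x0 (d / 3)" by fact+
      fix w assume w: "w \<in> cball x0 (d / 3)"
      show "(f has_derivative (\<lambda>h. D t w h - D t0 x0 h)) (at w within cball x0 (d / 3))"
        unfolding f_def
        by (intro has_derivative_diff has_derivative_at_withinI[OF der[OF t(1)]]
            bounded_linear_imp_has_derivative blinfun.bounded_linear_right)
      have "dist (t, w) (t0, x0) \<le> \<bar>t - t0\<bar> + dist x0 w"
        using dist_Pair_le[of t w t0 x0] by (simp add: dist_real_def dist_commute)
      also have "\<dots> < d" using t(2) w d by simp
      finally have "norm (D t w - D t0 x0) < e" using dd[OF t(1), of w] by (simp add: dist_norm)
      then show "onorm (\<lambda>h. D t w h - D t0 x0 h) \<le> e"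
        by (simp add: norm_blinfun.rep_eq minus_blinfun.rep_eq)
    qed
    then show "norm (\<phi> t x - \<phi> t y - D t0 x0 (x - y)) \<le> e * norm (x - y)"
      by (simp add: f_def blinfun.diff_right algebra_simps)
  qed
qed

lemma C1_local_lipschitz:
  fixes \<phi> :: "real \<Rightarrow> 'a::real_normed_vector \<Rightarrow> 'b::real_normed_vector"
  assumes der: "\<And>t x. t \<in> J \<Longrightarrow> (\<phi> t has_derivative blinfun_apply (D t x)) (at x)"
    and cont: "continuous_on (J \<times> UNIV) (\<lambda>(t, x). D t x)"
  shows "local_lipschitz J UNIV \<phi>"
proof (rule local_lipschitzI)
  fix t0 x0 assume t0: "t0 \<in> J"
  obtain \<delta> where \<delta>: "\<delta> > 0"
    "\<And>t x y. t \<in> J \<Longrightarrow> \<bar>t - t0\<bar> \<le> \<delta> \<Longrightarrow> x \<in> cball x0 \<delta> \<Longrightarrow> y \<in> cball x0 \<delta> \<Longrightarrow>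
       norm (\<phi> t x - \<phi> t y - D t0 x0 (x - y)) \<le> 1 * norm (x - y)"
    using C1_linear_approx[OF der cont t0, where e = 1 and ?x0.0 = x0] by (metis zero_less_one)
  show "\<exists>u>0. \<exists>L. \<forall>t\<in>cball t0 u \<inter> J. L-lipschitz_on (cball x0 u \<inter> UNIV) (\<phi> t)"
  proof (intro exI conjI ballI lipschitz_onI)
    show "\<delta> > 0" by fact
    fix t x y assume t: "t \<in> cball t0 \<delta> \<inter> J" and xy: "x \<in> cball x0 \<delta> \<inter> UNIV" "y \<in> cball x0 \<delta> \<inter> UNIV"
    have "norm (\<phi> t x - \<phi> t y - D t0 x0 (x - y)) \<le> 1 * norm (x - y)"
      using \<delta>(2)[of t x y] t xy by (auto simp: dist_real_def abs_minus_commute)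
    moreover have "norm (D t0 x0 (x - y)) \<le> norm (D t0 x0) * norm (x - y)" by (rule norm_blinfun)
    ultimately show "dist (\<phi> t x) (\<phi> t y) \<le> (norm (D t0 x0) + 1) * dist x y"
      using norm_triangle_sub[of "\<phi> t x - \<phi> t y" "D t0 x0 (x - y)"]
      by (simp add: dist_norm algebra_simps)
  qed simp
qed

text \<open>
  The simplified Newton map \<open>x \<mapsto> x - A\<^sup>-\<^sup>1 (x - \<phi>(t, x) - z)\<close>, where \<open>A = I - D\<^sub>x\<phi>(t\<^sub>0, x\<^sub>0)\<close>, is a
  contraction of a small ball for all \<open>(t, z)\<close> near the base point.  The radius \<open>\<rho>\<close> can be made as small as
  desired, which is what yields continuity in \<open>(t, z)\<close> in the global version below.
\<close>

lemma implicit_function_local: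
  fixes \<phi> :: "real \<Rightarrow> 'a::euclidean_space \<Rightarrow> 'a"
  assumes der: "\<And>t x. t \<in> J \<Longrightarrow> (\<phi> t has_derivative blinfun_apply (D t x)) (at x)"
    and contD: "continuous_on (J \<times> UNIV) (\<lambda>(t, x). D t x)"
    and cont: "continuous_on J (\<lambda>t. \<phi> t x0)"
    and t0: "t0 \<in> J" and inj: "\<And>v. D t0 x0 v = v \<Longrightarrow> v = 0" and e: "e > 0"
  obtains \<delta> \<rho> L where "\<delta> > 0" "\<rho> > 0" "\<rho> \<le> e" "L \<ge> 0"
    "\<And>t z. t \<in> J \<Longrightarrow> \<bar>t - t0\<bar> \<le> \<delta> \<Longrightarrow> norm (z - (x0 - \<phi> t0 x0)) \<le> \<delta> \<Longrightarrow>
       \<exists>x\<in>cball x0 \<rho>. x - \<phi> t x = z"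
    "\<And>t x y. t \<in> J \<Longrightarrow> \<bar>t - t0\<bar> \<le> \<delta> \<Longrightarrow> x \<in> cball x0 \<rho> \<Longrightarrow> y \<in> cball x0 \<rho> \<Longrightarrow>
       norm (x - y) \<le> L * norm ((x - \<phi> t x) - (y - \<phi> t y))"
proof -
  define A where "A = (\<lambda>v. v - D t0 x0 v)"
  have linA: "linear A" unfolding A_def
    by (intro linear_compose_sub linear_ident bounded_linear.linear blinfun.bounded_linear_right)
  have "inj A" using inj by (subst linear_injective_0[OF linA]) (auto simp: A_def)
  then obtain c where c: "c > 0" "\<And>v. c * norm v \<le> norm (A v)"
    using linear_inj_bounded_below_pos[OF linA] by metis
  have "surj A" using \<open>inj A\<close> linA linear_injective_imp_surjective by blast
  then have A': "A (inv A y) = y" for y by (simp add: surj_f_inv_f)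
  define F where "F = (\<lambda>t x. x - \<phi> t x)"
  obtain d where d: "d > 0"
    "\<And>t x y. t \<in> J \<Longrightarrow> \<bar>t - t0\<bar> \<le> d \<Longrightarrow> x \<in> cball x0 d \<Longrightarrow> y \<in> cball x0 d \<Longrightarrow>
       norm (\<phi> t x - \<phi> t y - D t0 x0 (x - y)) \<le> c / 2 * norm (x - y)"
    using C1_linear_approx[OF der contD t0, where e = "c / 2" and ?x0.0 = x0] c(1) by (metis half_gt_zero)
  have lin: "norm (A (x - y) - (F t x - F t y)) \<le> c / 2 * norm (x - y)"
    if "t \<in> J" "\<bar>t - t0\<bar> \<le> d" "x \<in> cball x0 d" "y \<in> cball x0 d" for t x y
  proof -
    have "A (x - y) - (F t x - F t y) = \<phi> t x - \<phi> t y - D t0 x0 (x - y)"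
      by (simp add: A_def F_def)
    then show ?thesis using d(2)[OF that] by simp
  qed
  define \<rho> where "\<rho> = min d e"
  have \<rho>: "\<rho> > 0" "\<rho> \<le> d" "\<rho> \<le> e" using d e by (auto simp: \<rho>_def)
  obtain d' where d': "d' > 0" "\<And>t. t \<in> J \<Longrightarrow> \<bar>t - t0\<bar> < d' \<Longrightarrow> norm (\<phi> t x0 - \<phi> t0 x0) < c * \<rho> / 4"
    using cont t0 c(1) \<rho>(1) unfolding continuous_on_iff dist_norm real_norm_def
    by (metis divide_pos_pos mult_pos_pos zero_less_numeral)
  define \<delta> where "\<delta> = min (min d (d' / 2)) (c * \<rho> / 4)"
  have \<delta>: "\<delta> > 0" "\<delta> \<le> d" "\<delta> < d'" "\<delta> \<le> c * \<rho> / 4" using d d' c \<rho> by (auto simp: \<delta>_def min_def)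
  show thesis
  proof (rule that[of \<delta> \<rho> "2 / c"])
    show "\<delta> > 0" "\<rho> > 0" "\<rho> \<le> e" "0 \<le> 2 / c" using \<delta> \<rho> c by auto
    fix t assume t: "t \<in> J" "\<bar>t - t0\<bar> \<le> \<delta>"
    have lin\<rho>: "norm (A (x - y) - (F t x - F t y)) \<le> c / 2 * norm (x - y)"
      if "x \<in> cball x0 \<rho>" "y \<in> cball x0 \<rho>" for x y
      using lin[of t x y] t \<delta> \<rho> that by simp
    show "norm (x - y) \<le> 2 / c * norm ((x - \<phi> t x) - (y - \<phi> t y))"
      if "x \<in> cball x0 \<rho>" "y \<in> cball x0 \<rho>" for x y
    proof -
      have "c * norm (x - y) \<le> norm (F t x - F t y) + c / 2 * norm (x - y)"
        using c(2)[of "x - y"] lin\<rho>[OF that] norm_triangle_sub[of "A (x - y)" "F t x - F t y"] by linarith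
      then show ?thesis using c(1) by (simp add: F_def field_simps)
    qed
    fix z assume z: "norm (z - (x0 - \<phi> t0 x0)) \<le> \<delta>"
    define S where "S = (\<lambda>x. x - inv A (F t x - z))"
    have contr: "norm (S x - S y) \<le> 1 / 2 * norm (x - y)"
      if "x \<in> cball x0 \<rho>" "y \<in> cball x0 \<rho>" for x y
    proof -
      have "A (S x - S y) = A (x - y) - (F t x - F t y)"
        by (simp add: S_def linear_diff[OF linA] A')
      then have "c * norm (S x - S y) \<le> c / 2 * norm (x - y)"
        using c(2)[of "S x - S y"] lin\<rho>[OF that] by simp
      then show ?thesis using c(1) by simp
    qed
    have "norm (F t x0 - z) \<le> norm (\<phi> t x0 - \<phi> t0 x0) + norm (z - (x0 - \<phi> t0 x0))"
    proof -
      have "F t x0 - z = - (\<phi> t x0 - \<phi> t0 x0) - (z - (x0 - \<phi> t0 x0))" by (simp add: F_def)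
      then show ?thesis by (metis norm_minus_cancel norm_triangle_ineq4)
    qed
    also have "\<dots> \<le> c * \<rho> / 4 + c * \<rho> / 4"
      using d'(2)[of t] t \<delta> z by (intro add_mono) auto
    finally have "c * norm (inv A (F t x0 - z)) \<le> c * (\<rho> / 2)"
      using c(2)[of "inv A (F t x0 - z)"] A' by (simp add: mult.commute)
    then have S0: "norm (S x0 - x0) \<le> \<rho> / 2" using c(1) by (simp add: S_def)
    have "\<exists>!x\<in>cball x0 \<rho>. S x = x"
    proof (rule Banach_fix[where c = "1 / 2"])
      show "complete (cball x0 \<rho>)" by (simp add: complete_eq_closed)
      show "cball x0 \<rho> \<noteq> {}" using \<rho> by simp
      show "S ` cball x0 \<rho> \<subseteq> cball x0 \<rho>"
      proof safe
        fix x assume x: "x \<in> cball x0 \<rho>"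
        have "norm (S x - x0) \<le> norm (S x - S x0) + norm (S x0 - x0)"
          by (metis diff_add_cancel norm_triangle_ineq add_diff_eq)
        also have "\<dots> \<le> 1 / 2 * norm (x - x0) + \<rho> / 2"
          using \<rho> by (intro add_mono contr x S0) auto
        also have "\<dots> \<le> \<rho>" using x by (simp add: dist_norm norm_minus_commute)
        finally show "S x \<in> cball x0 \<rho>" by (simp add: dist_norm norm_minus_commute)
      qed
      show "dist (S x) (S y) \<le> 1 / 2 * dist x y" if "x \<in> cball x0 \<rho>" "y \<in> cball x0 \<rho>" for x y
        using contr[OF that] by (simp add: dist_norm)
    qed auto
    then obtain x where x: "x \<in> cball x0 \<rho>" "S x = x" by blast
    have "A 0 = F t x - z" using x(2) A'[of "F t x - z"] by (simp add: S_def)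
    then have "F t x = z" by (simp add: linear_0[OF linA])
    then show "\<exists>x\<in>cball x0 \<rho>. x - \<phi> t x = z" using x by (auto simp: F_def)
  qed
qed

text \<open>
  The local solution near a given one is the global one by uniqueness, so \<open>X\<close> inherits continuity and the
  Lipschitz estimate.  The set \<open>Z\<close> of right-hand sides is allowed to have empty interior; it will be the
  subspace \<open>X\<^sub>1\<close>.
\<close>

lemma implicit_function_global:
  fixes \<phi> :: "real \<Rightarrow> 'a::euclidean_space \<Rightarrow> 'a"
  assumes der: "\<And>t x. t \<in> J \<Longrightarrow> (\<phi> t has_derivative blinfun_apply (D t x)) (at x)"
    and contD: "continuous_on (J \<times> UNIV) (\<lambda>(t, x). D t x)"
    and cont: "continuous_on (J \<times> UNIV) (\<lambda>(t, x). \<phi> t x)"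
    and sol: "\<And>t z. t \<in> J \<Longrightarrow> z \<in> Z \<Longrightarrow> X t z - \<phi> t (X t z) = z"
    and uniq: "\<And>t x y. t \<in> J \<Longrightarrow> x - \<phi> t x \<in> Z \<Longrightarrow> x - \<phi> t x = y - \<phi> t y \<Longrightarrow> x = y"
    and inj: "\<And>t x v. t \<in> J \<Longrightarrow> x - \<phi> t x \<in> Z \<Longrightarrow> D t x v = v \<Longrightarrow> v = 0"
  shows "continuous_on (J \<times> Z) (\<lambda>(t, z). X t z)" "local_lipschitz J Z X"
proof -
  have contt: "continuous_on J (\<lambda>t. \<phi> t x)" for x
    by (rule continuous_on_case_prod[OF cont]) (auto intro: continuous_intros)
  have near: "X t z \<in> cball (X t0 z0) \<rho>"
    if ex: "\<exists>x\<in>cball (X t0 z0) \<rho>. x - \<phi> t x = z" and "t \<in> J" "z \<in> Z" for t z t0 z0 \<rho>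
    using ex sol[of t z] uniq[of t] that by metis
  show "continuous_on (J \<times> Z) (\<lambda>(t, z). X t z)"
    unfolding continuous_on_iff
  proof (intro ballI allI impI)
    fix p and e :: real assume p: "p \<in> J \<times> Z" and e: "e > 0"
    obtain t0 z0 where tz0: "p = (t0, z0)" and t0: "t0 \<in> J" and z0: "z0 \<in> Z" using p by auto
    have I: "D t0 (X t0 z0) v = v \<Longrightarrow> v = 0" for v using inj[OF t0, of "X t0 z0" v] sol t0 z0 by auto
    obtain \<delta> \<rho> where \<delta>: "\<delta> > 0" "\<rho> \<le> e / 2"
      and ex: "\<And>t z. t \<in> J \<Longrightarrow> \<bar>t - t0\<bar> \<le> \<delta> \<Longrightarrow> norm (z - z0) \<le> \<delta> \<Longrightarrow> \<exists>x\<in>cball (X t0 z0) \<rho>. x - \<phi> t x = z"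
      using implicit_function_local[where e = "e / 2", OF der contD contt t0 I] e sol[OF t0 z0] by (metis half_gt_zero)
    show "\<exists>d>0. \<forall>x'\<in>J \<times> Z. dist x' p < d \<longrightarrow> dist (case x' of (t, z) \<Rightarrow> X t z) (case p of (t, z) \<Rightarrow> X t z) < e"
      unfolding tz0 prod.case
    proof (intro exI conjI ballI impI)
      show "\<delta> > 0" by fact
      fix x' assume x': "x' \<in> J \<times> Z" "dist x' (t0, z0) < \<delta>"
      obtain t z where tz: "x' = (t, z)" "t \<in> J" "z \<in> Z" using x' by auto
      have "\<bar>t - t0\<bar> \<le> \<delta>" "norm (z - z0) \<le> \<delta>"
        using x'(2) dist_fst_le[of x' "(t0, z0)"] dist_snd_le[of x' "(t0, z0)"]
        by (auto simp: tz dist_norm)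
      from near[OF ex[OF tz(2) this] tz(2,3)] show "dist (case x' of (t, z) \<Rightarrow> X t z) (X t0 z0) < e"
        using \<delta>(2) e by (simp add: tz dist_commute)
    qed
  qed
  show "local_lipschitz J Z X"
  proof (rule local_lipschitzI)
    fix t0 z0 assume t0: "t0 \<in> J" and z0: "z0 \<in> Z"
    have I: "D t0 (X t0 z0) v = v \<Longrightarrow> v = 0" for v using inj[OF t0, of "X t0 z0" v] sol t0 z0 by auto
    obtain \<delta> \<rho> L where \<delta>: "\<delta> > 0" "L \<ge> 0"
      and ex: "\<And>t z. t \<in> J \<Longrightarrow> \<bar>t - t0\<bar> \<le> \<delta> \<Longrightarrow> norm (z - z0) \<le> \<delta> \<Longrightarrow> \<exists>x\<in>cball (X t0 z0) \<rho>. x - \<phi> t x = z"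
      and lip: "\<And>t x y. t \<in> J \<Longrightarrow> \<bar>t - t0\<bar> \<le> \<delta> \<Longrightarrow> x \<in> cball (X t0 z0) \<rho> \<Longrightarrow> y \<in> cball (X t0 z0) \<rho> \<Longrightarrow>
       norm (x - y) \<le> L * norm ((x - \<phi> t x) - (y - \<phi> t y))"
      using implicit_function_local[where e = 1, OF der contD contt t0 I] sol[OF t0 z0] by (metis zero_less_one)
    show "\<exists>u>0. \<exists>L. \<forall>t\<in>cball t0 u \<inter> J. L-lipschitz_on (cball z0 u \<inter> Z) (X t)"
    proof (intro exI conjI ballI lipschitz_onI)
      fix t z w assume t: "t \<in> cball t0 \<delta> \<inter> J" and zw: "z \<in> cball z0 \<delta> \<inter> Z" "w \<in> cball z0 \<delta> \<inter> Z"
      have t': "\<bar>t - t0\<bar> \<le> \<delta>" "t \<in> J" using t by (auto simp: dist_norm)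
      have "X t z \<in> cball (X t0 z0) \<rho>" "X t w \<in> cball (X t0 z0) \<rho>"
        using zw t' by (auto intro!: near ex simp del: mem_cball) (auto simp: dist_norm norm_minus_commute)
      from lip[OF t'(2,1) this] show "dist (X t z) (X t w) \<le> L * dist z w"
        using zw by (simp add: sol[OF t'(2)] dist_norm)
    qed (use \<delta> in auto)
  qed
qed

lemma local_lipschitz_compose_implicit:
  fixes \<gamma> :: "real \<Rightarrow> 'a::real_normed_vector \<Rightarrow> 'b::real_normed_vector" and P :: "'c::real_normed_vector \<Rightarrow> 'd::real_normed_vector"
  assumes \<gamma>: "local_lipschitz J UNIV \<gamma>"
    and X: "continuous_on (J \<times> Z) (\<lambda>(t, z). X t z)" "local_lipschitz J Z X"
    and P: "bounded_linear P" "range P \<subseteq> Z"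
  shows "local_lipschitz J UNIV (\<lambda>t z. \<gamma> t (X t (P z)))"
proof (rule local_lipschitzI)
  fix t0 z0 assume t0: "t0 \<in> J"
  obtain C where C: "C > 0" "\<And>z. norm (P z) \<le> norm z * C"
    using bounded_linear.pos_bounded[OF P(1)] by auto
  have PC: "dist (P z) (P w) \<le> C * dist z w" for z w
    using C(2)[of "z - w"] by (simp add: dist_norm bounded_linear.linear[OF P(1)] linear_diff mult.commute)
  have PZ: "P z \<in> Z" for z using P by auto
  obtain u L where u: "u > 0" and L: "\<And>s. s \<in> cball t0 u \<inter> J \<Longrightarrow> L-lipschitz_on (cball (P z0) u \<inter> Z) (X s)"
    using local_lipschitzE[OF X(2) t0 PZ] by blast
  obtain v M where v: "v > 0" and M: "\<And>s. s \<in> cball t0 v \<inter> J \<Longrightarrow> M-lipschitz_on (cball (X t0 (P z0)) v \<inter> UNIV) (\<gamma> s)"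
    using local_lipschitzE[OF \<gamma> t0 UNIV_I] by blast
  obtain d where d: "d > 0" "\<And>t z. t \<in> J \<Longrightarrow> z \<in> Z \<Longrightarrow> dist (t, z) (t0, P z0) < d \<Longrightarrow> dist (X t z) (X t0 (P z0)) < v"
    using X(1) t0 PZ[of z0] v unfolding continuous_on_iff by fastforce
  have L0: "L \<ge> 0" "M \<ge> 0" using lipschitz_on_nonneg[OF L[of t0]] lipschitz_on_nonneg[OF M[of t0]] t0 u v by auto
  define r where "r = min (min u v) (min (u / C) (min (d / 3) (d / (3 * C))))"
  have r: "r > 0" "r \<le> u" "r \<le> v" "C * r \<le> u" "r \<le> d / 3" "C * r \<le> d / 3"
  proof -
    show "r > 0" using u v C(1) d(1) by (simp add: r_def)
    show "r \<le> u" "r \<le> v" "r \<le> d / 3" unfolding r_def by linarith+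
    have "r \<le> u / C" "r \<le> d / (3 * C)" unfolding r_def by linarith+
    then show "C * r \<le> u" "C * r \<le> d / 3" using C(1) by (auto simp: field_simps)
  qed
  show "\<exists>u>0. \<exists>L. \<forall>t\<in>cball t0 u \<inter> J. L-lipschitz_on (cball z0 u \<inter> UNIV) (\<lambda>z. \<gamma> t (X t (P z)))"
  proof (intro exI conjI ballI lipschitz_onI)
    show "r > 0" by fact
    show "0 \<le> M * (L * C)" using L0 C by simp
    fix t z w assume t: "t \<in> cball t0 r \<inter> J" and zw: "z \<in> cball z0 r \<inter> UNIV" "w \<in> cball z0 r \<inter> UNIV"
    have P_near: "dist (P y) (P z0) \<le> C * r" if "y \<in> cball z0 r" for y
    proof -
      have "dist (P y) (P z0) \<le> C * dist y z0" by (rule PC)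
      also have "\<dots> \<le> C * r" using that C(1) by (simp add: dist_commute)
      finally show ?thesis .
    qed
    have X_near: "X t (P y) \<in> cball (X t0 (P z0)) v" if "y \<in> cball z0 r" for y
    proof -
      have "dist (t, P y) (t0, P z0) \<le> dist t t0 + dist (P y) (P z0)"
        by (rule dist_Pair_le)
      also have "\<dots> < d" using t P_near[OF that] r d(1) by (auto simp: dist_commute)
      finally show ?thesis using d(2)[of t "P y"] t PZ by (auto simp: dist_commute)
    qed
    have "dist (\<gamma> t (X t (P z))) (\<gamma> t (X t (P w))) \<le> M * dist (X t (P z)) (X t (P w))"
      using M[of t] t r X_near zw by (intro lipschitz_onD[OF M]) auto
    also have "dist (X t (P z)) (X t (P w)) \<le> L * dist (P z) (P w)"
      using t r zw P_near[of z] P_near[of w] PZ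
      by (intro lipschitz_onD[OF L]) (auto simp: dist_commute)
    also have "dist (P z) (P w) \<le> C * dist z w" by (rule PC)
    finally show "dist (\<gamma> t (X t (P z))) (\<gamma> t (X t (P w))) \<le> M * (L * C) * dist z w"
      using L0 by (simp add: mult_left_mono mult.assoc)
  qed
qed

section \<open>Ordinary differential equations\<close>

lemma integral_exp_shift:
  fixes K a \<tau> :: real
  assumes "K > 0" "a \<le> \<tau>"
  shows "((\<lambda>s. exp (K * (s - a))) has_integral (exp (K * (\<tau> - a)) - 1) / K) {a..\<tau>}"
proof -
  have "((\<lambda>s. exp (K * (s - a))) has_integral exp (K * (\<tau> - a)) / K - exp (K * (a - a)) / K) {a..\<tau>}"
    using assms
    by (intro fundamental_theorem_of_calculus)
      (auto intro!: derivative_eq_intros simp: has_real_derivative_iff_has_vector_derivative[symmetric])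
  then show ?thesis by (simp add: diff_divide_distrib)
qed

text \<open>
  Bielecki's version of Picard's proof: measuring functions with the weight \<open>exp (- K (t - a))\<close> makes the
  integral operator a contraction on the whole interval at once.  The operator acts on the weighted
  function \<open>w(t) = exp (- K (t - a)) z(t)\<close>, extended to the real line by constants.
\<close>

lemma picard_lindelof_global_lipschitz:
  fixes g :: "real \<Rightarrow> 'a::euclidean_space \<Rightarrow> 'a"
  assumes ab: "a \<le> b" and cont: "continuous_on ({a..b} \<times> UNIV) (\<lambda>(t, x). g t x)"
    and lip: "\<And>t. t \<in> {a..b} \<Longrightarrow> L-lipschitz_on UNIV (g t)"
  obtains z where "z a = z0" "\<And>t. t \<in> {a..b} \<Longrightarrow> (z has_vector_derivative g t (z t)) (at t within {a..b})"
proof -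
  have L: "L \<ge> 0" using lipschitz_on_nonneg[OF lip[of a]] ab by simp
  \<comment> \<open>the contraction constant is \<open>L / K\<close>\<close>
  define K where "K = 2 * L + 1"
  have K: "K > 0" "L / K \<le> 1 / 2" using L by (auto simp: K_def field_simps)
  define c where "c = (\<lambda>t. max a (min b t))"
  have c: "c t \<in> {a..b}" for t using ab by (auto simp: c_def)
  have c_id: "c t = t" if "t \<in> {a..b}" for t using that by (auto simp: c_def)
  have c_cont: "continuous_on UNIV c" unfolding c_def by (intro continuous_intros)
  define Y where "Y = (\<lambda>(w :: real \<Rightarrow>\<^sub>C 'a) s. exp (K * (s - a)) *\<^sub>R apply_bcontfun w s)"
  have gY: "continuous_on {a..b} (\<lambda>s. g s (Y w s))" for w
    unfolding Y_def by (rule continuous_on_case_prod[OF cont]) (auto intro!: continuous_intros)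
  have gY_int: "(\<lambda>s. g s (Y w s)) integrable_on {a..t}" if "t \<in> {a..b}" for w t
    using that by (intro integrable_continuous_real continuous_on_subset[OF gY]) auto
  define F where "F = (\<lambda>w t. exp (- K * (t - a)) *\<^sub>R (z0 + integral {a..t} (\<lambda>s. g s (Y w s))))"
  have F_cont: "continuous_on {a..b} (F w)" for w unfolding F_def
    by (intro continuous_intros indefinite_integral_continuous_1 gY_int) (use ab in auto)
  have Fc: "(\<lambda>t. F w (c t)) \<in> bcontfun" for w
  proof -
    have "continuous_on UNIV (\<lambda>t. F w (c t))"
      by (rule continuous_on_compose2[OF F_cont c_cont]) (use c in auto)
    moreover have "bounded (F w ` {a..b})"
      using F_cont compact_continuous_image compact_imp_bounded by blast
    then have "bounded (range (\<lambda>t. F w (c t)))"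
      by (rule bounded_subset) (use c in auto)
    ultimately show ?thesis by (simp add: bcontfun_def)
  qed
  define T where "T = (\<lambda>w. Bcontfun (\<lambda>t. F w (c t)))"
  have T: "apply_bcontfun (T w) t = F w (c t)" for w t
    by (simp add: T_def Bcontfun_inverse[OF Fc])
  have "dist (T w) (T w') \<le> 1 / 2 * dist w w'" for w w'
  proof (rule dist_bound)
    fix t
    define \<tau> where "\<tau> = c t"
    have \<tau>: "\<tau> \<in> {a..b}" using c by (simp add: \<tau>_def)
    have "norm (integral {a..\<tau>} (\<lambda>s. g s (Y w s) - g s (Y w' s)))
        \<le> integral {a..\<tau>} (\<lambda>s. exp (K * (s - a)) * (L * dist w w'))"
    proof (rule integral_norm_bound_integral)
      show "(\<lambda>s. g s (Y w s) - g s (Y w' s)) integrable_on {a..\<tau>}"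
        by (intro integrable_diff gY_int \<tau>)
      show "(\<lambda>s. exp (K * (s - a)) * (L * dist w w')) integrable_on {a..\<tau>}"
        by (intro integrable_continuous_real continuous_intros)
      fix s assume s: "s \<in> {a..\<tau>}"
      have "norm (g s (Y w s) - g s (Y w' s)) \<le> L * norm (Y w s - Y w' s)"
        using lipschitz_onD[OF lip[of s], of "Y w s" "Y w' s"] s \<tau> by (simp add: dist_norm)
      also have "norm (Y w s - Y w' s) = exp (K * (s - a)) * dist (apply_bcontfun w s) (apply_bcontfun w' s)"
        by (simp add: Y_def dist_norm scaleR_diff_right[symmetric])
      also have "L * \<dots> \<le> L * (exp (K * (s - a)) * dist w w')"
        using L by (intro mult_left_mono dist_bounded) auto
      finally show "norm (g s (Y w s) - g s (Y w' s)) \<le> exp (K * (s - a)) * (L * dist w w')"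
        by (simp add: mult_ac)
    qed
    also have "\<dots> = (exp (K * (\<tau> - a)) - 1) / K * (L * dist w w')"
      using \<tau> by (intro integral_unique has_integral_mult_left integral_exp_shift K) auto
    finally have int: "norm (integral {a..\<tau>} (\<lambda>s. g s (Y w s) - g s (Y w' s)))
        \<le> (exp (K * (\<tau> - a)) - 1) / K * (L * dist w w')" .
    have "F w \<tau> - F w' \<tau> = exp (- K * (\<tau> - a)) *\<^sub>R integral {a..\<tau>} (\<lambda>s. g s (Y w s) - g s (Y w' s))"
      unfolding F_def by (subst integral_diff[OF gY_int[OF \<tau>] gY_int[OF \<tau>]])
        (simp add: algebra_simps)
    then have "dist (F w \<tau>) (F w' \<tau>) = exp (- K * (\<tau> - a)) * norm (integral {a..\<tau>} (\<lambda>s. g s (Y w s) - g s (Y w' s)))"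
      by (simp add: dist_norm)
    also have "\<dots> \<le> exp (- K * (\<tau> - a)) * ((exp (K * (\<tau> - a)) - 1) / K * (L * dist w w'))"
      by (intro mult_left_mono int) auto
    also have "\<dots> = (1 - exp (- K * (\<tau> - a))) * (L / K * dist w w')"
    proof -
      have "exp (- K * (\<tau> - a)) * exp (K * (\<tau> - a)) = 1"
        by (simp add: exp_minus)
      then have "exp (- K * (\<tau> - a)) * ((exp (K * (\<tau> - a)) - 1) * y) = (1 - exp (- K * (\<tau> - a))) * y" for y
        by (metis left_diff_distrib mult.assoc mult.right_neutral right_diff_distrib mult.left_neutral)
      from this[of "L / K * dist w w'"] show ?thesis by simp
    qed
    also have "\<dots> \<le> 1 * (L / K * dist w w')"
      using L K by (intro mult_right_mono) auto
    also have "\<dots> \<le> 1 / 2 * dist w w'" using K(2) by (simp only: mult_1) (intro mult_right_mono, auto)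
    finally show "dist (apply_bcontfun (T w) t) (apply_bcontfun (T w') t) \<le> 1 / 2 * dist w w'"
      by (simp add: T \<tau>_def)
  qed
  then obtain w where w: "T w = w"
    using banach_fix_type[of "1 / 2" T] by auto
  define z where "z = (\<lambda>t. z0 + integral {a..t} (\<lambda>s. g s (Y w s)))"
  have zY: "z t = Y w t" if "t \<in> {a..b}" for t
  proof -
    have "apply_bcontfun w t = F w t" using T[of w t] w c_id[OF that] by simp
    moreover have "exp (K * (t - a)) * exp (- (K * (t - a))) = 1" by (simp add: exp_minus)
    ultimately show ?thesis by (simp add: Y_def F_def z_def)
  qed
  show thesis
  proof (rule that[of z])
    show "z a = z0" by (simp add: z_def)
    fix t assume t: "t \<in> {a..b}"
    have "(z has_vector_derivative g t (Y w t)) (at t within {a..b})"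
      unfolding z_def
      by (auto intro!: derivative_eq_intros integral_has_vector_derivative[OF gY t])
    then show "(z has_vector_derivative g t (z t)) (at t within {a..b})" by (simp add: zY[OF t])
  qed
qed

lemma has_vector_derivative_at_interior:
  assumes "(z has_vector_derivative d) (at t within {a..b})" "a < t" "t < (b :: real)"
  shows "(z has_vector_derivative d) (at t)"
  using assms by (simp add: at_within_Icc_at)

text \<open>
  The function \<open>exp (- 2 L t) \<bar>z(t) - w(t)\<bar>\<^sup>2\<close> is nonincreasing and vanishes at \<open>a\<close>.
\<close>

lemma ode_unique_on_interval:
  fixes z w :: "real \<Rightarrow> 'a::euclidean_space"
  assumes lip: "\<And>t. t \<in> {a..b} \<Longrightarrow> L-lipschitz_on S (g t)"
    and z: "\<And>t. t \<in> {a..b} \<Longrightarrow> z t \<in> S" "\<And>t. t \<in> {a..b} \<Longrightarrow> (z has_vector_derivative g t (z t)) (at t within {a..b})"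
    and w: "\<And>t. t \<in> {a..b} \<Longrightarrow> w t \<in> S" "\<And>t. t \<in> {a..b} \<Longrightarrow> (w has_vector_derivative g t (w t)) (at t within {a..b})"
    and init: "z a = w a" and t: "t \<in> {a..b}"
  shows "z t = w t"
proof -
  define e where "e = (\<lambda>t. z t - w t)"
  define E where "E = (\<lambda>t. exp (- 2 * L * t) * (e t \<bullet> e t))"
  have e_der: "(e has_vector_derivative g s (z s) - g s (w s)) (at s within {a..b})" if "s \<in> {a..b}" for s
    unfolding e_def by (intro has_vector_derivative_diff z w that)
  have e_cont: "continuous_on {a..b} e"
    using e_der by (rule continuous_on_vector_derivative)
  have "E t \<le> E a"
  proof (rule DERIV_nonpos_imp_decreasing_open[of a t E])
    show "a \<le> t" using t by simp
    show "continuous_on {a..t} E" unfolding E_def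
      using t by (intro continuous_intros continuous_on_subset[OF e_cont]) auto
    fix s assume s: "a < s" "s < t"
    then have sab: "s \<in> {a..b}" using t by auto
    have "(e has_vector_derivative g s (z s) - g s (w s)) (at s)"
      using has_vector_derivative_at_interior[OF e_der[OF sab]] s t by auto
    then have ed: "(e has_derivative (\<lambda>h. h *\<^sub>R (g s (z s) - g s (w s)))) (at s)"
      by (simp add: has_vector_derivative_def)
    have "((\<lambda>t. e t \<bullet> e t) has_derivative (*) (2 * (e s \<bullet> (g s (z s) - g s (w s))))) (at s)"
      by (rule has_derivative_eq_rhs[OF has_derivative_inner[OF ed ed]])
        (simp add: fun_eq_iff inner_commute algebra_simps)
    then have "((\<lambda>t. e t \<bullet> e t) has_real_derivative 2 * (e s \<bullet> (g s (z s) - g s (w s)))) (at s)"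
      by (simp add: has_field_derivative_def)
    then have "(E has_real_derivative exp (- 2 * L * s) * (2 * (e s \<bullet> (g s (z s) - g s (w s))) - 2 * L * (e s \<bullet> e s))) (at s)"
      unfolding E_def by (auto intro!: derivative_eq_intros simp: algebra_simps)
    moreover have "e s \<bullet> (g s (z s) - g s (w s)) \<le> L * (e s \<bullet> e s)"
    proof -
      have "e s \<bullet> (g s (z s) - g s (w s)) \<le> norm (e s) * norm (g s (z s) - g s (w s))"
        by (rule norm_cauchy_schwarz)
      also have "\<dots> \<le> norm (e s) * (L * norm (e s))"
        using lipschitz_onD[OF lip[OF sab] z(1)[OF sab] w(1)[OF sab]]
        by (intro mult_left_mono) (auto simp: dist_norm e_def)
      finally show ?thesis by (simp add: dot_square_norm power2_eq_square mult_ac)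
    qed
    ultimately show "\<exists>y. (E has_real_derivative y) (at s) \<and> y \<le> 0"
      by (intro exI conjI) (auto simp: mult_le_0_iff)
  qed
  moreover have "E a = 0" by (simp add: E_def e_def init)
  ultimately have "e t \<bullet> e t \<le> 0" by (simp add: E_def mult_le_0_iff)
  then have "e t = 0" by (metis inner_gt_zero_iff linorder_not_less)
  then show ?thesis by (simp add: e_def)
qed

lemma ode_unique:
  fixes g :: "real \<Rightarrow> 'a::euclidean_space \<Rightarrow> 'a"
  assumes cont: "continuous_on ({a..} \<times> UNIV) (\<lambda>(t, x). g t x)" and lip: "local_lipschitz {a..} UNIV g"
    and z: "\<And>t. t \<in> {a..b} \<Longrightarrow> (z has_vector_derivative g t (z t)) (at t within {a..b})"
    and w: "\<And>t. t \<in> {a..b} \<Longrightarrow> (w has_vector_derivative g t (w t)) (at t within {a..b})"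
    and init: "z a = w a" and t: "t \<in> {a..b}"
  shows "z t = w t"
proof -
  have "compact (z ` {a..b} \<union> w ` {a..b})"
    using z w by (intro compact_Un compact_continuous_image continuous_on_vector_derivative) auto
  moreover have "local_lipschitz {a..b} (z ` {a..b} \<union> w ` {a..b}) g"
    by (rule local_lipschitz_subset[OF lip]) auto
  moreover have "continuous_on {a..b} (\<lambda>t. g t x)" for x
    by (rule continuous_on_case_prod[OF cont]) (auto intro: continuous_intros)
  ultimately obtain L where "\<And>t. t \<in> {a..b} \<Longrightarrow> L-lipschitz_on (z ` {a..b} \<union> w ` {a..b}) (g t)"
    using local_lipschitz_compact_implies_lipschitz[of "{a..b}" _ g] by (metis compact_Icc)
  from ode_unique_on_interval[OF this _ z _ w init t] show ?thesis by auto
qed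

text \<open>
  Composing \<open>g\<close> with the nonexpansive retraction onto a ball makes it globally Lipschitz.  A solution of the
  truncated equation solves the original one until it first reaches the sphere, and the a priori bound
  forbids it to get there.
\<close>

lemma ode_solution_on_interval:
  fixes g :: "real \<Rightarrow> 'a::euclidean_space \<Rightarrow> 'a"
  assumes cont: "continuous_on ({a..} \<times> UNIV) (\<lambda>(t, x). g t x)" and lip: "local_lipschitz {a..} UNIV g"
    and ab: "a \<le> b"
    and apriori: "\<And>s z. a \<le> s \<Longrightarrow> s \<le> b \<Longrightarrow> z a = z0 \<Longrightarrow>
       (\<And>t. t \<in> {a..s} \<Longrightarrow> (z has_vector_derivative g t (z t)) (at t within {a..s})) \<Longrightarrow> norm (z s) < M"
  obtains z where "z a = z0" "\<And>t. t \<in> {a..b} \<Longrightarrow> (z has_vector_derivative g t (z t)) (at t within {a..b})"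
proof -
  define R where "R = max M (norm z0)"
  define \<pi> where "\<pi> = closest_point (cball (0::'a) R)"
  have R: "R \<ge> 0" by (simp add: R_def le_max_iff_disj)
  then have ne: "cball (0::'a) R \<noteq> {}" by simp
  have \<pi>: "\<pi> x \<in> cball 0 R" "dist (\<pi> x) (\<pi> y) \<le> dist x y" for x y
    using closest_point_in_set[OF closed_cball ne] closest_point_lipschitz[OF convex_cball closed_cball ne]
    by (auto simp: \<pi>_def)
  have \<pi>_id: "\<pi> x = x" if "norm x \<le> R" for x
    using that by (auto simp: \<pi>_def intro: closest_point_self)
  have \<pi>_cont: "continuous_on UNIV \<pi>"
    using \<pi>(2) by (intro lipschitz_on_continuous_on[of 1] lipschitz_onI) auto
  have contt: "continuous_on {a..b} (\<lambda>t. g t x)" for x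
    by (rule continuous_on_case_prod[OF cont]) (auto intro: continuous_intros)
  have "local_lipschitz {a..b} (cball 0 R) g"
    by (rule local_lipschitz_subset[OF lip]) auto
  from local_lipschitz_compact_implies_lipschitz[OF this compact_cball compact_Icc contt]
  obtain L where L: "\<And>t. t \<in> {a..b} \<Longrightarrow> L-lipschitz_on (cball 0 R) (g t)"
    by blast
  define g' where "g' = (\<lambda>t x. g t (\<pi> x))"
  have g'_cont: "continuous_on ({a..b} \<times> UNIV) (\<lambda>(t, x). g' t x)"
    unfolding g'_def case_prod_unfold
    by (rule continuous_on_case_prod[OF cont])
      (auto intro!: continuous_intros continuous_on_compose2[OF \<pi>_cont])
  have g'_lip: "L-lipschitz_on UNIV (g' t)" if "t \<in> {a..b}" for t
  proof (rule lipschitz_onI)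
    show L0: "L \<ge> 0" using L[OF that] by (rule lipschitz_on_nonneg)
    fix x y
    have "dist (g' t x) (g' t y) \<le> L * dist (\<pi> x) (\<pi> y)"
      unfolding g'_def by (intro lipschitz_onD[OF L[OF that]] \<pi>)
    also have "\<dots> \<le> L * dist x y" by (intro mult_left_mono \<pi> L0)
    finally show "dist (g' t x) (g' t y) \<le> L * dist x y" .
  qed
  obtain z where z: "z a = z0" "\<And>t. t \<in> {a..b} \<Longrightarrow> (z has_vector_derivative g' t (z t)) (at t within {a..b})"
    using picard_lindelof_global_lipschitz[OF ab g'_cont g'_lip] by metis
  have z_cont: "continuous_on {a..b} z" using z(2) by (rule continuous_on_vector_derivative)
  have sol: "(z has_vector_derivative g t (z t)) (at t within {a..s})"
    if "s \<le> b" "\<And>r. r \<in> {a..s} \<Longrightarrow> norm (z r) \<le> R" "t \<in> {a..s}" for s t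
    using has_vector_derivative_within_subset[OF z(2)[of t], of "{a..s}"] that \<pi>_id[OF that(2)[OF that(3)]]
    by (auto simp: g'_def)
  have small: "norm (z t) \<le> R" if t: "t \<in> {a..b}" for t
  proof (rule ccontr)
    assume neg: "\<not> norm (z t) \<le> R"
    have zn_cont: "continuous_on {a..t} (\<lambda>s. norm (z s))"
      using t by (intro continuous_intros continuous_on_subset[OF z_cont]) auto
    \<comment> \<open>the first time at which the radius is reached\<close>
    define S where "S = {s \<in> {a..t}. norm (z s) = R}"
    have "\<exists>s\<ge>a. s \<le> t \<and> norm (z s) = R"
      using neg t z(1) by (intro IVT' zn_cont) (auto simp: R_def)
    then have "S \<noteq> {}" by (auto simp: S_def)
    moreover have "compact S" unfolding S_def by (rule compact_level_set[OF zn_cont])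
    ultimately obtain s where s: "s \<in> S" "\<And>r. r \<in> S \<Longrightarrow> s \<le> r"
      using compact_attains_inf[of S] by auto
    have below: "norm (z r) \<le> R" if r: "r \<in> {a..s}" for r
    proof (rule ccontr)
      assume neg: "\<not> norm (z r) \<le> R"
      have "\<exists>q\<ge>a. q \<le> r \<and> norm (z q) = R"
        using neg r s(1) z(1)
        by (intro IVT' continuous_on_subset[OF zn_cont]) (auto simp: R_def S_def)
      then obtain q where "q \<in> S" "q \<le> r" using r s(1) by (auto simp: S_def)
      then have "q = r" using s(2)[of q] r by auto
      then show False using neg \<open>q \<in> S\<close> by (auto simp: S_def)
    qed
    have "norm (z s) < M"
    proof (intro apriori)
      show "a \<le> s" "s \<le> b" using s(1) t by (auto simp: S_def)
      show "z a = z0" by (rule z(1))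
      show "(z has_vector_derivative g r (z r)) (at r within {a..s})"
        if "r \<in> {a..s}" for r
        by (rule sol[OF _ below that]) (use s(1) t in \<open>auto simp: S_def\<close>)
    qed
    then show False using s(1) by (auto simp: S_def R_def)
  qed
  show thesis
  proof (rule that[of z])
    show "z a = z0" by (rule z(1))
    show "(z has_vector_derivative g t (z t)) (at t within {a..b})" if "t \<in> {a..b}" for t
      by (rule sol[OF order_refl small that])
  qed
qed

text \<open>
  Solutions on larger and larger intervals agree by uniqueness and are glued.
\<close>

lemma ode_global_solution:
  fixes g :: "real \<Rightarrow> 'a::euclidean_space \<Rightarrow> 'a"
  assumes cont: "continuous_on ({a..} \<times> UNIV) (\<lambda>(t, x). g t x)" and lip: "local_lipschitz {a..} UNIV g"
    and apriori: "\<And>b. a \<le> b \<Longrightarrow> \<exists>M. \<forall>s z. a \<le> s \<longrightarrow> s \<le> b \<longrightarrow> z a = z0 \<longrightarrow>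
       (\<forall>t\<in>{a..s}. (z has_vector_derivative g t (z t)) (at t within {a..s})) \<longrightarrow> norm (z s) < M"
  obtains z where "z a = z0" "\<And>t. t \<ge> a \<Longrightarrow> (z has_vector_derivative g t (z t)) (at t within {a..})"
proof -
  have "\<exists>z. z a = z0 \<and> (\<forall>t\<in>{a..b}. (z has_vector_derivative g t (z t)) (at t within {a..b}))"
    if ab: "a \<le> b" for b
  proof -
    obtain M where M: "\<forall>s z. a \<le> s \<longrightarrow> s \<le> b \<longrightarrow> z a = z0 \<longrightarrow>
       (\<forall>t\<in>{a..s}. (z has_vector_derivative g t (z t)) (at t within {a..s})) \<longrightarrow> norm (z s) < M"
      using apriori[OF ab] by blast
    obtain z where "z a = z0" "\<And>t. t \<in> {a..b} \<Longrightarrow> (z has_vector_derivative g t (z t)) (at t within {a..b})"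
    proof (rule ode_solution_on_interval[OF cont lip ab, of z0 M])
      show "norm (z s) < M" if "a \<le> s" "s \<le> b" "z a = z0"
        "\<And>t. t \<in> {a..s} \<Longrightarrow> (z has_vector_derivative g t (z t)) (at t within {a..s})" for s z
        using M that by blast
    qed blast
    then show ?thesis by blast
  qed
  then obtain Z where Z: "\<And>b. a \<le> b \<Longrightarrow> Z b a = z0"
    "\<And>b t. a \<le> b \<Longrightarrow> t \<in> {a..b} \<Longrightarrow> (Z b has_vector_derivative g t (Z b t)) (at t within {a..b})"
    by metis
  have agree: "Z b t = Z b' t" if "a \<le> t" "t \<le> b" "b \<le> b'" for t b b'
  proof (rule ode_unique[OF cont lip, of b])
    show "(Z b has_vector_derivative g s (Z b s)) (at s within {a..b})" if "s \<in> {a..b}" for s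
      using Z that by auto
    show "(Z b' has_vector_derivative g s (Z b' s)) (at s within {a..b})" if "s \<in> {a..b}" for s
      using that \<open>b \<le> b'\<close> by (intro has_vector_derivative_within_subset[OF Z(2)[of b']]) auto
    show "Z b a = Z b' a" using Z that by auto
  qed (use that in auto)
  define z where "z = (\<lambda>t. Z t t)"
  show thesis
  proof (rule that[of z])
    show "z a = z0" by (simp add: z_def Z)
    fix t assume t: "a \<le> t"
    have zZ: "z s = Z (t + 1) s" if "s \<in> {a..t + 1}" for s
      using agree[of s s "t + 1"] that by (simp add: z_def)
    have "(Z (t + 1) has_vector_derivative g t (Z (t + 1) t)) (at t within {a..t + 1})"
      using Z t by auto
    then have "(z has_vector_derivative g t (z t)) (at t within {a..t + 1})"
      unfolding zZ[of t, symmetric, simplified, OF t]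
      by (rule has_vector_derivative_transform[rotated 2]) (use t zZ in auto)
    moreover have "at t within {a..} = at t within {a..t + 1}"
      by (rule at_within_nhd[of _ "{..<t + 1}"]) auto
    ultimately show "(z has_vector_derivative g t (z t)) (at t within {a..})" by simp
  qed
qed

section \<open>A priori bounds\<close>

text \<open>
  Bihari's argument: as long as \<open>V\<close> is above \<open>v0\<close>, the antiderivative of \<open>1 / U\<close> grows along \<open>V\<close> at rate
  at most \<open>K\<close>, so \<open>V\<close> cannot pass the level at which the integral of \<open>1 / U\<close> from \<open>v0\<close> exceeds
  \<open>K (b - a)\<close>.  The bound must not depend on \<open>V\<close> or on the length of its interval of existence.
\<close>

lemma bihari_bound:
  fixes U :: "real \<Rightarrow> real"
  assumes K: "K \<ge> 0" and v0: "v0 > 0"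
    and U: "continuous_on {0<..} U" "\<And>v. v > 0 \<Longrightarrow> U v > 0"
    and div: "filterlim (\<lambda>b. integral {v0..b} (\<lambda>v. 1 / U v)) at_top at_top"
  obtains vm where "\<And>V s. a \<le> s \<Longrightarrow> s \<le> b \<Longrightarrow> continuous_on {a..s} V \<Longrightarrow> V a \<le> v0 \<Longrightarrow>
     (\<And>t. a < t \<Longrightarrow> t < s \<Longrightarrow> v0 < V t \<Longrightarrow> \<exists>d. (V has_real_derivative d) (at t) \<and> d \<le> K * U (V t)) \<Longrightarrow>
     V s < vm"
proof -
  have "\<forall>\<^sub>F v in at_top. K * (b - a) < integral {v0..v} (\<lambda>v. 1 / U v)"
    using div by (simp add: filterlim_at_top_dense)
  then obtain v1 where v1: "\<And>v. v \<ge> v1 \<Longrightarrow> K * (b - a) < integral {v0..v} (\<lambda>v. 1 / U v)"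
    by (auto simp: eventually_at_top_linorder)
  show thesis
  proof (rule that[of "max v1 (v0 + 1)"], rule ccontr)
    fix V s assume s: "a \<le> s" "s \<le> b" and V: "continuous_on {a..s} V" "V a \<le> v0"
      and dV: "\<And>t. a < t \<Longrightarrow> t < s \<Longrightarrow> v0 < V t \<Longrightarrow> \<exists>d. (V has_real_derivative d) (at t) \<and> d \<le> K * U (V t)"
      and "\<not> V s < max v1 (v0 + 1)"
    then have Vs: "V s \<ge> v1" "V s > v0" by auto
    \<comment> \<open>the last time at which \<open>V\<close> has the value \<open>v0\<close>\<close>
    define S where "S = {t \<in> {a..s}. V t = v0}"
    have ivt: "\<exists>q\<in>S. r \<le> q" if r: "r \<in> {a..s}" "V r \<le> v0" for r
    proof -
      have "\<exists>q\<ge>r. q \<le> s \<and> V q = v0"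
        using r Vs by (intro IVT' continuous_on_subset[OF V(1)]) auto
      then obtain q where "q \<ge> r" "q \<le> s" "V q = v0" by blast
      then show ?thesis using r by (intro bexI[of _ q]) (auto simp: S_def)
    qed
    have "S \<noteq> {}" using ivt[of a] s V by auto
    moreover have "compact S" unfolding S_def by (rule compact_level_set[OF V(1)])
    ultimately obtain r where r: "r \<in> S" "\<And>q. q \<in> S \<Longrightarrow> q \<le> r"
      using compact_attains_sup[of S] by auto
    have rs: "a \<le> r" "r \<le> s" "V r = v0" using r(1) by (auto simp: S_def)
    have above: "V t > v0" if t: "r < t" "t \<le> s" for t
    proof (rule ccontr)
      assume "\<not> V t > v0"
      then obtain q where "q \<in> S" "t \<le> q" using ivt[of t] t rs by auto
      then show False using r(2)[of q] t by auto
    qed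
    \<comment> \<open>starting at \<open>v0 / 2\<close> makes \<open>W\<close> two-sided differentiable at \<open>v0\<close>\<close>
    define W where "W = (\<lambda>v. integral {v0 / 2..v} (\<lambda>v. 1 / U v))"
    have contU: "continuous_on {v0 / 2..c} (\<lambda>v. 1 / U v)" for c
    proof (intro continuous_intros continuous_on_subset[OF U(1)] ballI)
      show "{v0 / 2..c} \<subseteq> {0<..}" using v0 by auto
      show "U v \<noteq> 0" if "v \<in> {v0 / 2..c}" for v using U(2)[of v] that v0 by auto
    qed
    have W: "(W has_real_derivative 1 / U v) (at v)" if "v > v0 / 2" for v
      using integral_has_real_derivative[OF contU[of "v + 1"], of v] that
      by (simp add: W_def at_within_Icc_at)
    have "W (V s) - K * s \<le> W (V r) - K * r"
    proof (rule DERIV_nonpos_imp_decreasing_open[of r s "\<lambda>t. W (V t) - K * t"])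
      show "r \<le> s" by fact
      have "V ` {r..s} \<subseteq> {v0 / 2<..}"
        using above rs v0 by (force simp: le_less)
      moreover have "continuous_on {v0 / 2<..} W"
        by (intro continuous_at_imp_continuous_on ballI DERIV_isCont[OF W]) simp
      ultimately have "continuous_on {r..s} (\<lambda>t. W (V t))"
        using rs by (intro continuous_on_compose2[OF _ continuous_on_subset[OF V(1)]]) auto
      then show "continuous_on {r..s} (\<lambda>t. W (V t) - K * t)" by (intro continuous_intros)
      fix t assume t: "r < t" "t < s"
      have Vt: "V t > v0" using above t by simp
      obtain d where d: "(V has_real_derivative d) (at t)" "d \<le> K * U (V t)"
        using dV[of t] t rs Vt by auto
      have "((\<lambda>t. W (V t)) has_real_derivative 1 / U (V t) * d) (at t)"
        using Vt v0 by (intro DERIV_chain2[OF W d(1)]) auto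
      then have "((\<lambda>t. W (V t) - K * t) has_real_derivative 1 / U (V t) * d - K) (at t)"
        by (auto intro!: derivative_eq_intros)
      moreover have "1 / U (V t) * d - K \<le> 0"
        using d(2) U(2)[of "V t"] Vt v0 by (simp add: divide_le_eq)
      ultimately show "\<exists>y. ((\<lambda>t. W (V t) - K * t) has_real_derivative y) (at t) \<and> y \<le> 0" by blast
    qed
    moreover have "W (V s) = W v0 + integral {v0..V s} (\<lambda>v. 1 / U v)"
      unfolding W_def using v0 Vs
      by (intro Henstock_Kurzweil_Integration.integral_combine[symmetric] integrable_continuous_real contU) auto
    ultimately have "integral {v0..V s} (\<lambda>v. 1 / U v) \<le> K * (s - r)"
      using rs by (simp add: algebra_simps)
    also have "\<dots> \<le> K * (b - a)" using K s rs by (intro mult_left_mono) auto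
    finally show False using v1[OF Vs(1)] by simp
  qed
qed

lemma identity_divergent:
  assumes "c > (0::real)"
  shows "filterlim (\<lambda>b. integral {c..b} (\<lambda>v. 1 / v)) at_top at_top"
proof -
  have "\<forall>\<^sub>F b in at_top. ln b - ln c = integral {c..b} (\<lambda>v. 1 / v)"
    using eventually_ge_at_top[of c]
  proof eventually_elim
    case (elim b)
    have "((\<lambda>v. 1 / v) has_integral (ln b - ln c)) {c..b}"
      using elim assms
      by (intro fundamental_theorem_of_calculus)
        (auto intro!: derivative_eq_intros simp: has_real_derivative_iff_has_vector_derivative[symmetric])
    then show ?case by (simp add: integral_unique)
  qed
  moreover have "filterlim (\<lambda>b. - ln c + ln b) at_top at_top"
    by (intro filterlim_tendsto_add_at_top[OF tendsto_const] ln_at_top)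
  then have "filterlim (\<lambda>b. ln b - ln c) at_top at_top" by simp
  ultimately show ?thesis by (rule filterlim_cong[THEN iffD1, OF refl refl])
qed

lemma positive_form_bounds:
  fixes h :: "'a::euclidean_space \<Rightarrow> 'a"
  assumes X: "subspace X" and h: "linear h" and pos: "\<And>x. x \<in> X \<Longrightarrow> x \<noteq> 0 \<Longrightarrow> h x \<bullet> x > 0"
  obtains c C where "c > 0" "C > 0" "\<And>x. x \<in> X \<Longrightarrow> c * (norm x)\<^sup>2 \<le> h x \<bullet> x" "\<And>x. h x \<bullet> x \<le> C * (norm x)\<^sup>2"
    "\<And>x. norm (h x) \<le> C * norm x"
proof -
  obtain C where C: "C > 0" "\<And>x. norm (h x) \<le> C * norm x"
    using linear_bounded_pos[OF h] by auto
  have up: "h x \<bullet> x \<le> C * (norm x)\<^sup>2" for x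
  proof -
    have "h x \<bullet> x \<le> norm (h x) * norm x" by (rule norm_cauchy_schwarz)
    also have "\<dots> \<le> C * norm x * norm x" by (intro mult_right_mono C) auto
    finally show ?thesis by (simp add: power2_eq_square mult_ac)
  qed
  obtain c where c: "c > 0" "\<And>x. x \<in> X \<Longrightarrow> norm x = 1 \<Longrightarrow> c \<le> h x \<bullet> x"
  proof (cases "X \<inter> sphere 0 1 = {}")
    case True
    show thesis
    proof (rule that[of 1])
      show "1 \<le> h x \<bullet> x" if "x \<in> X" "norm x = 1" for x
        using True that by (auto simp: disjoint_iff)
    qed simp
  next
    case False
    have "compact (X \<inter> sphere 0 1)"
      by (intro closed_Int_compact closed_subspace X) simp
    moreover have "continuous_on (X \<inter> sphere 0 1) (\<lambda>x. h x \<bullet> x)"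
      by (intro continuous_intros linear_continuous_on linear_conv_bounded_linear[THEN iffD1] h)
    ultimately have "\<exists>x\<in>X \<inter> sphere 0 1. \<forall>y\<in>X \<inter> sphere 0 1. h x \<bullet> x \<le> h y \<bullet> y"
      by (rule continuous_attains_inf[OF _ False])
    then obtain x where x: "x \<in> X \<inter> sphere 0 1" "\<forall>y\<in>X \<inter> sphere 0 1. h x \<bullet> x \<le> h y \<bullet> y"
      by blast
    have "h x \<bullet> x > 0" using x(1) by (intro pos) auto
    then show thesis using that[of "h x \<bullet> x"] x(2) by auto
  qed
  have low: "c * (norm x)\<^sup>2 \<le> h x \<bullet> x" if "x \<in> X" for x
  proof (cases "x = 0")
    case False
    define y where "y = inverse (norm x) *\<^sub>R x"
    have y: "norm y = 1" "y \<in> X" using False that X by (auto simp: y_def subspace_scale)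
    have x: "norm x *\<^sub>R y = x" using False by (simp add: y_def)
    have "h x = norm x *\<^sub>R h y" using linear_scale[OF h, of "norm x" y] by (simp add: x)
    then have "h x \<bullet> x = (norm x *\<^sub>R h y) \<bullet> (norm x *\<^sub>R y)" by (simp only: x)
    then have "h x \<bullet> x = (norm x)\<^sup>2 * (h y \<bullet> y)" by (simp add: power2_eq_square)
    moreover have "c * (norm x)\<^sup>2 \<le> (h y \<bullet> y) * (norm x)\<^sup>2"
      using c(2)[OF y(2,1)] by (intro mult_right_mono) auto
    ultimately show ?thesis by (simp add: mult.commute)
  qed (simp add: linear_0[OF h])
  show thesis using that[OF c(1) C(1) low up C(2)] by blast
qed

text \<open>
  Apply \<open>bihari_bound\<close> to \<open>V = (h z, z) / 2\<close>.  The dissipation estimate is only available for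
  \<open>\<bar>z\<bar> \<ge> R\<close>, which holds as soon as \<open>V\<close> exceeds a level \<open>v0 > C R\<^sup>2\<close>.
\<close>

lemma lyapunov_a_priori_bound:
  fixes h :: "'a::euclidean_space \<Rightarrow> 'a"
  assumes X: "subspace X" and h: "linear h" and pos: "\<And>x. x \<in> X \<Longrightarrow> x \<noteq> 0 \<Longrightarrow> h x \<bullet> x > 0"
    and sym: "\<And>x y. x \<in> X \<Longrightarrow> y \<in> X \<Longrightarrow> h x \<bullet> y = x \<bullet> h y"
    and K: "K \<ge> 0"
    and U: "continuous_on {0<..} U" "\<And>v. v > 0 \<Longrightarrow> U v > 0"
    and div: "\<And>c. c > 0 \<Longrightarrow> filterlim (\<lambda>b. integral {c..b} (\<lambda>v. 1 / U v)) at_top at_top"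
    and diss: "\<And>t z. a \<le> t \<Longrightarrow> t \<le> b \<Longrightarrow> z \<in> X \<Longrightarrow> norm z \<ge> R \<Longrightarrow> h z \<bullet> g t z \<le> K * U (1 / 2 * (h z \<bullet> z))"
    and g: "\<And>t z. a \<le> t \<Longrightarrow> z \<in> X \<Longrightarrow> g t z \<in> X"
  shows "\<exists>M. \<forall>s z. a \<le> s \<longrightarrow> s \<le> b \<longrightarrow> z a = z0 \<longrightarrow> (\<forall>t\<in>{a..s}. z t \<in> X) \<longrightarrow>
       (\<forall>t\<in>{a..s}. (z has_vector_derivative g t (z t)) (at t within {a..s})) \<longrightarrow> norm (z s) < M"
proof -
  obtain c C where c: "c > 0" "C > 0" and low: "\<And>x. x \<in> X \<Longrightarrow> c * (norm x)\<^sup>2 \<le> h x \<bullet> x"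
    and up: "\<And>x. h x \<bullet> x \<le> C * (norm x)\<^sup>2"
    using positive_form_bounds[OF X h pos] by metis
  define v0 where "v0 = max (C * R\<^sup>2) (\<bar>h z0 \<bullet> z0\<bar>) + 1"
  have v0: "v0 > 0" "v0 > C * R\<^sup>2" "v0 > h z0 \<bullet> z0" by (auto simp: v0_def)
  obtain vm where vm: "\<And>V s. a \<le> s \<Longrightarrow> s \<le> b \<Longrightarrow> continuous_on {a..s} V \<Longrightarrow> V a \<le> v0 \<Longrightarrow>
     (\<And>t. a < t \<Longrightarrow> t < s \<Longrightarrow> v0 < V t \<Longrightarrow> \<exists>d. (V has_real_derivative d) (at t) \<and> d \<le> K * U (V t)) \<Longrightarrow>
     V s < vm"
    using bihari_bound[where a = a and b = b, OF K v0(1) U div[OF v0(1)]] by blast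
  have "norm (z s) < sqrt (2 * \<bar>vm\<bar> / c) + 1"
    if s: "a \<le> s" "s \<le> b" and z: "z a = z0" "\<forall>t\<in>{a..s}. z t \<in> X"
      and dz: "\<forall>t\<in>{a..s}. (z has_vector_derivative g t (z t)) (at t within {a..s})" for s z
  proof -
    define V where "V = (\<lambda>t. 1 / 2 * (h (z t) \<bullet> z t))"
    have z_cont: "continuous_on {a..s} z"
      by (rule continuous_on_vector_derivative) (use dz in auto)
    have bh: "bounded_linear h" using h by (simp add: linear_conv_bounded_linear)
    have "V s < vm"
    proof (rule vm[OF s])
      show "continuous_on {a..s} V" unfolding V_def
        by (intro continuous_intros z_cont bounded_linear.continuous_on[OF bh])
      have "h z0 \<bullet> z0 \<le> 2 * v0" using v0 by simp
      then show "V a \<le> v0" using z(1) by (simp add: V_def)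
      fix t assume t: "a < t" "t < s" and Vt: "v0 < V t"
      have zX: "z t \<in> X" using z t by auto
      have "(z has_vector_derivative g t (z t)) (at t)"
        using dz t by (metis atLeastAtMost_iff at_within_Icc_at less_imp_le)
      then have zd: "(z has_derivative (\<lambda>k. k *\<^sub>R g t (z t))) (at t)"
        by (simp add: has_vector_derivative_def)
      have hd: "((\<lambda>t. h (z t)) has_derivative (\<lambda>k. h (k *\<^sub>R g t (z t)))) (at t)"
        by (rule bounded_linear.has_derivative[OF bh zd])
      have gX: "g t (z t) \<in> X" using g[of t "z t"] t zX by simp
      have swap: "h (g t (z t)) \<bullet> z t = h (z t) \<bullet> g t (z t)"
        unfolding sym[OF gX zX] by (rule inner_commute)
      have "(V has_derivative (*) (h (z t) \<bullet> g t (z t))) (at t)"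
        unfolding V_def
      proof (rule has_derivative_eq_rhs[OF has_derivative_mult_right[OF has_derivative_inner[OF hd zd]]], rule ext)
        fix k
        have "h (k *\<^sub>R g t (z t)) = k *\<^sub>R h (g t (z t))" by (rule linear_scale[OF h])
        then show "1 / 2 * (h (z t) \<bullet> (k *\<^sub>R g t (z t)) + h (k *\<^sub>R g t (z t)) \<bullet> z t) = (h (z t) \<bullet> g t (z t)) * k"
          by (simp add: swap)
      qed
      then have "(V has_real_derivative h (z t) \<bullet> g t (z t)) (at t)"
        by (simp add: has_field_derivative_def)
      moreover have "h (z t) \<bullet> g t (z t) \<le> K * U (V t)"
        unfolding V_def
      proof (rule diss)
        show "norm (z t) \<ge> R"
        proof (rule ccontr)
          assume "\<not> norm (z t) \<ge> R"
          then have "(norm (z t))\<^sup>2 \<le> R\<^sup>2" by (intro power_mono) auto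
          then have "C * (norm (z t))\<^sup>2 \<le> C * R\<^sup>2" using c by simp
          then have "h (z t) \<bullet> z t < v0" using up[of "z t"] v0(2) by linarith
          then show False using Vt v0(1) by (simp add: V_def)
        qed
      qed (use t s zX in auto)
      ultimately show "\<exists>d. (V has_real_derivative d) (at t) \<and> d \<le> K * U (V t)" by blast
    qed
    then have "c * (norm (z s))\<^sup>2 \<le> 2 * \<bar>vm\<bar>"
      using low[of "z s"] z(2) s by (simp add: V_def)
    then have "(norm (z s))\<^sup>2 \<le> 2 * \<bar>vm\<bar> / c" using c(1) by (simp add: field_simps)
    then have "norm (z s) \<le> sqrt (2 * \<bar>vm\<bar> / c)" by (rule real_le_rsqrt)
    then show ?thesis by simp
  qed
  then show ?thesis by blast
qed

section \<open>Convergence of the scheme\<close>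

text \<open>
  With \<open>e = v - u\<close>, \<open>q = y - z\<close> and \<open>x = y + v\<close>, the error \<open>v' - u\<close> after the step satisfies
  \<open>(I - D(x)) (v' - u) = D(x) q + r\<close>, where the error \<open>r\<close> of linearising \<open>\<phi>\<close> between \<open>x\<close> and \<open>z + u\<close> is
  at most \<open>(k / 2) \<bar>e + q\<bar>\<close> in a thin tube.  Since \<open>k\<close> is a lower bound for \<open>I - D\<close> on the tube, \<open>e\<close>
  enters with the factor one half.  The step is described by the linear equation for \<open>v' - v\<close>, so that no
  inverse operators appear.
\<close>

lemma newton_step_error:
  fixes \<phi> :: "real \<Rightarrow> 'a::euclidean_space \<Rightarrow> 'a"
  assumes der: "\<And>t x. t \<in> J \<Longrightarrow> (\<phi> t has_derivative blinfun_apply (D t x)) (at x)"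
    and contD: "continuous_on (J \<times> UNIV) (\<lambda>(t, x). D t x)" and J: "compact J"
    and inj: "\<And>t x v. t \<in> J \<Longrightarrow> D t x v = v \<Longrightarrow> v = 0"
    and z: "continuous_on J z" and u: "continuous_on J u"
    and sol: "\<And>t. t \<in> J \<Longrightarrow> u t = \<phi> t (z t + u t)"
  obtains \<rho> C where "\<rho> > 0" "\<rho> \<le> 1" "C \<ge> 0"
    "\<And>t y v v'. t \<in> J \<Longrightarrow> norm (y + v - (z t + u t)) \<le> \<rho> \<Longrightarrow>
      (v' - v) - D t (y + v) (v' - v) = - (v - \<phi> t (y + v)) \<Longrightarrow>
      norm (v' - u t) \<le> C * norm (y - z t) + 1 / 2 * norm (v - u t)"
proof -
  obtain r where r: "\<And>t. t \<in> J \<Longrightarrow> norm (z t + u t) \<le> r"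
    using compact_image_norm_bound[OF J, of "\<lambda>t. z t + u t"] z u(1) by (auto intro: continuous_intros)
  define S where "S = cball (0::'a) (r + 1)"
  have S: "compact S" "convex S" by (auto simp: S_def)
  have contS: "continuous_on (J \<times> S) (\<lambda>(t, x). D t x)"
    by (rule continuous_on_subset[OF contD]) auto
  have compS: "compact (J \<times> S)" by (intro compact_Times J S)
  obtain M where M: "M \<ge> 0" "\<And>t x. t \<in> J \<Longrightarrow> x \<in> S \<Longrightarrow> norm (D t x) \<le> M"
    using compact_image_norm_bound[OF compS contS] by (metis SigmaI prod.case)
  obtain k where k: "k > 0" "\<And>t x v. t \<in> J \<Longrightarrow> x \<in> S \<Longrightarrow> k * norm v \<le> norm (v - D t x v)"
  proof -
    let ?C = "(J \<times> S) \<times> sphere (0::'a) 1"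
    have "continuous_on ?C ((\<lambda>(t, x). D t x) \<circ> fst)"
      by (intro continuous_on_compose continuous_intros continuous_on_subset[OF contS]) auto
    then have cont: "continuous_on ?C (\<lambda>p. norm (snd p - (case fst p of (t, x) \<Rightarrow> D t x) (snd p)))"
      unfolding comp_def by (intro continuous_intros)
    obtain k where k: "k > 0" "\<And>t x v. t \<in> J \<Longrightarrow> x \<in> S \<Longrightarrow> norm v = 1 \<Longrightarrow> k \<le> norm (v - D t x v)"
    proof (cases "?C = {}")
      case True
      show thesis
      proof (rule that[of 1])
        fix t x and v :: 'a assume "t \<in> J" "x \<in> S" "norm v = 1"
        then have "((t, x), v) \<in> ?C" by simp
        then show "1 \<le> norm (v - D t x v)" unfolding True by (rule emptyE)
      qed simp
    next
      case False
      have "compact ?C" by (intro compact_Times compS) simp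
      from continuous_attains_inf[OF this False cont] obtain p where p: "p \<in> ?C"
        "\<forall>q\<in>?C. norm (snd p - (case fst p of (t, x) \<Rightarrow> D t x) (snd p))
            \<le> norm (snd q - (case fst q of (t, x) \<Rightarrow> D t x) (snd q))"
        by blast
      obtain t x v where tv: "p = ((t, x), v)" by (metis surj_pair)
      have "v - D t x v \<noteq> 0" using inj[of t x v] p(1) by (auto simp: tv)
      then show thesis using that[of "norm (v - D t x v)"] p(2) by (force simp: tv)
    qed
    show thesis
    proof (rule that[OF k(1)])
      fix t x v assume tx: "t \<in> J" "x \<in> S"
      show "k * norm v \<le> norm (v - D t x v)"
      proof (cases "v = 0")
        case False
        define e where "e = inverse (norm v) *\<^sub>R v"
        have v: "norm v *\<^sub>R e = v" "norm e = 1" using False by (auto simp: e_def)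
        have "norm v *\<^sub>R (e - D t x e) = v - D t x v"
          by (simp only: scaleR_diff_right blinfun.scaleR_right[symmetric] v(1))
        then have "norm (v - D t x v) = norm (norm v *\<^sub>R (e - D t x e))" by (simp only:)
        then have "norm (v - D t x v) = norm v * norm (e - D t x e)" by simp
        then show ?thesis using mult_left_mono[OF k(2)[OF tx v(2)], of "norm v"] by (simp add: mult.commute)
      qed simp
    qed
  qed
  obtain d where d: "d > 0"
    "\<And>t x y. t \<in> J \<Longrightarrow> x \<in> S \<Longrightarrow> y \<in> S \<Longrightarrow> dist x y < d \<Longrightarrow> norm (D t x - D t y) < k / 2"
  proof -
    have "uniformly_continuous_on (J \<times> S) (\<lambda>(t, x). D t x)"
      by (rule compact_uniformly_continuous[OF contS compS])
    then obtain d where d: "d > 0" "\<forall>p\<in>J \<times> S. \<forall>q\<in>J \<times> S. dist q p < d \<longrightarrow>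
        dist (case q of (t, x) \<Rightarrow> D t x) (case p of (t, x) \<Rightarrow> D t x) < k / 2"
      using k(1) unfolding uniformly_continuous_on_def by (metis half_gt_zero)
    show thesis
    proof (rule that[OF d(1)])
      fix t x y assume "t \<in> J" "x \<in> S" "y \<in> S" "dist x y < d"
      then show "norm (D t x - D t y) < k / 2"
        using d(2)[rule_format, of "(t, y)" "(t, x)"] by (simp add: dist_Pair_Pair dist_norm)
    qed
  qed
  define \<rho> where "\<rho> = min 1 (d / 2)"
  have \<rho>: "\<rho> > 0" "\<rho> \<le> 1" "\<rho> < d" using d(1) by (auto simp: \<rho>_def min_def)
  show thesis
  proof (rule that[of \<rho> "M / k + 1 / 2"])
    show "\<rho> > 0" "\<rho> \<le> 1" by fact+
    show "M / k + 1 / 2 \<ge> 0" using M k by simp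
    fix t y v v' assume t: "t \<in> J" and near: "norm (y + v - (z t + u t)) \<le> \<rho>"
      and step: "(v' - v) - D t (y + v) (v' - v) = - (v - \<phi> t (y + v))"
    define x where "x = y + v"
    define x' where "x' = z t + u t"
    define A where "A = D t x"
    have x': "x' \<in> S" "x \<in> S"
      using r[OF t] near \<rho>(2) norm_triangle_sub[of x x'] by (auto simp: S_def x'_def x_def)
    have seg: "closed_segment x' x \<subseteq> S" using x' S(2) by (simp add: closed_segment_subset)
    define f where "f = (\<lambda>w. \<phi> t w - A w)"
    have rem: "norm (f x - f x') \<le> k / 2 * norm (x - x')"
    proof (rule differentiable_bound[of "closed_segment x' x" f "\<lambda>w h. D t w h - A h"])
      fix w assume w: "w \<in> closed_segment x' x"
      show "(f has_derivative (\<lambda>h. D t w h - A h)) (at w within closed_segment x' x)"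
        unfolding f_def
        by (intro has_derivative_diff has_derivative_at_withinI[OF der[OF t]]
            bounded_linear_imp_has_derivative blinfun.bounded_linear_right)
      have "dist w x \<le> dist x x'"
        using w by (metis dist_in_closed_segment dist_commute)
      then have "dist w x < d" using near \<rho>(3) by (simp add: x_def x'_def dist_norm)
      then have "norm (D t w - D t x) \<le> k / 2" using d(2)[OF t _ x'(2), of w] seg w by fastforce
      then show "onorm (\<lambda>h. D t w h - A h) \<le> k / 2"
        by (simp add: norm_blinfun.rep_eq minus_blinfun.rep_eq A_def)
    qed auto
    define e where "e = v - u t"
    define q where "q = y - z t"
    have xx: "x - x' = e + q" by (simp add: x_def x'_def e_def q_def)
    have "u t = \<phi> t x'" using sol[OF t] by (simp add: x'_def)
    then have "(v' - u t) - A (v' - u t) = A q + (f x - f x')"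
    proof -
      have 1: "v' - u t = (v' - v) + e" by (simp add: e_def)
      have "f x - f x' = \<phi> t x - u t - A (x - x')"
        using \<open>u t = \<phi> t x'\<close> by (simp add: f_def blinfun.diff_right)
      then have 2: "f x - f x' = \<phi> t x - u t - A e - A q"
        unfolding xx by (simp add: blinfun.add_right)
      have 3: "(v' - v) - A (v' - v) = - (v - \<phi> t x)" using step by (simp add: A_def x_def)
      show ?thesis unfolding 2 unfolding 1 blinfun.add_right using 3 by (simp add: e_def algebra_simps)
    qed
    then have "k * norm (v' - u t) \<le> norm (A q + (f x - f x'))"
      using k(2)[OF t x'(2), of "v' - u t"] by (simp add: A_def)
    also have "\<dots> \<le> norm (A q) + norm (f x - f x')" by (rule norm_triangle_ineq)
    also have "norm (A q) \<le> M * norm q"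
      unfolding A_def by (rule order_trans[OF norm_blinfun]) (intro mult_right_mono M(2) t x' norm_ge_zero)
    also have "norm (f x - f x') \<le> k / 2 * (norm e + norm q)"
    proof -
      have "k / 2 * norm (e + q) \<le> k / 2 * (norm e + norm q)"
        using k(1) by (intro mult_left_mono norm_triangle_ineq) auto
      then show ?thesis using rem xx by simp
    qed
    finally have "k * norm (v' - u t) \<le> M * norm q + k / 2 * (norm e + norm q)" by simp
    also have "\<dots> = k * ((M / k + 1 / 2) * norm q + 1 / 2 * norm e)"
      using k(1) by (simp add: field_simps)
    finally have "norm (v' - u t) \<le> (M / k + 1 / 2) * norm q + 1 / 2 * norm e"
      using k(1) by simp
    then show "norm (v' - u t) \<le> (M / k + 1 / 2) * norm (y - z t) + 1 / 2 * norm (v - u t)"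
      by (simp add: q_def e_def)
  qed
qed

text \<open>
  Here \<open>d\<close> and \<open>\<epsilon>\<close> are the errors in \<open>z\<close> and \<open>u\<close>, and \<open>\<sigma>\<close> bounds the oscillation of \<open>u\<close> over one step.
  Both recursive estimates hold only while the errors stay below \<open>\<rho>\<close>, so smallness and the estimate are
  proved together, with the majorant \<open>\<beta>\<close> that satisfies \<open>(1 + a h) \<beta>\<^sub>i + h p \<le> \<beta>\<^sub>i\<^sub>+\<^sub>1\<close>.  Being monotone it
  dominates the two-step recursion as well: the invariant is \<open>d\<^sub>i \<le> \<beta>\<^sub>i\<close> and \<open>\<epsilon>\<^sub>i \<le> 2 C \<beta>\<^sub>i + \<sigma>\<close>.
\<close>

lemma coupled_error_recursion:
  fixes d \<epsilon> :: "nat \<Rightarrow> real"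
  assumes nn: "h \<ge> 0" "L \<ge> 0" "C \<ge> 0" "\<sigma> \<ge> 0" "\<tau> \<ge> 0"
    and init: "d 0 = 0" "\<epsilon> 0 = 0" "d 1 \<le> h * \<tau>"
    and dstep: "\<And>i. 1 \<le> i \<Longrightarrow> i < N \<Longrightarrow> d i + \<epsilon> i \<le> \<rho> \<Longrightarrow>
      d (i + 1) \<le> d (i - 1) + 2 * h * L * (d i + \<epsilon> i) + h * \<tau>"
    and estep: "\<And>i. i < N \<Longrightarrow> d (i + 1) + \<epsilon> i + \<sigma> \<le> \<rho> \<Longrightarrow>
      \<epsilon> (i + 1) \<le> C * d (i + 1) + 1 / 2 * (\<epsilon> i + \<sigma>)"
    and len: "real N * h = len"
    and a: "a = 2 * L * (1 + 2 * C)" and p: "p = 2 * L * \<sigma> + \<tau>" and b: "b = p * len * exp (a * len)"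
    and small: "(1 + 2 * C) * b + 2 * \<sigma> \<le> \<rho>"
    and i: "i \<le> N"
  shows "d i \<le> b" "\<epsilon> i \<le> 2 * C * b + \<sigma>"
proof -
  have a0: "a \<ge> 0" and p0: "p \<ge> 0" using nn by (auto simp: a p)
  define \<beta> where "\<beta> = (\<lambda>i::nat. p * (real i * h) * (1 + a * h) ^ i)"
  have pow1: "1 \<le> (1 + a * h) ^ i" for i using a0 nn by simp
  have \<beta>_step: "(1 + a * h) * \<beta> i + h * p \<le> \<beta> (i + 1)" for i
  proof -
    have "h * p * 1 \<le> h * p * (1 + a * h) ^ (i + 1)"
      by (intro mult_left_mono pow1 mult_nonneg_nonneg nn p0)
    then show ?thesis by (simp add: \<beta>_def algebra_simps)
  qed
  have \<beta>0: "\<beta> i \<ge> 0" for i using p0 nn a0 by (simp add: \<beta>_def)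
  have \<beta>_mono: "\<beta> i \<le> \<beta> (i + 1)" for i
  proof -
    have "\<beta> i \<le> (1 + a * h) * \<beta> i + h * p"
      using \<beta>0[of i] a0 p0 nn by (simp add: algebra_simps)
    then show ?thesis using \<beta>_step[of i] by linarith
  qed
  have \<beta>_b: "\<beta> i \<le> b" if "i \<le> N" for i
  proof -
    have len0: "len \<ge> 0" using nn unfolding len[symmetric] by simp
    have ih: "real i * h \<le> len" unfolding len[symmetric] using that nn by (intro mult_right_mono) auto
    have "(1 + a * h) ^ i \<le> exp (a * h) ^ i"
      using a0 nn by (intro power_mono) (auto simp: exp_ge_add_one_self)
    also have "\<dots> = exp (a * (real i * h))" by (simp add: exp_of_nat_mult[symmetric] mult_ac)
    also have "\<dots> \<le> exp (a * len)" using a0 ih by (simp add: mult_left_mono)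
    finally have "(1 + a * h) ^ i \<le> exp (a * len)" .
    then show ?thesis unfolding \<beta>_def b using ih p0 nn a0 len0
      by (intro mult_mono mult_left_mono) auto
  qed
  have main: "j \<le> N \<Longrightarrow> (\<forall>i\<le>j. d i \<le> \<beta> i \<and> \<epsilon> i \<le> 2 * C * \<beta> i + \<sigma>)" for j
  proof (induction j)
    case 0
    then show ?case using init \<beta>0 nn by (auto simp: \<beta>_def)
  next
    case (Suc j)
    then have IH: "\<And>i. i \<le> j \<Longrightarrow> d i \<le> \<beta> i" "\<And>i. i \<le> j \<Longrightarrow> \<epsilon> i \<le> 2 * C * \<beta> i + \<sigma>" by auto
    have jN: "j < N" using Suc.prems by simp
    have Cb: "C * \<beta> j \<le> C * b" using \<beta>_b[of j] jN nn by (intro mult_left_mono) auto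
    have tube: "b + (2 * C * \<beta> j + \<sigma>) + \<sigma> \<le> \<rho>" using small Cb by (simp add: algebra_simps)
    have dj: "d (j + 1) \<le> \<beta> (j + 1)"
    proof (cases "j = 0")
      case True
      have "h * \<tau> \<le> h * p" using nn by (intro mult_left_mono) (auto simp: p)
      then show ?thesis using init \<beta>_step[of 0] True by (simp add: \<beta>_def)
    next
      case False
      have "d j + \<epsilon> j \<le> \<beta> j + (2 * C * \<beta> j + \<sigma>)" using IH[of j] by simp
      moreover have "\<dots> \<le> \<rho>" using tube \<beta>_b[of j] jN nn by linarith
      ultimately have "d (j + 1) \<le> d (j - 1) + 2 * h * L * (d j + \<epsilon> j) + h * \<tau>"
        using False jN by (intro dstep) auto
      also have "\<dots> \<le> \<beta> j + 2 * h * L * (\<beta> j + (2 * C * \<beta> j + \<sigma>)) + h * \<tau>"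
      proof -
        have "d (j - 1) \<le> \<beta> j" using IH(1)[of "j - 1"] \<beta>_mono[of "j - 1"] False by simp
        moreover have "2 * h * L * (d j + \<epsilon> j) \<le> 2 * h * L * (\<beta> j + (2 * C * \<beta> j + \<sigma>))"
          using IH[of j] nn by (intro mult_left_mono) auto
        ultimately show ?thesis by simp
      qed
      also have "\<dots> = (1 + a * h) * \<beta> j + h * p" by (simp add: a p algebra_simps)
      also have "\<dots> \<le> \<beta> (j + 1)" by (rule \<beta>_step)
      finally show ?thesis .
    qed
    have "\<epsilon> (j + 1) \<le> C * d (j + 1) + 1 / 2 * (\<epsilon> j + \<sigma>)"
      using dj \<beta>_b[of "j + 1"] jN IH(2)[of j] tube by (intro estep) auto
    also have "\<dots> \<le> C * \<beta> (j + 1) + 1 / 2 * (2 * C * \<beta> (j + 1) + \<sigma> + \<sigma>)"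
    proof -
      have "C * d (j + 1) \<le> C * \<beta> (j + 1)" "C * \<beta> j \<le> C * \<beta> (j + 1)"
        using dj \<beta>_mono[of j] nn by (auto intro: mult_left_mono)
      moreover have "x + 1 / 2 * (y + \<sigma>) \<le> x' + 1 / 2 * (2 * x' + \<sigma> + \<sigma>)"
        if "x \<le> x'" "w \<le> x'" "y \<le> 2 * w + \<sigma>" for x x' y w :: real
        using that by (simp add: field_simps)
      ultimately show ?thesis using IH(2)[OF order_refl] by (simp only: mult.assoc)
    qed
    finally have "\<epsilon> (j + 1) \<le> 2 * C * \<beta> (j + 1) + \<sigma>" by (simp add: field_simps)
    then show ?case using dj IH by (auto simp: le_Suc_eq)
  qed
  show "d i \<le> b" using main[OF i] \<beta>_b[OF i] by fastforce
  have "C * \<beta> i \<le> C * b" using \<beta>_b[OF i] nn by (intro mult_left_mono)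
  then show "\<epsilon> i \<le> 2 * C * b + \<sigma>" using main[OF i] by fastforce
qed

text \<open>
  Since \<open>f\<close> is merely continuous in \<open>t\<close>, no order of convergence can be expected: both the local error of
  the midpoint rule divided by \<open>h\<close> and the oscillation of \<open>u\<close> over a step are controlled by uniform
  continuity alone.
\<close>

lemma midpoint_newton_scheme_converges:
  fixes \<phi> \<gamma> :: "real \<Rightarrow> 'a::euclidean_space \<Rightarrow> 'a" and T0 T :: real
  defines "J \<equiv> {T0..T}" and "h \<equiv> step_size T0 T" and "g \<equiv> grid_point T0 T"
  assumes T: "T0 < T"
    and der: "\<And>t x. t \<in> J \<Longrightarrow> (\<phi> t has_derivative blinfun_apply (D t x)) (at x)"
    and contD: "continuous_on (J \<times> UNIV) (\<lambda>(t, x). D t x)"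
    and inj: "\<And>t x v. t \<in> J \<Longrightarrow> D t x v = v \<Longrightarrow> v = 0"
    and \<gamma>: "continuous_on (J \<times> UNIV) (\<lambda>(t, x). \<gamma> t x)" "local_lipschitz J UNIV \<gamma>"
    and u: "continuous_on J u" "\<And>t. t \<in> J \<Longrightarrow> u t = \<phi> t (z t + u t)"
    and z: "\<And>t. t \<in> J \<Longrightarrow> (z has_vector_derivative \<gamma> t (z t + u t)) (at t within J)"
    and init: "\<And>N. N \<ge> 1 \<Longrightarrow> zs N 0 = z T0" "\<And>N. N \<ge> 1 \<Longrightarrow> us N 0 = u T0"
      "\<And>N. N \<ge> 1 \<Longrightarrow> zs N 1 = z T0 + h N *\<^sub>R \<gamma> T0 (z T0 + u T0)"
    and newton: "\<And>N i. i < N \<Longrightarrow>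
      (us N (i + 1) - us N i) - D (g N (i + 1)) (zs N (i + 1) + us N i) (us N (i + 1) - us N i)
        = - (us N i - \<phi> (g N (i + 1)) (zs N (i + 1) + us N i))"
    and midpoint: "\<And>N i. 1 \<le> i \<Longrightarrow> i < N \<Longrightarrow>
      zs N (i + 1) = zs N (i - 1) + (2 * h N) *\<^sub>R \<gamma> (g N i) (zs N i + us N i)"
    and e: "e > 0"
  shows "\<forall>\<^sub>F N in sequentially. \<forall>i\<le>N. norm (z (g N i) - zs N i) < e \<and> norm (u (g N i) - us N i) < e"
proof -
  have J: "compact J" by (simp add: J_def)
  have z_cont: "continuous_on J z" using z by (rule continuous_on_vector_derivative)
  define z' where "z' = (\<lambda>t. \<gamma> t (z t + u t))"
  have z'_cont: "continuous_on J z'"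
    unfolding z'_def
    by (rule continuous_on_case_prod[OF \<gamma>(1)]) (auto intro!: continuous_intros z_cont u)
  obtain \<rho> C where \<rho>: "\<rho> > 0" "\<rho> \<le> 1" "C \<ge> 0" and newton_err:
    "\<And>t y v v'. t \<in> J \<Longrightarrow> norm (y + v - (z t + u t)) \<le> \<rho> \<Longrightarrow>
      (v' - v) - D t (y + v) (v' - v) = - (v - \<phi> t (y + v)) \<Longrightarrow>
      norm (v' - u t) \<le> C * norm (y - z t) + 1 / 2 * norm (v - u t)"
    by (rule newton_step_error[OF der contD J inj z_cont u]) blast+
  obtain r where r: "\<And>t. t \<in> J \<Longrightarrow> norm (z t + u t) \<le> r"
    using compact_image_norm_bound[OF J, of "\<lambda>t. z t + u t"] z_cont u(1) by (auto intro: continuous_intros)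
  obtain L where L: "\<And>t. t \<in> J \<Longrightarrow> L-lipschitz_on (cball 0 (r + 1)) (\<gamma> t)"
  proof -
    have "local_lipschitz J (cball 0 (r + 1)) \<gamma>" by (rule local_lipschitz_subset[OF \<gamma>(2)]) auto
    moreover have "continuous_on J (\<lambda>t. \<gamma> t x)" for x
      by (rule continuous_on_case_prod[OF \<gamma>(1)]) (auto intro: continuous_intros)
    ultimately show thesis
      using local_lipschitz_compact_implies_lipschitz[OF _ compact_cball J] that by metis
  qed
  have L0: "L \<ge> 0" using lipschitz_on_nonneg[OF L[of T0]] T by (simp add: J_def)
  define len where "len = T - T0"
  define a where "a = 2 * L * (1 + 2 * C)"
  define Q where "Q = (1 + 2 * C) * ((2 * L + 1) * len * exp (a * len)) + 2"
  have len0: "len > 0" using T by (simp add: len_def)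
  have E0: "(2 * L + 1) * len * exp (a * len) \<ge> 0" using L0 len0 by simp
  have Q: "Q \<ge> 2" unfolding Q_def using E0 \<rho> by simp
  \<comment> \<open>with local errors of size \<open>s\<close> every bound produced by the recursion is at most \<open>s * Q\<close>\<close>
  define s where "s = min \<rho> (e / 2) / Q"
  have s: "s > 0" using \<rho> e Q by (simp add: s_def)
  have sQ: "s * Q \<le> \<rho>" "s * Q < e" using Q e by (auto simp: s_def min_def)
  define p where "p = 2 * L * s + s"
  define b where "b = p * len * exp (a * len)"
  have "(1 + 2 * C) * b + 2 * s = s * Q"
    by (simp add: b_def p_def Q_def algebra_simps)
  then have bs: "(1 + 2 * C) * b + 2 * s \<le> \<rho>" "(1 + 2 * C) * b + 2 * s < e" using sQ by auto
  have b0: "b \<ge> 0" using L0 s len0 by (simp add: b_def p_def)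
  have Cb0: "C * b \<ge> 0" using \<rho> b0 by simp
  obtain \<delta> where \<delta>: "\<delta> > 0" "\<And>t t'. t \<in> J \<Longrightarrow> t' \<in> J \<Longrightarrow> \<bar>t - t'\<bar> < \<delta> \<Longrightarrow> norm (u t - u t') \<le> s"
    "\<And>t t'. t \<in> J \<Longrightarrow> t' \<in> J \<Longrightarrow> \<bar>t - t'\<bar> < \<delta> \<Longrightarrow> norm (z' t - z' t') \<le> s / 2"
  proof -
    obtain d1 where "d1 > 0" "\<forall>t'\<in>J. \<forall>t\<in>J. dist t t' < d1 \<longrightarrow> dist (u t) (u t') < s"
      using compact_uniformly_continuous[OF u(1) J] s unfolding uniformly_continuous_on_def by metis
    moreover obtain d2 where "d2 > 0" "\<forall>t'\<in>J. \<forall>t\<in>J. dist t t' < d2 \<longrightarrow> dist (z' t) (z' t') < s / 2"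
      using compact_uniformly_continuous[OF z'_cont J] s unfolding uniformly_continuous_on_def
      by (metis half_gt_zero)
    ultimately show thesis
      by (intro that[of "min d1 d2"]) (auto simp: dist_norm less_imp_le)
  qed
  have "\<forall>\<^sub>F N in sequentially. h N < \<delta>"
  proof -
    have "h \<longlonglongrightarrow> 0" unfolding h_def step_size_def
      by (rule lim_const_over_n)
    then show ?thesis using \<delta>(1) by (rule order_tendstoD)
  qed
  then show ?thesis using eventually_ge_at_top[of 1]
  proof eventually_elim
    case (elim N)
    have N: "N \<ge> 1" and h\<delta>: "h N < \<delta>" using elim by auto
    have h0: "h N > 0" using T N by (simp add: h_def step_size_def)
    have Nh: "real N * h N = len" using N by (simp add: h_def step_size_def len_def)
    have g_eq: "g N i = T0 + real i * h N" for i by (simp add: g_def h_def grid_point_def)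
    have gJ: "g N i \<in> J" if "i \<le> N" for i
    proof -
      have "real i * h N \<le> real N * h N" using that h0 by (intro mult_right_mono) auto
      then show ?thesis using h0 Nh by (simp add: J_def g_eq len_def)
    qed
    have g_Suc: "g N (Suc i) = g N i + h N" for i by (simp add: g_eq algebra_simps)
    \<comment> \<open>local consistency error of a difference quotient of \<open>z\<close>\<close>
    have consist: "norm (z t2 - z t1 - (t2 - t1) *\<^sub>R z' m) \<le> (t2 - t1) * (s / 2)"
      if "t1 \<in> J" "t2 \<in> J" "t1 \<le> m" "m \<le> t2" "m - t1 \<le> h N" "t2 - m \<le> h N" for t1 t2 m
    proof -
      have "norm (z t2 - z t1 - (t2 - t1) *\<^sub>R z' m) \<le> norm (t2 - t1) * (s / 2)"
      proof (rule vector_differentiable_bound_linearization[where S = "{t1..t2}"])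
        show "(z has_vector_derivative z' x) (at x within {t1..t2})" if "x \<in> {t1..t2}" for x
          unfolding z'_def
          by (rule has_vector_derivative_within_subset[OF z]) (use that \<open>t1 \<in> J\<close> \<open>t2 \<in> J\<close> in \<open>auto simp: J_def\<close>)
        show "closed_segment t1 t2 \<subseteq> {t1..t2}" using that by (simp add: closed_segment_eq_real_ivl)
        show "norm (z' x - z' m) \<le> s / 2" if "x \<in> {t1..t2}" for x
          using that \<open>t1 \<in> J\<close> \<open>t2 \<in> J\<close> \<open>t1 \<le> m\<close> \<open>m \<le> t2\<close> \<open>m - t1 \<le> h N\<close> \<open>t2 - m \<le> h N\<close> h\<delta>
          by (intro \<delta>(3)) (auto simp: J_def abs_if)
        show "m \<in> {t1..t2}" using that by auto
      qed
      then show ?thesis using that by simp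
    qed
    define d where "d = (\<lambda>i. norm (zs N i - z (g N i)))"
    define \<epsilon> where "\<epsilon> = (\<lambda>i. norm (us N i - u (g N i)))"
    have g0: "g N 0 = T0" by (simp add: g_eq)
    have bounds: "d i \<le> b" "\<epsilon> i \<le> 2 * C * b + s" if "i \<le> N" for i
    proof -
      have init_d: "d 1 \<le> h N * s"
      proof -
        have "zs N 1 - z (g N 1) = - (z (g N 1) - z T0 - (g N 1 - T0) *\<^sub>R z' T0)"
          by (simp add: init(3)[OF N, unfolded One_nat_def] g_eq z'_def)
        then have "d 1 = norm (z (g N 1) - z T0 - (g N 1 - T0) *\<^sub>R z' T0)"
          unfolding d_def by (simp only: norm_minus_cancel)
        also have "\<dots> \<le> (g N 1 - T0) * (s / 2)"
          using gJ[of 0] gJ[OF N] h0 by (intro consist) (auto simp: g_eq)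
        also have "\<dots> \<le> h N * s" using h0 s by (simp add: g_eq)
        finally show ?thesis .
      qed
      have dstep: "d (i + 1) \<le> d (i - 1) + 2 * h N * L * (d i + \<epsilon> i) + h N * s"
        if i: "1 \<le> i" "i < N" and near: "d i + \<epsilon> i \<le> \<rho>" for i
      proof -
        define x where "x = zs N i + us N i"
        define x' where "x' = z (g N i) + u (g N i)"
        have xx: "norm (x - x') \<le> d i + \<epsilon> i"
          unfolding d_def \<epsilon>_def x_def x'_def by (metis add_diff_add norm_triangle_ineq)
        have x'S: "norm x' \<le> r" unfolding x'_def using i by (intro r gJ) auto
        moreover have "norm x \<le> norm x' + norm (x - x')" by (rule norm_triangle_sub)
        ultimately have inS: "x \<in> cball 0 (r + 1)" "x' \<in> cball 0 (r + 1)" using xx near \<rho>(2) by auto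
        have gi: "g N (i - 1) = g N i - h N" "g N (i + 1) = g N i + h N"
          using i by (auto simp: g_eq of_nat_diff algebra_simps)
        have gd: "g N (i + 1) - g N (i - 1) = 2 * h N" unfolding gi by simp
        let ?q = "z (g N (i + 1)) - z (g N (i - 1)) - (g N (i + 1) - g N (i - 1)) *\<^sub>R z' (g N i)"
        have eq: "zs N (i + 1) - z (g N (i + 1)) = (zs N (i - 1) - z (g N (i - 1)))
            + (2 * h N) *\<^sub>R (\<gamma> (g N i) x - \<gamma> (g N i) x')
            - ?q"
          unfolding midpoint[OF i] z'_def gd by (simp add: x_def x'_def algebra_simps)
        have tri: "norm (v1 + v2 - v3) \<le> norm v1 + norm v2 + norm v3" for v1 v2 v3 :: 'a
          by (rule order_trans[OF norm_triangle_ineq4 add_mono[OF norm_triangle_ineq order_refl]])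
        have "d (i + 1) \<le> d (i - 1) + norm ((2 * h N) *\<^sub>R (\<gamma> (g N i) x - \<gamma> (g N i) x'))
            + norm ?q"
          unfolding d_def eq by (rule tri)
        also have "norm ((2 * h N) *\<^sub>R (\<gamma> (g N i) x - \<gamma> (g N i) x')) \<le> 2 * h N * (L * (d i + \<epsilon> i))"
        proof -
          have "norm (\<gamma> (g N i) x - \<gamma> (g N i) x') \<le> L * norm (x - x')"
            using lipschitz_onD[OF L[OF gJ] inS] i by (simp add: dist_norm)
          also have "\<dots> \<le> L * (d i + \<epsilon> i)" by (intro mult_left_mono xx L0)
          finally show ?thesis using h0 by simp
        qed
        also have "norm ?q \<le> h N * s"
        proof -
          have "g N (i - 1) \<le> g N i" "g N i \<le> g N (i + 1)"
            "g N i - g N (i - 1) \<le> h N" "g N (i + 1) - g N i \<le> h N"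
            unfolding gi using h0 by simp_all
          moreover have "g N (i - 1) \<in> J" "g N (i + 1) \<in> J" using i by (auto intro!: gJ)
          ultimately have "norm ?q
            \<le> (g N (i + 1) - g N (i - 1)) * (s / 2)"
            by (intro consist)
          then show ?thesis unfolding gd by simp
        qed
        finally show ?thesis by simp
      qed
      have estep: "\<epsilon> (i + 1) \<le> C * d (i + 1) + 1 / 2 * (\<epsilon> i + s)"
        if i: "i < N" and near: "d (i + 1) + \<epsilon> i + s \<le> \<rho>" for i
      proof -
        let ?t = "g N (i + 1)"
        have tJ: "?t \<in> J" "g N i \<in> J" using i by (auto intro!: gJ)
        have "norm (u (g N i) - u ?t) \<le> s" using tJ h0 h\<delta> by (intro \<delta>(2)) (auto simp: g_Suc)
        then have e1: "norm (us N i - u ?t) \<le> \<epsilon> i + s"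
          unfolding \<epsilon>_def using norm_triangle_ineq[of "us N i - u (g N i)" "u (g N i) - u ?t"] by simp
        have "zs N (i + 1) + us N i - (z ?t + u ?t) = (zs N (i + 1) - z ?t) + (us N i - u ?t)" by simp
        then have "norm (zs N (i + 1) + us N i - (z ?t + u ?t)) \<le> d (i + 1) + norm (us N i - u ?t)"
          unfolding d_def by (metis norm_triangle_ineq)
        then have "norm (zs N (i + 1) + us N i - (z ?t + u ?t)) \<le> \<rho>" using e1 near by simp
        from newton_err[OF tJ(1) this newton[OF i]]
        show ?thesis using e1 by (simp add: d_def \<epsilon>_def field_simps)
      qed
      show "d i \<le> b" "\<epsilon> i \<le> 2 * C * b + s"
        using coupled_error_recursion[of "h N" L C s s d \<epsilon> N \<rho> len a p b i, OF _ L0 \<rho>(3) _ _ _ _ init_d dstep estep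
            Nh a_def p_def b_def bs(1) that] h0 s N
        by (auto simp: d_def \<epsilon>_def init g0)
    qed
    show "\<forall>i\<le>N. norm (z (g N i) - zs N i) < e \<and> norm (u (g N i) - us N i) < e"
    proof (intro allI impI)
      fix i assume i: "i \<le> N"
      have "b < e" "2 * C * b + s < e" using bs(2) b0 Cb0 s by (auto simp: algebra_simps)
      then show "norm (z (g N i) - zs N i) < e \<and> norm (u (g N i) - us N i) < e"
        using bounds[OF i] by (simp add: d_def \<epsilon>_def norm_minus_commute)
    qed
  qed
qed

section \<open>Uniqueness from basis invertibility\<close>

lemma linop_on_0: "linop_on W Z F \<Longrightarrow> 0 \<in> W \<Longrightarrow> F 0 = 0"
  unfolding linop_on_def by (metis scaleR_zero_left)

lemma invertible_op_kernel:
  assumes "invertible_op W Z F" "w \<in> W" "0 \<in> W" "0 \<in> Z" "F w = 0"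
  shows "w = 0"
proof -
  obtain F' where "linop_on Z W F'" "\<forall>w\<in>W. F' (F w) = w"
    using assms(1) unfolding invertible_op_def by blast
  then show ?thesis using linop_on_0[of Z W F'] assms by metis
qed

text \<open>
  A one-dimensional projector is determined by a single coordinate, so that a real mean value theorem
  becomes applicable to each component.
\<close>

lemma additive_resolution_separating_functional:
  assumes \<Theta>: "additive_resolution Z s \<Theta>" and k: "k \<in> {1..s}"
  obtains e where "\<And>z. z \<in> Z \<Longrightarrow> \<Theta> k z \<bullet> e = 0 \<Longrightarrow> \<Theta> k z = 0"
proof -
  have "dim (\<Theta> k ` Z) = 1" using \<Theta> k unfolding additive_resolution_def by blast
  then obtain b where b: "b \<subseteq> \<Theta> k ` Z" "\<Theta> k ` Z \<subseteq> span b" "card b = 1"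
    using basis_exists[of "\<Theta> k ` Z"] by metis
  then obtain e where e: "b = {e}" by (auto simp: card_1_singleton_iff)
  show thesis
  proof (rule that[of e])
    fix z assume "z \<in> Z" and 0: "\<Theta> k z \<bullet> e = 0"
    then have "\<Theta> k z \<in> span {e}" using b(2) e by auto
    then obtain c where "\<Theta> k z = c *\<^sub>R e" by (auto simp: span_singleton)
    then show "\<Theta> k z = 0" using 0 by auto
  qed
qed

text \<open>
  The mean value theorem fails for vector-valued functions, but holds for each component \<open>\<Theta>\<^sub>k q\<close> with its own
  intermediate point \<open>w\<^sub>k\<close>.  If \<open>q\<close> takes equal values at the ends, then \<open>\<Theta>\<^sub>k \<Phi>(w\<^sub>k)\<close> annihilates
  \<open>w2 - w1\<close> for every \<open>k\<close>, and so does their sum, which is invertible.  The projection \<open>R\<close> onto \<open>Z\<close> extends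
  \<open>\<Theta>\<^sub>k\<close> to the whole space, where differentiation takes place.
\<close>

lemma basis_invertible_imp_injective:
  fixes q :: "'a::euclidean_space \<Rightarrow> 'b::euclidean_space"
  assumes W: "subspace W" and bi: "basis_invertible W Z \<Phi> w1 w2" and w: "w1 \<in> W" "w2 \<in> W"
    and R: "linear R" "\<And>y. R y \<in> Z" "\<And>z. z \<in> Z \<Longrightarrow> R z = z" and Z: "subspace Z"
    and der: "\<And>w. w \<in> closed_segment w1 w2 \<Longrightarrow> (q has_derivative q' w) (at w)"
    and q': "\<And>w v. w \<in> closed_segment w1 w2 \<Longrightarrow> v \<in> W \<Longrightarrow> q' w v = \<Phi> w v"
    and \<Phi>Z: "\<And>w v. w \<in> closed_segment w1 w2 \<Longrightarrow> v \<in> W \<Longrightarrow> \<Phi> w v \<in> Z"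
    and eq: "q w1 = q w2"
  shows "w1 = w2"
proof -
  obtain \<Theta> where \<Theta>: "additive_resolution Z (dim Z) \<Theta>"
    and inv: "\<And>w. (\<forall>k\<in>{1..dim Z}. w k \<in> closed_segment w1 w2) \<Longrightarrow>
             invertible_op W Z (\<lambda>v. \<Sum>k=1..dim Z. \<Theta> k (\<Phi> (w k) v))"
    using bi unfolding basis_invertible_def by blast
  let ?d = "w2 - w1"
  have dW: "?d \<in> W" using W w by (simp add: subspace_diff)
  have "\<exists>w\<in>closed_segment w1 w2. \<Theta> k (\<Phi> w ?d) = 0" if k: "k \<in> {1..dim Z}" for k
  proof -
    obtain e where e: "\<And>z. z \<in> Z \<Longrightarrow> \<Theta> k z \<bullet> e = 0 \<Longrightarrow> \<Theta> k z = 0"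
      using additive_resolution_separating_functional[OF \<Theta> k] by blast
    have lin: "linop_on Z Z (\<Theta> k)" using \<Theta> k unfolding additive_resolution_def by blast
    have "linear (\<lambda>y. \<Theta> k (R y))"
    proof (rule linearI)
      show "\<Theta> k (R (x + y)) = \<Theta> k (R x) + \<Theta> k (R y)" for x y
        using lin R(2) unfolding linop_on_def by (simp add: linear_add[OF R(1)])
      show "\<Theta> k (R (c *\<^sub>R x)) = c *\<^sub>R \<Theta> k (R x)" for c x
        using lin R(2) unfolding linop_on_def by (simp add: linear_scale[OF R(1)])
    qed
    then have bl: "bounded_linear (\<lambda>y. \<Theta> k (R y))" by (simp add: linear_conv_bounded_linear)
    define \<sigma> where "\<sigma> = (\<lambda>t :: real. w1 + t *\<^sub>R ?d)"
    have seg: "\<sigma> t \<in> closed_segment w1 w2" if "0 \<le> t" "t \<le> 1" for t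
      unfolding closed_segment_def using that
      by (auto intro!: exI[of _ t] simp: \<sigma>_def algebra_simps)
    define p where "p = (\<lambda>t. \<Theta> k (R (q (\<sigma> t))) \<bullet> e)"
    have pd: "(p has_derivative (\<lambda>h. \<Theta> k (R (q' (\<sigma> t) (h *\<^sub>R ?d))) \<bullet> e)) (at t)"
      if t: "0 \<le> t" "t \<le> 1" for t
    proof -
      have "(\<sigma> has_derivative (\<lambda>h. h *\<^sub>R ?d)) (at t)"
        unfolding \<sigma>_def by (auto intro!: derivative_eq_intros)
      from has_derivative_compose[OF this der[OF seg[OF t]]]
      show ?thesis unfolding p_def
        by (intro has_derivative_inner_left bounded_linear.has_derivative[OF bl])
    qed
    have "\<exists>\<xi>\<in>{0..1}. p 1 - p 0 = \<Theta> k (R (q' (\<sigma> \<xi>) ((1 - 0) *\<^sub>R ?d))) \<bullet> e"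
      by (rule mvt_very_simple[of 0 1 p "\<lambda>t h. \<Theta> k (R (q' (\<sigma> t) (h *\<^sub>R ?d))) \<bullet> e"])
        (auto intro: has_derivative_at_withinI pd)
    moreover have "p 1 - p 0 = 0" by (simp add: p_def \<sigma>_def eq)
    ultimately obtain \<xi> where \<xi>: "\<xi> \<in> {0..1}" "\<Theta> k (R (q' (\<sigma> \<xi>) ?d)) \<bullet> e = 0" by auto
    have s: "\<sigma> \<xi> \<in> closed_segment w1 w2" using \<xi>(1) by (intro seg) auto
    have "\<Theta> k (\<Phi> (\<sigma> \<xi>) ?d) = 0"
      using e[OF \<Phi>Z[OF s dW]] \<xi>(2) by (simp add: q'[OF s dW] R(3)[OF \<Phi>Z[OF s dW]])
    then show ?thesis using s by blast
  qed
  then have "\<forall>k. \<exists>w. k \<in> {1..dim Z} \<longrightarrow> w \<in> closed_segment w1 w2 \<and> \<Theta> k (\<Phi> w ?d) = 0" by blast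
  from choice[OF this] obtain w where w: "\<And>k. k \<in> {1..dim Z} \<Longrightarrow> w k \<in> closed_segment w1 w2"
    "\<And>k. k \<in> {1..dim Z} \<Longrightarrow> \<Theta> k (\<Phi> (w k) ?d) = 0" by blast
  have "?d = 0"
    by (rule invertible_op_kernel[OF inv[of w] dW]) (use w W Z in \<open>auto simp: subspace_0\<close>)
  then show ?thesis by simp
qed

lemma basis_invertible_diagonal:
  assumes bi: "basis_invertible W Z \<Phi> w w" and \<Phi>: "\<And>v. v \<in> W \<Longrightarrow> \<Phi> w v \<in> Z"
    and v: "v \<in> W" "\<Phi> w v = 0" and 0: "0 \<in> W" "0 \<in> Z"
  shows "v = 0"
proof -
  obtain \<Theta> where \<Theta>: "additive_resolution Z (dim Z) \<Theta>"
    and inv: "\<And>f. (\<forall>k\<in>{1..dim Z}. f k \<in> closed_segment w w) \<Longrightarrow>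
             invertible_op W Z (\<lambda>v. \<Sum>k=1..dim Z. \<Theta> k (\<Phi> (f k) v))"
    using bi unfolding basis_invertible_def by blast
  show ?thesis
    by (rule invertible_op_kernel[OF inv[of "\<lambda>_. w"] v(1) 0])
      (use \<Theta> v(2) 0 in \<open>auto simp: additive_resolution_def\<close>)
qed

section \<open>Reduction to a semi-explicit system\<close>

lemmas mult_continuous_on = bounded_linear.continuous_on[OF matrix_vector_mul_bounded_linear]
  and mult_has_vector_derivative =
    bounded_linear.has_vector_derivative[OF matrix_vector_mul_bounded_linear]

definition mat_blinfun :: "real^'n^'m \<Rightarrow> (real^'n) \<Rightarrow>\<^sub>L (real^'m)" where
  "mat_blinfun M = Blinfun ((*v) M)"

lemma mat_blinfun_apply [simp]: "blinfun_apply (mat_blinfun M) v = M *v v"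
  by (simp add: mat_blinfun_def bounded_linear_Blinfun_apply)

lemma bounded_linear_mat_blinfun: "bounded_linear (mat_blinfun :: real^'n^'m \<Rightarrow> _)"
proof -
  have "linear (mat_blinfun :: real^'n^'m \<Rightarrow> _)"
    by (rule linearI; rule blinfun_eqI)
      (simp_all add: blinfun.add_left blinfun.scaleR_left matrix_vector_mult_add_rdistrib scaleR_matrix_vector_assoc)
  then show ?thesis by (simp add: linear_conv_bounded_linear)
qed

lemma bounded_linear_matrix_mult_left: "bounded_linear (\<lambda>M :: real^'n^'m. K ** M)"
  for K :: "real^'m^'k"
proof -
  have "linear (\<lambda>M :: real^'n^'m. K ** M)"
    by (rule linearI) (simp_all add: vec_eq_iff matrix_matrix_mult_def algebra_simps sum.distrib sum_distrib_left)
  then show ?thesis by (simp add: linear_conv_bounded_linear)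
qed

lemma has_derivative_jacobian_mult:
  fixes F :: "real^'n \<Rightarrow> real^'n" and M :: "real^'n^'n"
  assumes "F differentiable (at x)"
  shows "((\<lambda>y. M *v F y) has_derivative (*v) (M ** jacobian F (at x))) (at x)"
proof -
  have "(F has_derivative (*v) (jacobian F (at x))) (at x)" using assms by (simp add: jacobian_works)
  then have "((\<lambda>y. M *v F y) has_derivative (\<lambda>h. M *v (jacobian F (at x) *v h))) (at x)"
    by (rule bounded_linear.has_derivative[OF matrix_vector_mul_bounded_linear])
  then show ?thesis by (simp add: matrix_vector_mul_assoc)
qed

lemma jacobian_unique:
  fixes F :: "real^'n \<Rightarrow> real^'m"
  assumes "(F has_derivative (*v) M) (at x)"
  shows "jacobian F (at x) = M"
  unfolding jacobian_def frechet_derivative_at[OF assms, symmetric] by (rule matrix_of_matrix_vector_mul)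

text \<open>
  Of the spectral projectors only these algebraic relations matter from here on, not the contour
  integrals that define them.
\<close>

locale index_one_dae =
  fixes A B P1 P2 Q1 Q2 G :: "real^'n^'n" and f :: "real \<Rightarrow> real^'n \<Rightarrow> real^'n"
  assumes P1: "P1 ** P1 = P1" and Q1: "Q1 ** Q1 = Q1" and AP: "A ** P1 = A" and QA: "Q1 ** A = A"
    and QB: "Q1 ** B = B ** P1" and P2: "P2 = mat 1 - P1" and Q2: "Q2 = mat 1 - Q1"
    and G: "G = A + B ** P2" and G_inv: "invertible G" and f: "cont_with_d_dx f"
begin

text \<open>
  The right-hand sides of the semi-explicit system: \<open>\<phi>\<close> has values in \<open>X2\<close> and \<open>\<gamma>\<close> in \<open>X1\<close>.
\<close>

abbreviation "G' \<equiv> matrix_inv G"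

definition "\<phi> t x = G' *v (Q2 *v f t x)"
definition "\<gamma> t x = G' *v (Q1 *v f t x - B *v (P1 *v x))"
definition "D\<phi> t x = G' ** (Q2 ** d_dx f t x)"
definition "D\<gamma> t x = G' ** (Q1 ** d_dx f t x - B ** P1)"

abbreviation "X1 \<equiv> range (\<lambda>v. P1 *v v)"
abbreviation "X2 \<equiv> range (\<lambda>v. P2 *v v)"
abbreviation "Y2 \<equiv> range (\<lambda>v. Q2 *v v)"

lemma matrix_facts:
  "G' ** G = mat 1" "G ** G' = mat 1"
  "P1 ** P2 = 0" "P2 ** P1 = 0" "P2 ** P2 = P2" "Q1 ** Q2 = 0" "Q2 ** Q1 = 0" "Q2 ** Q2 = Q2"
  "G ** P1 = A" "G ** P2 = B ** P2" "Q2 ** B = B ** P2" "Q2 ** A = 0"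
  "P1 ** G' = G' ** Q1" "P2 ** G' = G' ** Q2"
  "G' ** A = P1" "G' ** (B ** P2) = P2"
proof -
  show inv: "G' ** G = mat 1" "G ** G' = mat 1"
    using invertible_matrix_inv[OF G_inv] by auto
  show p: "P1 ** P2 = 0" "P2 ** P1 = 0" "P2 ** P2 = P2"
    by (simp_all add: P2 matrix_diff_ldistrib matrix_diff_rdistrib P1)
  show "Q1 ** Q2 = 0" "Q2 ** Q1 = 0" "Q2 ** Q2 = Q2"
    by (simp_all add: Q2 matrix_diff_ldistrib matrix_diff_rdistrib Q1)
  show GP1: "G ** P1 = A"
    by (simp add: G matrix_add_rdistrib AP matrix_mul_assoc[symmetric] p)
  have AP2: "A ** P2 = 0" by (simp add: P2 matrix_diff_ldistrib AP)
  show GP2: "G ** P2 = B ** P2"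
    by (simp add: G matrix_add_rdistrib AP2 matrix_mul_assoc[symmetric] p)
  show QB2: "Q2 ** B = B ** P2"
    by (simp add: Q2 P2 matrix_diff_ldistrib matrix_diff_rdistrib QB)
  show QA2: "Q2 ** A = 0" by (simp add: Q2 matrix_diff_rdistrib QA)
  have Q1G: "Q1 ** G = G ** P1"
    unfolding GP1 by (simp add: G matrix_add_ldistrib QA matrix_mul_assoc QB)
      (simp add: matrix_mul_assoc[symmetric] p)
  have Q2G: "Q2 ** G = G ** P2"
    by (simp add: Q2 P2 matrix_diff_ldistrib matrix_diff_rdistrib Q1G)
  have comm: "P ** G' = G' ** Q" if "Q ** G = G ** P" for P Q
  proof -
    have "P ** G' = G' ** (G ** P) ** G'"
      by (simp add: matrix_mul_assoc inv)
    also have "\<dots> = G' ** Q ** (G ** G')"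
      unfolding that[symmetric] by (simp only: matrix_mul_assoc)
    finally show ?thesis by (simp add: inv)
  qed
  show "P1 ** G' = G' ** Q1" "P2 ** G' = G' ** Q2"
    by (rule comm, fact)+
  show "G' ** A = P1" unfolding GP1[symmetric] by (simp add: matrix_mul_assoc inv)
  show "G' ** (B ** P2) = P2" unfolding GP2[symmetric] by (simp add: matrix_mul_assoc inv)
qed

lemma P_sum: "P1 *v x + P2 *v x = x"
  by (simp add: P2 matrix_vector_mult_diff_rdistrib)

lemma X1_iff: "x \<in> X1 \<longleftrightarrow> P1 *v x = x"
proof
  assume "x \<in> X1"
  then show "P1 *v x = x" by (auto simp: matrix_vector_mul_assoc P1)
next
  assume "P1 *v x = x"
  then have "x = P1 *v x" by simp
  then show "x \<in> X1" by (rule range_eqI)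
qed

lemma X2_iff: "x \<in> X2 \<longleftrightarrow> P1 *v x = 0"
proof
  assume "x \<in> X2"
  then obtain v where "x = P2 *v v" by auto
  then show "P1 *v x = 0" by (simp add: matrix_vector_mul_assoc matrix_facts)
next
  assume "P1 *v x = 0"
  then have "x = P2 *v x" using P_sum[of x] by simp
  then show "x \<in> X2" by (rule range_eqI)
qed

lemma subspaces: "subspace X1" "subspace X2" "subspace Y2"
  by (auto intro!: linear_subspace_image)

lemma P1_\<phi> [simp]: "P1 *v \<phi> t x = 0"
proof -
  have "P1 *v \<phi> t x = (G' ** (Q1 ** Q2)) *v f t x"
    unfolding \<phi>_def by (simp only: matrix_vector_mul_assoc matrix_mul_assoc matrix_facts(13))
  then show ?thesis by (simp add: matrix_facts)
qed

lemma P1_D\<phi> [simp]: "P1 *v (D\<phi> t x *v v) = 0"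
proof -
  have "P1 ** D\<phi> t x = G' ** (Q1 ** Q2) ** d_dx f t x"
    unfolding D\<phi>_def by (metis matrix_facts(13) matrix_mul_assoc)
  then show ?thesis by (simp add: matrix_vector_mul_assoc matrix_facts)
qed

lemma P1_\<gamma> [simp]: "P1 *v \<gamma> t x = \<gamma> t x"
proof -
  have "P1 *v \<gamma> t x = G' *v (Q1 *v (Q1 *v f t x - B *v (P1 *v x)))"
    by (simp add: \<gamma>_def matrix_vector_mul_assoc matrix_facts(13))
  also have "Q1 *v (Q1 *v f t x - B *v (P1 *v x)) = Q1 *v f t x - B *v (P1 *v x)"
  proof -
    have "Q1 *v (B *v (P1 *v x)) = B *v (P1 *v x)" "Q1 *v (Q1 *v f t x) = Q1 *v f t x"
      by (metis QB P1 matrix_vector_mul_assoc, metis Q1 matrix_vector_mul_assoc)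
    then show ?thesis by (simp add: matrix_vector_mult_diff_distrib)
  qed
  finally show ?thesis by (simp add: \<gamma>_def)
qed

lemma f_facts:
  shows "continuous_on ({0..} \<times> UNIV) (\<lambda>(t, x). f t x)"
    "\<And>t x. t \<ge> 0 \<Longrightarrow> f t differentiable (at x)"
    "continuous_on ({0..} \<times> UNIV) (\<lambda>(t, x). d_dx f t x)"
  using f unfolding cont_with_d_dx_def by auto

lemma \<phi>_deriv: "t \<in> {0..} \<Longrightarrow> (\<phi> t has_derivative blinfun_apply (mat_blinfun (D\<phi> t x))) (at x)"
proof -
  assume t: "t \<in> {0..}"
  have "((\<lambda>y. Q2 *v f t y) has_derivative (*v) (Q2 ** d_dx f t x)) (at x)"
    unfolding d_dx_def using t by (intro has_derivative_jacobian_mult f_facts) auto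
  from bounded_linear.has_derivative[OF matrix_vector_mul_bounded_linear[of "G'"] this]
  show ?thesis unfolding \<phi>_def[abs_def] D\<phi>_def
    by (simp add: matrix_vector_mul_assoc mat_blinfun_apply[abs_def])
qed

lemma \<gamma>_deriv: "t \<in> {0..} \<Longrightarrow> (\<gamma> t has_derivative blinfun_apply (mat_blinfun (D\<gamma> t x))) (at x)"
proof -
  assume t: "t \<in> {0..}"
  have "((\<lambda>y. Q1 *v f t y - (B ** P1) *v y) has_derivative (\<lambda>h. (Q1 ** d_dx f t x) *v h - (B ** P1) *v h)) (at x)"
    unfolding d_dx_def using t
    by (intro has_derivative_diff has_derivative_jacobian_mult f_facts
        bounded_linear_imp_has_derivative matrix_vector_mul_bounded_linear) auto
  from bounded_linear.has_derivative[OF matrix_vector_mul_bounded_linear[of "G'"] this]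
  show ?thesis unfolding \<gamma>_def[abs_def] D\<gamma>_def
    by (simp add: matrix_vector_mul_assoc matrix_vector_mult_diff_rdistrib[symmetric] mat_blinfun_apply[abs_def])
qed

lemma continuity:
  "continuous_on ({0..} \<times> UNIV) (\<lambda>(t, x). \<phi> t x)"
  "continuous_on ({0..} \<times> UNIV) (\<lambda>(t, x). \<gamma> t x)"
  "continuous_on ({0..} \<times> UNIV) (\<lambda>(t, x). mat_blinfun (D\<phi> t x))"
  "continuous_on ({0..} \<times> UNIV) (\<lambda>(t, x). mat_blinfun (D\<gamma> t x))"
proof -
  have *: "continuous_on S (\<lambda>p. M *v h p)" if "continuous_on S h" for S M and h :: "_ \<Rightarrow> real^'n"
    by (rule mult_continuous_on[OF that])
  have **: "continuous_on S (\<lambda>p. M ** h p)" if "continuous_on S h" for S and M :: "real^'n^'n" and h :: "_ \<Rightarrow> real^'n^'n"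
    by (rule bounded_linear.continuous_on[OF bounded_linear_matrix_mult_left that])
  note c = f_facts(1,3)[unfolded case_prod_unfold]
  show "continuous_on ({0..} \<times> UNIV) (\<lambda>(t, x). \<phi> t x)"
    "continuous_on ({0..} \<times> UNIV) (\<lambda>(t, x). \<gamma> t x)"
    "continuous_on ({0..} \<times> UNIV) (\<lambda>(t, x). mat_blinfun (D\<phi> t x))"
    "continuous_on ({0..} \<times> UNIV) (\<lambda>(t, x). mat_blinfun (D\<gamma> t x))"
    unfolding \<phi>_def \<gamma>_def D\<phi>_def D\<gamma>_def case_prod_unfold
    by (intro * ** c continuous_intros bounded_linear.continuous_on[OF bounded_linear_mat_blinfun])+
qed

lemma constraint_iff: "Q2 *v (B *v x - f t x) = 0 \<longleftrightarrow> x - \<phi> t x = P1 *v x"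
proof -
  have eq: "G' *v (Q2 *v (B *v x - f t x)) = P2 *v x - \<phi> t x"
    by (simp add: \<phi>_def matrix_vector_mult_diff_distrib matrix_vector_mul_assoc matrix_facts)
  have "y = 0 \<longleftrightarrow> G' *v y = 0" for y
    by (metis matrix_facts(2) matrix_vector_mul_assoc matrix_vector_mul_lid matrix_vector_mult_0_right)
  from this[of "Q2 *v (B *v x - f t x)"]
  have "Q2 *v (B *v x - f t x) = 0 \<longleftrightarrow> P2 *v x - \<phi> t x = 0" unfolding eq .
  also have "\<dots> \<longleftrightarrow> x - \<phi> t x = P1 *v x"
  proof -
    have 1: "x - \<phi> t x = P1 *v x + (P2 *v x - \<phi> t x)" by (simp add: add_diff_eq P_sum)
    show ?thesis unfolding 1 by simp
  qed
  finally show ?thesis .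
qed

definition "L0 = {(t, x). t \<ge> 0 \<and> Q2 *v (B *v x - f t x) = 0}"

lemma L0_iff: "(t, x) \<in> L0 \<longleftrightarrow> t \<ge> 0 \<and> x - \<phi> t x = P1 *v x"
  by (simp add: L0_def constraint_iff)

lemma constraint_iff_X1: "Q2 *v (B *v x - f t x) = 0 \<longleftrightarrow> x - \<phi> t x \<in> X1"
  unfolding constraint_iff X1_iff by (auto simp: matrix_vector_mult_diff_distrib)

lemma d_dx_Q2: "t \<ge> 0 \<Longrightarrow> d_dx (\<lambda>\<tau> y. Q2 *v f \<tau> y) t x = Q2 ** d_dx f t x"
  unfolding d_dx_def by (rule jacobian_unique[OF has_derivative_jacobian_mult[OF f_facts(2)]])

text \<open>
  This links the matrix \<open>I - G\<^sup>-\<^sup>1 Q\<^sub>2 f\<^sub>x\<close> of the Newton step, which acts on the whole space, to the operator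
  from \<open>X2\<close> to \<open>Y2\<close> of the hypotheses: a vector in the kernel of the former lies in \<open>X2\<close> and in the kernel
  of the latter.
\<close>

lemma D\<phi>_fixed_vector:
  assumes "D\<phi> t x *v v = v"
  shows "v \<in> X2" "((Q2 ** d_dx f t x - B) ** P2) *v v = 0"
proof -
  show v: "v \<in> X2" unfolding X2_iff by (metis P1_D\<phi> assms)
  then have P2v: "P2 *v v = v" using P_sum[of v] by (simp add: X2_iff)
  have "(Q2 ** d_dx f t x) *v v = G *v (D\<phi> t x *v v)"
    by (simp add: D\<phi>_def matrix_vector_mul_assoc matrix_mul_assoc matrix_facts)
  also have "\<dots> = (G ** P2) *v v" by (simp add: assms matrix_vector_mul_assoc[symmetric] P2v)
  finally show "((Q2 ** d_dx f t x - B) ** P2) *v v = 0"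
    by (simp add: matrix_vector_mul_assoc[symmetric] P2v matrix_vector_mult_diff_rdistrib matrix_facts)
qed

text \<open>
  Differentiability of \<open>A x\<close> is that of \<open>P\<^sub>1 x\<close>, since \<open>A = G P\<^sub>1\<close>.  Applying \<open>Q\<^sub>2\<close> to the equation kills the
  derivative and leaves the constraint; applying \<open>G\<^sup>-\<^sup>1 Q\<^sub>1\<close> leaves the differential equation for \<open>P\<^sub>1 x\<close>.
\<close>

lemma dae_solution_iff:
  assumes t0: "t0 \<ge> 0"
  shows "dae_solution_on A B f t0 x0 {t0..} y \<longleftrightarrow>
    continuous_on {t0..} y \<and> y t0 = x0 \<and> (\<forall>t\<ge>t0. y t - \<phi> t (y t) = P1 *v y t) \<and>
    (\<forall>t\<ge>t0. ((\<lambda>t. P1 *v y t) has_vector_derivative \<gamma> t (y t)) (at t within {t0..}))"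
  (is "?L \<longleftrightarrow> ?R")
proof
  assume ?L
  then obtain w where c: "continuous_on {t0..} y" "y t0 = x0"
    and w: "\<And>t. t \<ge> t0 \<Longrightarrow> ((\<lambda>\<tau>. A *v y \<tau>) has_vector_derivative w t) (at t within {t0..})"
      "\<And>t. t \<ge> t0 \<Longrightarrow> w t + B *v y t = f t (y t)"
    unfolding dae_solution_on_def by auto
  have nontriv: "at t within {t0..} \<noteq> bot" if "t \<ge> t0" for t
  proof -
    have "t islimpt {t<..<t + 1}" by (rule islimpt_greaterThanLessThan1) simp
    then have "t islimpt {t0..}" by (rule islimpt_subset) (use that in auto)
    then show ?thesis by (simp add: trivial_limit_within)
  qed
  have Q2w: "Q2 *v w t = 0" if t: "t \<ge> t0" for t
  proof -
    have "((\<lambda>\<tau>. Q2 *v (A *v y \<tau>)) has_vector_derivative Q2 *v w t) (at t within {t0..})"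
      by (rule mult_has_vector_derivative[OF w(1)[OF t]])
    moreover have "((\<lambda>\<tau>. Q2 *v (A *v y \<tau>)) has_vector_derivative 0) (at t within {t0..})"
      by (simp add: matrix_vector_mul_assoc matrix_facts)
    ultimately show ?thesis using vector_derivative_unique_within[OF nontriv[OF t]] by metis
  qed
  have con: "Q2 *v (B *v y t - f t (y t)) = 0" if t: "t \<ge> t0" for t
  proof -
    have "B *v y t - f t (y t) = 0 - w t" using w(2)[OF t, symmetric] by simp
    then show ?thesis by (simp only: matrix_vector_mult_diff_distrib Q2w[OF t]) simp
  qed
  have "((\<lambda>t. P1 *v y t) has_vector_derivative \<gamma> t (y t)) (at t within {t0..})" if t: "t \<ge> t0" for t
  proof -
    have "((\<lambda>\<tau>. G' *v (A *v y \<tau>)) has_vector_derivative G' *v w t) (at t within {t0..})"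
      by (rule mult_has_vector_derivative[OF w(1)[OF t]])
    then have "((\<lambda>\<tau>. P1 *v y \<tau>) has_vector_derivative G' *v w t) (at t within {t0..})"
      by (simp add: matrix_vector_mul_assoc matrix_facts)
    moreover have "w t = Q1 *v w t" using Q2w[OF t] by (simp add: Q2 matrix_vector_mult_diff_rdistrib)
    then have "w t = Q1 *v (f t (y t) - B *v y t)" using w(2)[OF t] by (metis add_diff_cancel_right')
    then have "w t = Q1 *v f t (y t) - B *v (P1 *v y t)"
      by (simp add: matrix_vector_mult_diff_distrib matrix_vector_mul_assoc QB)
    then have "G' *v w t = \<gamma> t (y t)" by (simp add: \<gamma>_def)
    ultimately show ?thesis by simp
  qed
  then show ?R using c con constraint_iff by auto
next
  assume R: ?R
  define w where "w = (\<lambda>t. f t (y t) - B *v y t)"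
  have w: "w t = G *v \<gamma> t (y t)" if "t \<ge> t0" for t
  proof -
    have "Q2 *v (B *v y t - f t (y t)) = 0" using R that constraint_iff by auto
    then have "w t = Q1 *v w t"
      by (simp add: w_def Q2 matrix_vector_mult_diff_rdistrib matrix_vector_mult_diff_distrib algebra_simps)
    also have "\<dots> = Q1 *v f t (y t) - B *v (P1 *v y t)"
      by (simp add: w_def matrix_vector_mult_diff_distrib matrix_vector_mul_assoc QB)
    also have "\<dots> = G *v \<gamma> t (y t)" by (simp add: \<gamma>_def matrix_vector_mul_assoc matrix_facts)
    finally show ?thesis .
  qed
  have "continuous_on {t0..} (\<lambda>t. f t (y t))"
    by (rule continuous_on_case_prod[OF f_facts(1)]) (use R t0 in \<open>auto intro: continuous_intros\<close>)
  then have "continuous_on {t0..} w" unfolding w_def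
    using R by (intro continuous_intros mult_continuous_on) auto
  moreover have "((\<lambda>\<tau>. A *v y \<tau>) has_vector_derivative w t) (at t within {t0..})" if t: "t \<ge> t0" for t
  proof -
    have "((\<lambda>\<tau>. G *v (P1 *v y \<tau>)) has_vector_derivative G *v \<gamma> t (y t)) (at t within {t0..})"
      using R t by (intro mult_has_vector_derivative) auto
    then show ?thesis by (simp add: matrix_vector_mul_assoc matrix_facts w[OF t])
  qed
  ultimately show ?L unfolding dae_solution_on_def
    using R by (auto intro!: exI[of _ w] simp: w_def)
qed

lemma \<Phi>_in_Y2: "((Q2 ** M - B) ** P2) *v v \<in> Y2"
proof -
  have "((Q2 ** M - B) ** P2) *v v = Q2 *v ((M ** P2 - B) *v v)"
    by (simp add: matrix_vector_mul_assoc matrix_diff_ldistrib matrix_diff_rdistrib matrix_mul_assoc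
        matrix_facts)
  then show ?thesis by blast
qed

lemma constraint_unique:
  assumes t: "t \<ge> 0" and x: "x - \<phi> t x = P1 *v x" and y: "y - \<phi> t y = P1 *v y" and xy: "P1 *v x = P1 *v y"
    and bi: "basis_invertible X2 Y2
      (\<lambda>u v. ((d_dx (\<lambda>\<tau> x. Q2 *v f \<tau> x) t (P1 *v x + u) - B) ** P2) *v v) (P2 *v x) (P2 *v y)"
  shows "x = y"
proof -
  define q where "q = (\<lambda>u. Q2 *v f t (P1 *v x + u) - (B ** P2) *v u)"
  have q0: "q (P2 *v w) = 0" if "w - \<phi> t w = P1 *v w" "P1 *v w = P1 *v x" for w
  proof -
    have "Q2 *v (B *v w - f t w) = 0" using that(1) constraint_iff by simp
    then have "(B ** P2) *v w = Q2 *v f t w"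
      by (simp add: matrix_vector_mult_diff_distrib matrix_vector_mul_assoc matrix_facts)
    moreover have "(B ** P2) *v (P2 *v w) = (B ** P2) *v w"
      by (simp add: matrix_vector_mul_assoc matrix_mul_assoc[symmetric] matrix_facts)
    ultimately show ?thesis using P_sum[of w] by (simp add: q_def that(2)[symmetric])
  qed
  have "P2 *v x = P2 *v y"
  proof (rule basis_invertible_imp_injective[OF subspaces(2) bi, where q = q and R = "(*v) Q2"
        and q' = "\<lambda>u v. (Q2 ** d_dx f t (P1 *v x + u)) *v v - (B ** P2) *v v"])
    show "linear ((*v) Q2)" by simp
    show "Q2 *v v \<in> Y2" for v by blast
    show "Q2 *v v = v" if "v \<in> Y2" for v using that by (auto simp: matrix_vector_mul_assoc matrix_facts)
    show "q (P2 *v x) = q (P2 *v y)" using q0[OF x refl] q0[OF y xy[symmetric]] by simp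
    fix u
    have shift: "((\<lambda>u. P1 *v x + u) has_derivative (\<lambda>h. h)) (at u)"
      by (auto intro!: derivative_eq_intros)
    have "((\<lambda>w. Q2 *v f t w) has_derivative (*v) (Q2 ** d_dx f t (P1 *v x + u))) (at (P1 *v x + u))"
      unfolding d_dx_def by (intro has_derivative_jacobian_mult f_facts t)
    from has_derivative_compose[OF shift this]
    show "(q has_derivative (\<lambda>v. (Q2 ** d_dx f t (P1 *v x + u)) *v v - (B ** P2) *v v)) (at u)"
      unfolding q_def
      by (intro has_derivative_diff bounded_linear_imp_has_derivative matrix_vector_mul_bounded_linear)
    fix v
    show "((d_dx (\<lambda>\<tau> x. Q2 *v f \<tau> x) t (P1 *v x + u) - B) ** P2) *v v \<in> Y2"
      unfolding d_dx_Q2[OF t] by (rule \<Phi>_in_Y2)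
    assume "v \<in> X2"
    then have "P2 *v v = v" using P_sum[of v] by (simp add: X2_iff)
    then show "(Q2 ** d_dx f t (P1 *v x + u)) *v v - (B ** P2) *v v
       = ((d_dx (\<lambda>\<tau> x. Q2 *v f \<tau> x) t (P1 *v x + u) - B) ** P2) *v v"
      unfolding d_dx_Q2[OF t] by (simp add: matrix_vector_mul_assoc[symmetric] matrix_vector_mult_diff_rdistrib)
  qed (use subspaces in auto)
  then show ?thesis using P_sum[of x] P_sum[of y] xy by metis
qed

lemma D\<phi>_injective_on_constraint:
  assumes t: "t \<ge> 0"
    and bi: "basis_invertible X2 Y2
      (\<lambda>u v. ((d_dx (\<lambda>\<tau> x. Q2 *v f \<tau> x) t (P1 *v x + u) - B) ** P2) *v v) (P2 *v x) (P2 *v x)"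
    and v: "D\<phi> t x *v v = v"
  shows "v = 0"
proof (rule basis_invertible_diagonal[OF bi])
  show "v \<in> X2" by (rule D\<phi>_fixed_vector(1)[OF v])
  show "((d_dx (\<lambda>\<tau> x. Q2 *v f \<tau> x) t (P1 *v x + P2 *v x) - B) ** P2) *v v = 0"
    using D\<phi>_fixed_vector(2)[OF v] by (simp add: d_dx_Q2[OF t] P_sum)
  show "((d_dx (\<lambda>\<tau> x. Q2 *v f \<tau> x) t (P1 *v x + P2 *v x) - B) ** P2) *v w \<in> Y2" for w
    unfolding d_dx_Q2[OF t] by (rule \<Phi>_in_Y2)
qed (use subspaces subspace_0 in blast)+

lemma D\<phi>_injective:
  assumes t: "t \<ge> 0"
    and inv: "invertible_op X2 Y2 (\<lambda>v. ((d_dx (\<lambda>\<tau> x. Q2 *v f \<tau> x) t x - B) ** P2) *v v)"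
    and v: "D\<phi> t x *v v = v"
  shows "v = 0"
  by (rule invertible_op_kernel[OF inv D\<phi>_fixed_vector(1)[OF v]])
    (use D\<phi>_fixed_vector(2)[OF v] subspaces subspace_0 in \<open>auto simp: d_dx_Q2[OF t]\<close>)

text \<open>
  The common consequence of the three growth conditions that the Lyapunov argument needs.  It refers to a
  bounded time interval, which allows \<open>K\<close> and \<open>R\<close> to depend on \<open>b\<close>.
\<close>

definition dissipative_on :: "real \<Rightarrow> real \<Rightarrow> (real^'n \<Rightarrow> real^'n) \<Rightarrow> bool" where
  "dissipative_on a b H \<longleftrightarrow> (\<exists>K\<ge>0. \<exists>R (U :: real \<Rightarrow> real).
     continuous_on {0<..} U \<and> (\<forall>v>0. U v > 0) \<and>
     (\<forall>c>0. filterlim (\<lambda>b. integral {c..b} (\<lambda>v. 1 / U v)) at_top at_top) \<and>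
     (\<forall>t x. a \<le> t \<longrightarrow> t \<le> b \<longrightarrow> x - \<phi> t x = P1 *v x \<longrightarrow> norm (P1 *v x) \<ge> R \<longrightarrow>
        H (P1 *v x) \<bullet> \<gamma> t x \<le> K * U (1 / 2 * (H (P1 *v x) \<bullet> (P1 *v x)))))"

lemma positive_selfadjoint_extend:
  assumes H: "positive_selfadjoint_on X1 H"
  shows "linear (\<lambda>v. H (P1 *v v))" "x \<in> X1 \<Longrightarrow> H (P1 *v x) = H x"
proof -
  have lin: "linop_on X1 X1 H" using H unfolding positive_selfadjoint_on_def by blast
  show "linear (\<lambda>v. H (P1 *v v))"
  proof (rule linearI)
    show "H (P1 *v (x + y)) = H (P1 *v x) + H (P1 *v y)" for x y
      using lin unfolding linop_on_def by (simp add: matrix_vector_right_distrib)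
    show "H (P1 *v (c *\<^sub>R x)) = c *\<^sub>R H (P1 *v x)" for c x
      using lin unfolding linop_on_def by (simp add: matrix_vector_mult_scaleR)
  qed
  show "x \<in> X1 \<Longrightarrow> H (P1 *v x) = H x" using X1_iff by simp
qed

text \<open>
  A remainder of at most linear growth contributes a multiple of \<open>\<bar>z\<bar>\<^sup>2\<close>, hence of \<open>(H z, z)\<close>, to the
  derivative of \<open>V\<close>, so that \<open>U v = v\<close> serves as comparison function.
\<close>

lemma linear_growth_dissipative:
  assumes H: "positive_selfadjoint_on X1 H"
    and split: "\<And>t x. a \<le> t \<Longrightarrow> t \<le> b \<Longrightarrow> x - \<phi> t x = P1 *v x \<Longrightarrow> norm (P1 *v x) \<ge> R \<Longrightarrow>
      \<exists>p r. \<gamma> t x = p + r \<and> H (P1 *v x) \<bullet> p \<le> 0 \<and> norm r \<le> k * norm (P1 *v x)"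
  shows "dissipative_on a b H"
proof -
  define h where "h = (\<lambda>v. H (P1 *v v))"
  have h: "linear h" unfolding h_def by (rule positive_selfadjoint_extend(1)[OF H])
  have hH: "h (P1 *v x) = H (P1 *v x)" for x
    unfolding h_def by (rule positive_selfadjoint_extend(2)[OF H]) blast
  have pos: "h x \<bullet> x > 0" if "x \<in> X1" "x \<noteq> 0" for x
    using H that unfolding positive_selfadjoint_on_def h_def by (metis X1_iff)
  obtain c C where c: "c > 0" "C > 0" and low: "\<And>x. x \<in> X1 \<Longrightarrow> c * (norm x)\<^sup>2 \<le> h x \<bullet> x"
    and up: "\<And>x. norm (h x) \<le> C * norm x"
    using positive_form_bounds[OF subspaces(1) h pos] by metis
  define K where "K = 2 * (C * \<bar>k\<bar>) / c"
  have K: "K \<ge> 0" using c by (simp add: K_def)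
  have main: "H (P1 *v x) \<bullet> \<gamma> t x \<le> K * (1 / 2 * (H (P1 *v x) \<bullet> (P1 *v x)))"
    if tx: "a \<le> t" "t \<le> b" "x - \<phi> t x = P1 *v x" "norm (P1 *v x) \<ge> R" for t x
  proof -
    define z where "z = P1 *v x"
    obtain p r where pr: "\<gamma> t x = p + r" "h z \<bullet> p \<le> 0" "norm r \<le> k * norm z"
      using split[OF tx] by (auto simp: hH z_def)
    have "h z \<bullet> \<gamma> t x \<le> h z \<bullet> r" using pr by (simp add: inner_add_right)
    also have "\<dots> \<le> norm (h z) * norm r" by (rule norm_cauchy_schwarz)
    also have "\<dots> \<le> (C * norm z) * (\<bar>k\<bar> * norm z)"
    proof (rule mult_mono)
      show "norm r \<le> \<bar>k\<bar> * norm z"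
        using pr(3) mult_right_mono[OF abs_ge_self[of k], of "norm z"] by simp
    qed (use up c in auto)
    also have "\<dots> = C * \<bar>k\<bar> / c * (c * (norm z)\<^sup>2)" using c by (simp add: power2_eq_square)
    also have "\<dots> \<le> C * \<bar>k\<bar> / c * (h z \<bullet> z)"
      using c by (intro mult_left_mono low) (auto simp: z_def)
    finally show ?thesis by (simp add: K_def z_def hH)
  qed
  show ?thesis unfolding dissipative_on_def
  proof (intro exI conjI allI impI)
    show "K \<ge> 0" by (rule K)
    show "filterlim (\<lambda>b. integral {c..b} (\<lambda>v. 1 / (v :: real))) at_top at_top" if "c > 0" for c
      using that by (rule identity_divergent)
    show "H (P1 *v x) \<bullet> \<gamma> t x \<le> K * (1 / 2 * (H (P1 *v x) \<bullet> (P1 *v x)))"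
      if "a \<le> t" "t \<le> b" "x - \<phi> t x = P1 *v x" "R \<le> norm (P1 *v x)" for t x
      using that by (rule main)
  qed (auto intro: continuous_intros)
qed

lemma dissipative_of_sign:
  assumes H: "positive_selfadjoint_on X1 H" and a: "a \<ge> 0"
    and sign: "\<forall>T>0. \<exists>R>0. \<forall>(t, x)\<in>L0. 0 \<le> t \<and> t \<le> T \<and> norm (P1 *v x) \<ge> R \<longrightarrow>
      H (P1 *v x) \<bullet> (G' *v (Q1 *v f t x)) \<le> 0"
  shows "dissipative_on a b H"
proof -
  have "max b 1 > 0" by simp
  then obtain R where R: "\<forall>(t, x)\<in>L0. 0 \<le> t \<and> t \<le> max b 1 \<and> norm (P1 *v x) \<ge> R \<longrightarrow>
      H (P1 *v x) \<bullet> (G' *v (Q1 *v f t x)) \<le> 0"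
    using sign by blast
  show ?thesis
  proof (rule linear_growth_dissipative[OF H, where R = R and k = "onorm ((*v) (G' ** B))"], intro exI conjI)
    fix t x assume *: "a \<le> t" "t \<le> b" "x - \<phi> t x = P1 *v x" "R \<le> norm (P1 *v x)"
    then have "(t, x) \<in> L0" using a by (simp add: L0_iff)
    from bspec[OF R this] show "H (P1 *v x) \<bullet> (G' *v (Q1 *v f t x)) \<le> 0" using * a by simp
    show "\<gamma> t x = G' *v (Q1 *v f t x) + (G' ** B) *v (- (P1 *v x))"
      by (simp add: \<gamma>_def matrix_vector_mult_diff_distrib matrix_vector_mul_assoc[symmetric] vec.neg)
    show "norm ((G' ** B) *v (- (P1 *v x))) \<le> onorm ((*v) (G' ** B)) * norm (P1 *v x)"
      using onorm[OF matrix_vector_mul_bounded_linear, of "G' ** B" "- (P1 *v x)"] by simp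
  qed
qed

lemma dissipative_of_split:
  fixes S1 Pif \<psi> e
  assumes H: "positive_selfadjoint_on X1 H" and a: "a \<ge> 0"
    and split: "\<forall>t\<ge>0. \<forall>x. Q1 *v f t x = S1 t *v (P1 *v x) + \<psi> t x + Pif x *v e t"
    and S: "continuous_on {0..} S1" and e: "continuous_on {0..} e"
    and Pi: "r > 0" "\<forall>x. norm (P1 *v x) \<ge> r \<longrightarrow> onorm (\<lambda>v. Pif x *v v) \<le> C"
    and sign: "\<forall>T>0. \<exists>R>0. \<forall>(t, x)\<in>L0. 0 \<le> t \<and> t \<le> T \<and> norm (P1 *v x) \<ge> R \<longrightarrow>
      H (P1 *v x) \<bullet> (G' *v \<psi> t x) \<le> 0"
  shows "dissipative_on a b H"
proof -
  have "max b 1 > 0" by simp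
  then obtain R where R: "\<forall>(t, x)\<in>L0. 0 \<le> t \<and> t \<le> max b 1 \<and> norm (P1 *v x) \<ge> R \<longrightarrow>
      H (P1 *v x) \<bullet> (G' *v \<psi> t x) \<le> 0"
    using sign by blast
  have restrict: "continuous_on {a..b} F" if "continuous_on {0..} F" for F :: "real \<Rightarrow> 'z::real_normed_vector"
    by (rule continuous_on_subset[OF that]) (use a in auto)
  obtain s where s: "s \<ge> 0" "\<And>t. t \<in> {a..b} \<Longrightarrow> norm (mat_blinfun (S1 t)) \<le> s"
    using compact_image_norm_bound[OF compact_Icc
        restrict[OF bounded_linear.continuous_on[OF bounded_linear_mat_blinfun S]]] by blast
  obtain m where m: "m \<ge> 0" "\<And>t. t \<in> {a..b} \<Longrightarrow> norm (e t) \<le> m"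
    using compact_image_norm_bound[OF compact_Icc restrict[OF e]] by blast
  define g where "g = onorm ((*v) (G'))"
  have g: "norm (G' *v v) \<le> g * norm v" for v
    unfolding g_def by (rule onorm[OF matrix_vector_mul_bounded_linear])
  have g0: "g \<ge> 0" unfolding g_def by (rule onorm_pos_le[OF matrix_vector_mul_bounded_linear])
  define \<beta> where "\<beta> = onorm ((*v) B)"
  have \<beta>: "norm (B *v v) \<le> \<beta> * norm v" for v
    unfolding \<beta>_def by (rule onorm[OF matrix_vector_mul_bounded_linear])
  show ?thesis
  \<comment> \<open>for \<open>\<bar>P\<^sub>1 x\<bar> \<ge> 1\<close> the bounded forcing term is dominated by a multiple of \<open>\<bar>P\<^sub>1 x\<bar>\<close>\<close>
  proof (rule linear_growth_dissipative[OF H, where R = "max R (max r 1)" and k = "g * (s + \<bar>C\<bar> * m + \<beta>)"], intro exI conjI)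
    fix t x assume t: "a \<le> t" "t \<le> b" and x: "x - \<phi> t x = P1 *v x" and z: "max R (max r 1) \<le> norm (P1 *v x)"
    let ?z = "P1 *v x"
    define rest where "rest = S1 t *v ?z + Pif x *v e t - B *v ?z"
    have "(t, x) \<in> L0" using a t x by (simp add: L0_iff)
    from bspec[OF R this] show "H ?z \<bullet> (G' *v \<psi> t x) \<le> 0" using a t z by simp
    have "Q1 *v f t x - B *v ?z = \<psi> t x + rest" using split a t by (simp add: rest_def)
    then show "\<gamma> t x = G' *v \<psi> t x + G' *v rest"
      by (simp add: \<gamma>_def matrix_vector_right_distrib)
    have "norm rest \<le> norm (S1 t *v ?z) + norm (Pif x *v e t) + norm (B *v ?z)"
      unfolding rest_def by (rule order_trans[OF norm_triangle_ineq4 add_mono[OF norm_triangle_ineq order_refl]])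
    also have "norm (S1 t *v ?z) \<le> s * norm ?z"
    proof -
      have "norm (S1 t *v ?z) \<le> norm (mat_blinfun (S1 t)) * norm ?z"
        using norm_blinfun[of "mat_blinfun (S1 t)" ?z] by simp
      also have "\<dots> \<le> s * norm ?z" using s(2)[of t] t by (intro mult_right_mono) auto
      finally show ?thesis .
    qed
    also have "norm (Pif x *v e t) \<le> \<bar>C\<bar> * m * norm ?z"
    proof -
      have "norm (Pif x *v e t) \<le> onorm (\<lambda>v. Pif x *v v) * norm (e t)"
        by (rule onorm[OF matrix_vector_mul_bounded_linear])
      also have "\<dots> \<le> \<bar>C\<bar> * m"
        using Pi(2)[rule_format, of x] z m(2)[of t] t by (intro mult_mono) auto
      also have "\<dots> \<le> \<bar>C\<bar> * m * norm ?z"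
        using z m(1) mult_left_mono[of 1 "norm ?z" "\<bar>C\<bar> * m"] by simp
      finally show ?thesis .
    qed
    also have "norm (B *v ?z) \<le> \<beta> * norm ?z" by (rule \<beta>)
    finally have "norm rest \<le> (s + \<bar>C\<bar> * m + \<beta>) * norm ?z" by (simp add: algebra_simps)
    then have "g * norm rest \<le> g * ((s + \<bar>C\<bar> * m + \<beta>) * norm ?z)" using g0 by (rule mult_left_mono)
    then show "norm (G' *v rest) \<le> g * (s + \<bar>C\<bar> * m + \<beta>) * norm ?z"
      using g[of rest] by (simp add: mult.assoc)
  qed
qed

lemma dissipative_of_comparison:
  assumes H: "positive_selfadjoint_on X1 H" and a: "a \<ge> 0" and R: "R > 0"
    and k: "continuous_on {0..} k"
    and U: "continuous_on {0<..} U" "\<forall>v>0. U v > (0 :: real)"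
      "\<forall>c>0. filterlim (\<lambda>b. integral {c..b} (\<lambda>v. 1 / U v)) at_top at_top"
    and cmp: "\<forall>(t, x)\<in>L0. norm (P1 *v x) \<ge> R \<longrightarrow>
      H (P1 *v x) \<bullet> (G' *v (- (B *v (P1 *v x)) + Q1 *v f t x))
      \<le> k t * U (1 / 2 * (H (P1 *v x) \<bullet> (P1 *v x)))"
  shows "dissipative_on a b H"
proof -
  have "continuous_on {a..b} k" by (rule continuous_on_subset[OF k]) (use a in auto)
  then obtain m where m: "m \<ge> 0" "\<And>t. t \<in> {a..b} \<Longrightarrow> norm (k t) \<le> m"
    using compact_image_norm_bound[OF compact_Icc] by blast
  have main: "H (P1 *v x) \<bullet> \<gamma> t x \<le> m * U (1 / 2 * (H (P1 *v x) \<bullet> (P1 *v x)))"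
    if "a \<le> t" "t \<le> b" "x - \<phi> t x = P1 *v x" "norm (P1 *v x) \<ge> R" for t x
  proof -
    have "P1 *v x \<noteq> 0" using R that by auto
    then have "H (P1 *v x) \<bullet> (P1 *v x) > 0"
      using H unfolding positive_selfadjoint_on_def by blast
    then have U0: "U (1 / 2 * (H (P1 *v x) \<bullet> (P1 *v x))) > 0" using U(2) by simp
    have "k t \<le> m" using m(2)[of t] that by auto
    then have "k t * U (1 / 2 * (H (P1 *v x) \<bullet> (P1 *v x))) \<le> m * U (1 / 2 * (H (P1 *v x) \<bullet> (P1 *v x)))"
      using U0 by (intro mult_right_mono) auto
    moreover have "(t, x) \<in> L0" using that a by (simp add: L0_iff)
    from bspec[OF cmp this] have "H (P1 *v x) \<bullet> \<gamma> t x \<le> k t * U (1 / 2 * (H (P1 *v x) \<bullet> (P1 *v x)))"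
      using that by (simp add: \<gamma>_def)
    ultimately show ?thesis by simp
  qed
  show ?thesis unfolding dissipative_on_def
    by (rule exI[of _ m], rule conjI, rule m(1), rule exI[of _ R], rule exI[of _ U]) (use U main in blast)
qed

end

text \<open>
  Solvability and basis invertibility in the form in which they enter: the equation \<open>x - \<phi>(t, x) = z\<close> with \<open>z\<close> in
  \<open>X1\<close> has exactly one solution, and it is nondegenerate there.
\<close>

locale solvable_index_one_dae = index_one_dae +
  assumes solvable: "\<And>t z. t \<ge> 0 \<Longrightarrow> z \<in> X1 \<Longrightarrow> \<exists>x. x - \<phi> t x = z"
    and unique: "\<And>t x y. t \<ge> 0 \<Longrightarrow> x - \<phi> t x \<in> X1 \<Longrightarrow> x - \<phi> t x = y - \<phi> t y \<Longrightarrow> x = y"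
    and regular: "\<And>t x v. t \<ge> 0 \<Longrightarrow> x - \<phi> t x \<in> X1 \<Longrightarrow> D\<phi> t x *v v = v \<Longrightarrow> v = 0"
begin

text \<open>
  \<open>g\<close> is the right-hand side of the differential equation on \<open>X1\<close>, extended to the whole space along
  \<open>P1\<close>, so that the results on equations in Euclidean space apply.
\<close>

definition "X t z = (SOME x. x - \<phi> t x = z)"
definition "g t z = \<gamma> t (X t (P1 *v z))"

lemma X_sol: "t \<ge> 0 \<Longrightarrow> z \<in> X1 \<Longrightarrow> X t z - \<phi> t (X t z) = z"
  unfolding X_def using someI_ex[OF solvable] by blast

lemma P1_X: "t \<ge> 0 \<Longrightarrow> z \<in> X1 \<Longrightarrow> P1 *v X t z = z"
  using X_sol[of t z] constraint_iff_X1 constraint_iff by metis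

lemma X_P1: "t \<ge> 0 \<Longrightarrow> x - \<phi> t x = P1 *v x \<Longrightarrow> X t (P1 *v x) = x"
  by (rule unique[of t]) (simp_all add: X_sol)

lemma X_regular:
  "continuous_on ({0..} \<times> X1) (\<lambda>(t, z). X t z)" "local_lipschitz {0..} X1 X"
proof -
  have *: "t \<in> {0..} \<Longrightarrow> z \<in> X1 \<Longrightarrow> X t z - \<phi> t (X t z) = z" for t z by (simp add: X_sol)
  have **: "t \<in> {0..} \<Longrightarrow> x - \<phi> t x \<in> X1 \<Longrightarrow> x - \<phi> t x = y - \<phi> t y \<Longrightarrow> x = y" for t x y
    by (rule unique) auto
  have ***: "t \<in> {0..} \<Longrightarrow> x - \<phi> t x \<in> X1 \<Longrightarrow> blinfun_apply (mat_blinfun (D\<phi> t x)) v = v \<Longrightarrow> v = 0" for t x v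
    using regular[of t x v] by simp
  show "continuous_on ({0..} \<times> X1) (\<lambda>(t, z). X t z)"
    by (rule implicit_function_global(1)[OF \<phi>_deriv continuity(3,1) * ** ***])
  show "local_lipschitz {0..} X1 X"
    by (rule implicit_function_global(2)[OF \<phi>_deriv continuity(3,1) * ** ***])
qed

lemma g_regular:
  "continuous_on ({0..} \<times> UNIV) (\<lambda>(t, z). g t z)" "local_lipschitz {0..} UNIV g"
proof -
  have "continuous_on ({0..} \<times> UNIV) (\<lambda>p. X (fst p) (P1 *v snd p))"
    by (rule continuous_on_case_prod[OF X_regular(1)])
      (auto intro!: continuous_intros mult_continuous_on)
  then show "continuous_on ({0..} \<times> UNIV) (\<lambda>(t, z). g t z)"
    unfolding g_def case_prod_unfold
    by (intro continuous_on_case_prod[OF continuity(2)]) (auto intro!: continuous_intros)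
  show "local_lipschitz {0..} UNIV g"
    unfolding g_def[abs_def]
    by (rule local_lipschitz_compose_implicit[OF C1_local_lipschitz[OF \<gamma>_deriv continuity(4)] X_regular]) auto
qed

lemma g_X1: "P1 *v g t z = g t z"
  by (simp add: g_def)

text \<open>
  A solution of the extended equation that starts in \<open>X1\<close> stays there, because \<open>g\<close> has values in \<open>X1\<close>; so
  the bound for \<open>(H z, z)\<close>, which is positive on \<open>X1\<close> only, applies to it.
\<close>

lemma global_solution:
  assumes t0: "t0 \<ge> 0" and x0: "x0 - \<phi> t0 x0 = P1 *v x0"
    and H: "positive_selfadjoint_on X1 H" and diss: "\<And>b. dissipative_on t0 b H"
  obtains x where "dae_solution_on A B f t0 x0 {t0..} x"
    "\<And>y t. dae_solution_on A B f t0 x0 {t0..} y \<Longrightarrow> t \<ge> t0 \<Longrightarrow> y t = x t"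
proof -
  have cont: "continuous_on ({t0..} \<times> UNIV) (\<lambda>(t, z). g t z)"
    by (rule continuous_on_subset[OF g_regular(1)]) (use t0 in auto)
  have lip: "local_lipschitz {t0..} UNIV g"
    by (rule local_lipschitz_subset[OF g_regular(2)]) (use t0 in auto)
  define z0 where "z0 = P1 *v x0"
  have P1z0: "P1 *v z0 = z0" by (simp add: z0_def matrix_vector_mul_assoc P1)
  have invariant: "z t \<in> X1"
    if z: "z t0 = z0" "\<And>t. t \<in> {t0..s} \<Longrightarrow> (z has_vector_derivative g t (z t)) (at t within {t0..s})"
      and t: "t \<in> {t0..s}" for z s t
  proof -
    have "((\<lambda>t. P2 *v z t) has_vector_derivative 0) (at t within {t0..s})" if "t \<in> {t0..s}" for t
    proof -
      have "P2 *v g t (z t) = 0" using P_sum[of "g t (z t)"] by (simp add: g_X1)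
      then show ?thesis
        using mult_has_vector_derivative[OF z(2)[OF that], of P2]
        by simp
    qed
    then obtain c where c: "\<And>t. t \<in> {t0..s} \<Longrightarrow> P2 *v z t = c"
      using has_vector_derivative_zero_constant[of "{t0..s}"] by (metis convex_closed_interval)
    have "P2 *v z t = P2 *v z t0" using c t by simp
    also have "\<dots> = 0" using P_sum[of z0] by (simp add: z(1) P1z0)
    finally show ?thesis using P_sum[of "z t"] by (simp add: X1_iff)
  qed
  define h where "h = (\<lambda>v. H (P1 *v v))"
  have h: "linear h" unfolding h_def by (rule positive_selfadjoint_extend(1)[OF H])
  have hH: "h x = H x" if "x \<in> X1" for x
    unfolding h_def by (rule positive_selfadjoint_extend(2)[OF H that])
  have bound: "\<exists>M. \<forall>s z. t0 \<le> s \<longrightarrow> s \<le> b \<longrightarrow> z t0 = z0 \<longrightarrow>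
       (\<forall>t\<in>{t0..s}. (z has_vector_derivative g t (z t)) (at t within {t0..s})) \<longrightarrow> norm (z s) < M" for b
  proof -
    obtain K R U where K: "K \<ge> 0" and U: "continuous_on {0<..} U" "\<And>v. v > 0 \<Longrightarrow> U v > (0 :: real)"
      "\<And>c. c > 0 \<Longrightarrow> filterlim (\<lambda>b. integral {c..b} (\<lambda>v. 1 / U v)) at_top at_top"
      and est: "\<And>t x. t0 \<le> t \<Longrightarrow> t \<le> b \<Longrightarrow> x - \<phi> t x = P1 *v x \<Longrightarrow> norm (P1 *v x) \<ge> R \<Longrightarrow>
        H (P1 *v x) \<bullet> \<gamma> t x \<le> K * U (1 / 2 * (H (P1 *v x) \<bullet> (P1 *v x)))"
      using diss[of b] unfolding dissipative_on_def by blast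
    have pos: "h x \<bullet> x > 0" if "x \<in> X1" "x \<noteq> 0" for x
      unfolding hH[OF that(1)] using H that unfolding positive_selfadjoint_on_def by blast
    have sym: "h x \<bullet> y = x \<bullet> h y" if "x \<in> X1" "y \<in> X1" for x y
      unfolding hH[OF that(1)] hH[OF that(2)] using H that unfolding positive_selfadjoint_on_def by blast
    have est': "h z \<bullet> g t z \<le> K * U (1 / 2 * (h z \<bullet> z))"
      if "t0 \<le> t" "t \<le> b" and z: "z \<in> X1" and "norm z \<ge> R" for t z
      using est[of t "X t z"] that t0 z X_sol[of t z] P1_X[of t z] X1_iff[of z] hH[OF z] by (simp add: g_def)
    have gX: "g t z \<in> X1" for t z using g_X1 X1_iff by blast
    have "\<exists>M. \<forall>s z. t0 \<le> s \<longrightarrow> s \<le> b \<longrightarrow> z t0 = z0 \<longrightarrow> (\<forall>t\<in>{t0..s}. z t \<in> X1) \<longrightarrow>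
       (\<forall>t\<in>{t0..s}. (z has_vector_derivative g t (z t)) (at t within {t0..s})) \<longrightarrow> norm (z s) < M"
      by (rule lyapunov_a_priori_bound[where g = g, OF subspaces(1) h pos sym K U est' gX])
    then obtain M where M: "\<And>s z. t0 \<le> s \<Longrightarrow> s \<le> b \<Longrightarrow> z t0 = z0 \<Longrightarrow> \<forall>t\<in>{t0..s}. z t \<in> X1 \<Longrightarrow>
       \<forall>t\<in>{t0..s}. (z has_vector_derivative g t (z t)) (at t within {t0..s}) \<Longrightarrow> norm (z s) < M"
      by blast
    show ?thesis
    proof (intro exI[of _ M] allI impI)
      fix s z assume *: "t0 \<le> s" "s \<le> b" "z t0 = z0"
        "\<forall>t\<in>{t0..s}. (z has_vector_derivative g t (z t)) (at t within {t0..s})"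
      show "norm (z s) < M"
      proof (rule M[OF *(1,2,3) _ *(4)])
        show "\<forall>t\<in>{t0..s}. z t \<in> X1"
          by (intro ballI invariant[OF *(3) *(4)[rule_format]])
      qed
    qed
  qed
  obtain z where z: "z t0 = z0" "\<And>t. t \<ge> t0 \<Longrightarrow> (z has_vector_derivative g t (z t)) (at t within {t0..})"
    by (rule ode_global_solution[OF cont lip bound]) blast
  have z_int: "(z has_vector_derivative g t (z t)) (at t within {t0..s})" if "t \<in> {t0..s}" for s t
    by (rule has_vector_derivative_within_subset[OF z(2)]) (use that in auto)
  have zX: "z t \<in> X1" if "t \<ge> t0" for t
    using invariant[OF z(1) z_int, of t t] that by simp
  define x where "x = (\<lambda>t. X t (z t))"
  have Px: "P1 *v x t = z t" if "t \<ge> t0" for t using P1_X[of t "z t"] zX[OF that] that t0 by (simp add: x_def)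
  have z_cont: "continuous_on {t0..} z" by (rule continuous_on_vector_derivative) (use z(2) in auto)
  have x_sol: "dae_solution_on A B f t0 x0 {t0..} x"
    unfolding dae_solution_iff[OF t0]
  proof (intro conjI allI impI)
    show "continuous_on {t0..} x" unfolding x_def
      by (rule continuous_on_case_prod[OF X_regular(1)]) (use zX t0 z_cont in \<open>auto intro: continuous_intros\<close>)
    show "x t0 = x0" unfolding x_def z(1) z0_def by (rule X_P1[OF t0 x0])
    fix t assume t: "t0 \<le> t"
    show "x t - \<phi> t (x t) = P1 *v x t" unfolding Px[OF t] unfolding x_def by (rule X_sol) (use t t0 zX in auto)
    have "\<gamma> t (x t) = g t (z t)" using zX[OF t] by (simp add: g_def x_def X1_iff)
    moreover have "((\<lambda>t. P1 *v x t) has_vector_derivative g t (z t)) (at t within {t0..})"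
      by (rule has_vector_derivative_transform[OF _ _ z(2)[OF t]]) (use t Px in auto)
    ultimately show "((\<lambda>t. P1 *v x t) has_vector_derivative \<gamma> t (x t)) (at t within {t0..})" by simp
  qed
  have "y t = x t" if y: "dae_solution_on A B f t0 x0 {t0..} y" and t: "t \<ge> t0" for y t
  proof -
    have y0: "y t0 = x0" and yc: "\<And>t. t \<ge> t0 \<Longrightarrow> y t - \<phi> t (y t) = P1 *v y t"
      and yd: "\<And>t. t \<ge> t0 \<Longrightarrow> ((\<lambda>t. P1 *v y t) has_vector_derivative \<gamma> t (y t)) (at t within {t0..})"
      using y unfolding dae_solution_iff[OF t0] by auto
    have yX: "X s (P1 *v y s) = y s" if "s \<ge> t0" for s using X_P1[OF _ yc[OF that]] that t0 by simp
    have "P1 *v y t = z t"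
    proof (rule ode_unique[OF cont lip, of t "\<lambda>t. P1 *v y t" z])
      show "((\<lambda>t. P1 *v y t) has_vector_derivative g s (P1 *v y s)) (at s within {t0..t})"
        if "s \<in> {t0..t}" for s
      proof -
        have "g s (P1 *v y s) = \<gamma> s (y s)" using yX[of s] that
          by (simp add: g_def matrix_vector_mul_assoc P1)
        then show ?thesis
          by (simp only:) (rule has_vector_derivative_within_subset[OF yd], use that in auto)
      qed
      show "P1 *v y t0 = z t0" by (simp add: y0 z(1) z0_def)
    qed (use t z_int in auto)
    then show ?thesis using yX[OF t] by (simp add: x_def)
  qed
  then show thesis using that x_sol by blast
qed

end

context index_one_dae
begin

text \<open>
  The Newton correction solves \<open>(I - D\<phi>) w = - (u\<^sub>i - \<phi>)\<close> on the whole space; applying \<open>P1\<close> shows that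
  the iterates \<open>u\<^sub>i\<close> stay in \<open>X2\<close>, and likewise \<open>z\<^sub>i\<close> in \<open>X1\<close>.  Hence \<open>P1 (z\<^sub>i + u\<^sub>i) = z\<^sub>i\<close>, and the
  method becomes the scheme for the semi-explicit system.
\<close>

lemma method_converges:
  assumes t0: "t0 \<ge> 0" and T: "t0 < T" and x: "dae_solution_on A B f t0 x0 {t0..} x"
    and inj: "\<And>t y v. t \<in> {t0..T} \<Longrightarrow> D\<phi> t y *v v = v \<Longrightarrow> v = 0"
    and scheme: "\<And>N. N \<ge> 1 \<Longrightarrow> method_seqs B P1 P2 Q1 Q2 G f t0 T x0 N (zs N) (us N) (xs N)"
    and e: "e > 0"
  shows "\<forall>\<^sub>F N in sequentially. \<forall>i\<le>N. norm (P1 *v x (grid_point t0 T N i) - zs N i) < e \<and>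
     norm (P2 *v x (grid_point t0 T N i) - us N i) < e"
proof -
  let ?h = "step_size t0 T" and ?g = "grid_point t0 T"
  have c: "continuous_on {t0..} x" and xt0: "x t0 = x0"
    and con: "\<And>t. t \<ge> t0 \<Longrightarrow> x t - \<phi> t (x t) = P1 *v x t"
    and der: "\<And>t. t \<ge> t0 \<Longrightarrow> ((\<lambda>t. P1 *v x t) has_vector_derivative \<gamma> t (x t)) (at t within {t0..})"
    using x unfolding dae_solution_iff[OF t0] by auto
  have g0: "?g N i \<ge> 0" for N i
    using t0 T by (auto simp: grid_point_def step_size_def)
  have gT: "?g N i \<in> {t0..T}" if "i \<le> N" "N \<ge> 1" for N i
  proof -
    have "real i * ?h N \<le> real N * ?h N"
      using that T by (intro mult_right_mono) (auto simp: step_size_def)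
    also have "real N * ?h N = T - t0" using that by (simp add: step_size_def)
    finally show ?thesis using T by (auto simp: grid_point_def step_size_def)
  qed
  have m: "zs N 0 = P1 *v x0" "us N 0 = P2 *v x0"
    "zs N 1 = (mat 1 - ?h N *\<^sub>R (G' ** B)) *v zs N 0
       + ?h N *\<^sub>R (G' *v (Q1 *v f t0 (zs N 0 + us N 0)))"
    "\<And>i. i < N \<Longrightarrow> us N (i + 1) = us N i -
         matrix_inv (mat 1 - G' ** d_dx (\<lambda>\<tau> y. Q2 *v f \<tau> y) (?g N (i + 1)) (zs N (i + 1) + us N i)) *v
           (us N i - G' *v (Q2 *v f (?g N (i + 1)) (zs N (i + 1) + us N i)))"
    "\<And>i. 1 \<le> i \<Longrightarrow> i < N \<Longrightarrow> zs N (i + 1) = zs N (i - 1) + (2 * ?h N) *\<^sub>R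
       (G' *v (Q1 *v f (?g N i) (zs N i + us N i) - B *v zs N i))"
    if "N \<ge> 1" for N
    using scheme[OF that] unfolding method_seqs_def Let_def by blast+
  have newton: "(us N (i + 1) - us N i) - D\<phi> (?g N (i + 1)) (zs N (i + 1) + us N i) *v (us N (i + 1) - us N i)
        = - (us N i - \<phi> (?g N (i + 1)) (zs N (i + 1) + us N i))" if i: "i < N" for N i
  proof -
    have N: "N \<ge> 1" using i by simp
    let ?t = "?g N (i + 1)" and ?y = "zs N (i + 1) + us N i"
    define M where "M = mat 1 - D\<phi> ?t ?y"
    have Mv: "M *v v = v - D\<phi> ?t ?y *v v" for v by (simp add: M_def matrix_vector_mult_diff_rdistrib)
    have "invertible M" unfolding invertible_left_inverse matrix_left_invertible_ker
    proof (intro allI impI)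
      fix v assume "M *v v = 0"
      then have "D\<phi> ?t ?y *v v = v" by (simp add: Mv)
      then show "v = 0" using gT[of "i + 1" N] i by (intro inj[of ?t ?y v]) auto
    qed
    then have Minv: "M *v (matrix_inv M *v v) = v" for v
      by (simp add: matrix_vector_mul_assoc invertible_matrix_inv)
    have "us N (i + 1) - us N i = - (matrix_inv M *v (us N i - \<phi> ?t ?y))"
      using m(4)[OF N i] by (simp add: M_def D\<phi>_def \<phi>_def d_dx_Q2[OF g0])
    then have "M *v (us N (i + 1) - us N i) = - (us N i - \<phi> ?t ?y)"
      using Minv[of "us N i - \<phi> ?t ?y"] by (simp add: vec.neg)
    then show ?thesis by (simp add: Mv)
  qed
  have uX: "P1 *v us N i = 0" if "i \<le> N" "N \<ge> 1" for N i
    using that(1)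
  proof (induction i)
    case 0
    then show ?case using m(2)[OF that(2)] by (simp add: matrix_vector_mul_assoc matrix_facts)
  next
    case (Suc i)
    have "P1 *v ((us N (i + 1) - us N i) - D\<phi> (?g N (i + 1)) (zs N (i + 1) + us N i) *v (us N (i + 1) - us N i))
      = P1 *v (\<phi> (?g N (i + 1)) (zs N (i + 1) + us N i) - us N i)"
      unfolding newton[OF Suc_le_lessD[OF Suc.prems]] by simp
    then show ?case using Suc by (simp add: matrix_vector_mult_diff_distrib)
  qed
  have m5: "zs N (i + 1) = zs N (i - 1) + (2 * ?h N) *\<^sub>R \<gamma> (?g N i) (zs N i + us N i)"
    if i: "1 \<le> i" "i < N" and z: "P1 *v zs N i = zs N i" for N i
    using m(5)[OF _ i] i uX[of i N] by (simp add: \<gamma>_def matrix_vector_right_distrib z)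
  have m3: "zs N 1 = P1 *v x0 + ?h N *\<^sub>R \<gamma> t0 (P1 *v x0 + P2 *v x0)" if N: "N \<ge> 1" for N
  proof -
    have "P1 *v (P1 *v x0) = P1 *v x0" by (simp add: matrix_vector_mul_assoc P1)
    then show ?thesis unfolding m(3)[OF N] m(1,2)[OF N] P_sum
      by (simp add: \<gamma>_def matrix_vector_mult_diff_rdistrib scaleR_matrix_vector_assoc[symmetric]
          matrix_vector_mult_diff_distrib matrix_vector_mul_assoc[symmetric] scaleR_diff_right)
  qed
  have zX: "P1 *v zs N i = zs N i" if "i \<le> N" "N \<ge> 1" for N i
    using that(1)
  proof (induction i rule: less_induct)
    case (less i)
    consider "i = 0" | "i = 1" | "i \<ge> 2" by linarith
    then show ?case
    proof cases
      case 1
      then show ?thesis using m(1)[OF that(2)] by (simp add: matrix_vector_mul_assoc P1)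
    next
      case 2
      then show ?thesis using m3[OF that(2)]
        by (simp add: matrix_vector_right_distrib matrix_vector_mult_scaleR matrix_vector_mul_assoc P1)
    next
      case 3
      define j where "j = i - 1"
      have j: "i = j + 1" "1 \<le> j" "j < N" using 3 less.prems by (auto simp: j_def)
      have "P1 *v zs N j = zs N j" "P1 *v zs N (j - 1) = zs N (j - 1)"
        using less.IH[of j] less.IH[of "j - 1"] j by auto
      then show ?thesis using m5[OF j(2,3)]
        by (simp add: j(1) matrix_vector_right_distrib matrix_vector_mult_scaleR)
    qed
  qed
  have sub: "{t0..T} \<times> UNIV \<subseteq> {0..} \<times> (UNIV :: (real^'n) set)" using t0 by auto
  show ?thesis
  proof (rule midpoint_newton_scheme_converges[OF T, where \<phi> = \<phi> and \<gamma> = \<gamma> and D = "\<lambda>t x. mat_blinfun (D\<phi> t x)"])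
    show "(\<phi> t has_derivative blinfun_apply (mat_blinfun (D\<phi> t y))) (at y)" if "t \<in> {t0..T}" for t y
      using that t0 by (intro \<phi>_deriv) auto
    show "continuous_on ({t0..T} \<times> UNIV) (\<lambda>(t, x). mat_blinfun (D\<phi> t x))"
      by (rule continuous_on_subset[OF continuity(3) sub])
    show "v = 0" if "t \<in> {t0..T}" "blinfun_apply (mat_blinfun (D\<phi> t y)) v = v" for t y v
      using inj[OF that(1)] that(2) by simp
    show "continuous_on ({t0..T} \<times> UNIV) (\<lambda>(t, x). \<gamma> t x)"
      by (rule continuous_on_subset[OF continuity(2) sub])
    show "local_lipschitz {t0..T} UNIV \<gamma>"
      by (rule local_lipschitz_subset[OF C1_local_lipschitz[OF \<gamma>_deriv continuity(4)]]) (use t0 in auto)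
    show "continuous_on {t0..T} (\<lambda>t. P2 *v x t)"
      by (intro mult_continuous_on continuous_on_subset[OF c]) auto
    show "P2 *v x t = \<phi> t (P1 *v x t + P2 *v x t)" if "t \<in> {t0..T}" for t
    proof -
      have "\<phi> t (x t) = x t - P1 *v x t" using con[of t] that by (metis add_diff_cancel_left' atLeastAtMost_iff diff_diff_eq2 diff_add_cancel)
      also have "\<dots> = P2 *v x t" using P_sum[of "x t"] by (metis add_diff_cancel_left')
      finally show ?thesis by (simp add: P_sum)
    qed
    show "((\<lambda>t. P1 *v x t) has_vector_derivative \<gamma> t (P1 *v x t + P2 *v x t)) (at t within {t0..T})"
      if "t \<in> {t0..T}" for t
      unfolding P_sum by (rule has_vector_derivative_within_subset[OF der]) (use that in auto)
    show "zs N 0 = P1 *v x t0" "us N 0 = P2 *v x t0"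
      "zs N 1 = P1 *v x t0 + ?h N *\<^sub>R \<gamma> t0 (P1 *v x t0 + P2 *v x t0)" if "N \<ge> 1" for N
      unfolding xt0 by (rule m that m3)+
    show "(us N (i + 1) - us N i)
        - blinfun_apply (mat_blinfun (D\<phi> (?g N (i + 1)) (zs N (i + 1) + us N i))) (us N (i + 1) - us N i)
      = - (us N i - \<phi> (?g N (i + 1)) (zs N (i + 1) + us N i))" if "i < N" for N i
      using newton[OF that] by simp
    show "zs N (i + 1) = zs N (i - 1) + (2 * ?h N) *\<^sub>R \<gamma> (?g N i) (zs N i + us N i)"
      if "1 \<le> i" "i < N" for N i
      by (rule m5[OF that zX]) (use that in auto)
    show "e > 0" by fact
  qed
qed

end

section \<open>The convergence theorem\<close>

lemma Max_tendsto_0: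
  fixes F :: "nat \<Rightarrow> nat \<Rightarrow> real"
  assumes "\<And>e. e > 0 \<Longrightarrow> \<forall>\<^sub>F N in sequentially. \<forall>i\<le>N. F N i < e" "\<And>N i. F N i \<ge> 0"
  shows "(\<lambda>N. MAX i\<in>{0..N}. F N i) \<longlonglongrightarrow> 0"
proof (rule tendstoI)
  fix e :: real assume "e > 0"
  from assms(1)[OF this] show "\<forall>\<^sub>F N in sequentially. dist (MAX i\<in>{0..N}. F N i) 0 < e"
  proof eventually_elim
    case (elim N)
    have "(MAX i\<in>{0..N}. F N i) < e" using elim by (subst Max_less_iff) auto
    moreover have "F N 0 \<le> (MAX i\<in>{0..N}. F N i)" by (rule Max_ge) auto
    ultimately show ?case using assms(2)[of N 0] unfolding dist_real_def by linarith
  qed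
qed

theorem mainTheorem4:
  fixes A B P\<^sub>1 P\<^sub>2 Q\<^sub>1 Q\<^sub>2 G :: "real^'n^'n"
    and X\<^sub>1 X\<^sub>2 Y\<^sub>1 Y\<^sub>2 :: "(real^'n) set"
    and f :: "real \<Rightarrow> real^'n \<Rightarrow> real^'n"
    and L\<^sub>0 :: "(real \<times> (real^'n)) set"
    and C\<^sub>1 C\<^sub>2 t\<^sub>0 T :: real
    and x\<^sub>0 :: "real^'n"
  assumes regular: "regular_pencil A B"
    and index_le_1: "index_le_one_with A B C\<^sub>1 C\<^sub>2"
    and P\<^sub>1: "P\<^sub>1 = spectral_P\<^sub>1 A B C\<^sub>2" and P\<^sub>2: "P\<^sub>2 = mat 1 - P\<^sub>1"
    and Q\<^sub>1: "Q\<^sub>1 = spectral_Q\<^sub>1 A B C\<^sub>2" and Q\<^sub>2: "Q\<^sub>2 = mat 1 - Q\<^sub>1"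
    and X\<^sub>1: "X\<^sub>1 = range (\<lambda>v. P\<^sub>1 *v v)" and X\<^sub>2: "X\<^sub>2 = range (\<lambda>v. P\<^sub>2 *v v)"
    and Y\<^sub>1: "Y\<^sub>1 = range (\<lambda>v. Q\<^sub>1 *v v)" and Y\<^sub>2: "Y\<^sub>2 = range (\<lambda>v. Q\<^sub>2 *v v)"
    and G: "G = A + B ** P\<^sub>2"
    and f: "cont_with_d_dx f"
    and L\<^sub>0: "L\<^sub>0 = {(t, x). t \<ge> 0 \<and> Q\<^sub>2 *v (B *v x - f t x) = 0}"
    and cond_i: "\<forall>t\<ge>0. \<forall>z\<in>X\<^sub>1. \<exists>u\<in>X\<^sub>2. (t, z + u) \<in> L\<^sub>0"
    and cond_ii: "\<forall>t\<ge>0. \<forall>z\<in>X\<^sub>1. \<forall>u\<^sub>1\<in>X\<^sub>2. \<forall>u\<^sub>2\<in>X\<^sub>2.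
          (t, z + u\<^sub>1) \<in> L\<^sub>0 \<and> (t, z + u\<^sub>2) \<in> L\<^sub>0 \<longrightarrow>
          basis_invertible X\<^sub>2 Y\<^sub>2
            (\<lambda>u v. ((d_dx (\<lambda>\<tau> x. Q\<^sub>2 *v f \<tau> x) t (z + u) - B) ** P\<^sub>2) *v v) u\<^sub>1 u\<^sub>2"
    and cond_iii:
      "(\<exists>H. positive_selfadjoint_on X\<^sub>1 H \<and>
          (\<forall>T'>0. \<exists>R>0. \<forall>(t, x)\<in>L\<^sub>0. 0 \<le> t \<and> t \<le> T' \<and> norm (P\<^sub>1 *v x) \<ge> R \<longrightarrow>
             H (P\<^sub>1 *v x) \<bullet> (matrix_inv G *v (Q\<^sub>1 *v f t x)) \<le> 0))
       \<or>
       (\<exists>(S\<^sub>1 :: real \<Rightarrow> real^'n^'n) (\<psi> :: real \<Rightarrow> real^'n \<Rightarrow> real^'n)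
         (Pi\<^sub>f :: real^'n \<Rightarrow> real^'n^'n) (e :: real \<Rightarrow> real^'n).
          (\<forall>t\<ge>0. \<forall>x. Q\<^sub>1 *v f t x = S\<^sub>1 t *v (P\<^sub>1 *v x) + \<psi> t x + Pi\<^sub>f x *v e t) \<and>
          continuous_on {0..} S\<^sub>1 \<and> (\<forall>t\<ge>0. linop_on X\<^sub>1 Y\<^sub>1 (\<lambda>v. S\<^sub>1 t *v v)) \<and>
          cont_with_d_dx \<psi> \<and>
          (\<forall>t\<ge>0. \<forall>x. \<psi> t x \<in> Y\<^sub>1 \<and> linop_on UNIV Y\<^sub>1 (\<lambda>v. d_dx \<psi> t x *v v)) \<and>
          continuous_on {0..} e \<and>
          C1_map Pi\<^sub>f \<and> (\<forall>x. linop_on UNIV Y\<^sub>1 (\<lambda>v. Pi\<^sub>f x *v v)) \<and>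
          (\<exists>C>0. \<exists>r>0. \<forall>x. norm (P\<^sub>1 *v x) \<ge> r \<longrightarrow> onorm (\<lambda>v. Pi\<^sub>f x *v v) \<le> C) \<and>
          (\<exists>H. positive_selfadjoint_on X\<^sub>1 H \<and>
             (\<forall>T'>0. \<exists>R>0. \<forall>(t, x)\<in>L\<^sub>0. 0 \<le> t \<and> t \<le> T' \<and> norm (P\<^sub>1 *v x) \<ge> R \<longrightarrow>
                H (P\<^sub>1 *v x) \<bullet> (matrix_inv G *v \<psi> t x) \<le> 0)))
       \<or>
       (\<exists>H. positive_selfadjoint_on X\<^sub>1 H \<and>
          (\<exists>R>0. \<exists>(k :: real \<Rightarrow> real) (U :: real \<Rightarrow> real).
             continuous_on {0..} k \<and>
             continuous_on {0<..} U \<and> (\<forall>v>0. U v > 0) \<and>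
             (\<forall>c>0. filterlim (\<lambda>b. integral {c..b} (\<lambda>v. 1 / U v)) at_top at_top) \<and>
             (\<forall>(t, x)\<in>L\<^sub>0. norm (P\<^sub>1 *v x) \<ge> R \<longrightarrow>
                H (P\<^sub>1 *v x) \<bullet>
                  (matrix_inv G *v (- (B *v (P\<^sub>1 *v x)) + Q\<^sub>1 *v f t x))
                \<le> k t * U (1/2 * (H (P\<^sub>1 *v x) \<bullet> (P\<^sub>1 *v x))))))"
    and init: "(t\<^sub>0, x\<^sub>0) \<in> L\<^sub>0"
    and T: "T > t\<^sub>0"
    and inv: "\<forall>t\<in>{t\<^sub>0..T}. \<forall>z\<in>X\<^sub>1. \<forall>u\<in>X\<^sub>2.
          invertible_op X\<^sub>2 Y\<^sub>2
            (\<lambda>v. ((d_dx (\<lambda>\<tau> x. Q\<^sub>2 *v f \<tau> x) t (z + u) - B) ** P\<^sub>2) *v v)"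
  shows "\<exists>x. dae_global_solution A B f t\<^sub>0 x\<^sub>0 x \<and>
     (\<forall>y. dae_global_solution A B f t\<^sub>0 x\<^sub>0 y \<longrightarrow> (\<forall>t\<ge>t\<^sub>0. y t = x t)) \<and>
     (\<forall>zs us xs :: nat \<Rightarrow> nat \<Rightarrow> real^'n.
        (\<forall>N\<ge>1. method_seqs B P\<^sub>1 P\<^sub>2 Q\<^sub>1 Q\<^sub>2 G f t\<^sub>0 T x\<^sub>0 N (zs N) (us N) (xs N)) \<longrightarrow>
        (\<lambda>N. MAX i\<in>{0..N}. norm (P\<^sub>1 *v x (grid_point t\<^sub>0 T N i) - zs N i)) \<longlonglongrightarrow> 0 \<and>
        (\<lambda>N. MAX i\<in>{0..N}. norm (P\<^sub>2 *v x (grid_point t\<^sub>0 T N i) - us N i)) \<longlonglongrightarrow> 0)"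
proof -
  note proj = spectral_projections[OF index_le_1 P\<^sub>1 Q\<^sub>1]
  interpret index_one_dae A B P\<^sub>1 P\<^sub>2 Q\<^sub>1 Q\<^sub>2 G f
    by unfold_locales (use proj P\<^sub>2 Q\<^sub>2 G f in auto)
  have L_eq: "L\<^sub>0 = L0" by (simp add: L\<^sub>0 L0_def)
  have L: "(t, x) \<in> L\<^sub>0 \<longleftrightarrow> t \<ge> 0 \<and> x - \<phi> t x = P\<^sub>1 *v x" for t x
    by (simp add: L_eq L0_iff)
  have t0: "t\<^sub>0 \<ge> 0" and x0: "x\<^sub>0 - \<phi> t\<^sub>0 x\<^sub>0 = P\<^sub>1 *v x\<^sub>0" using init L by auto
  have bi: "basis_invertible (range (\<lambda>v. P\<^sub>2 *v v)) (range (\<lambda>v. Q\<^sub>2 *v v))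
      (\<lambda>u v. ((d_dx (\<lambda>\<tau> x. Q\<^sub>2 *v f \<tau> x) t (P\<^sub>1 *v x + u) - B) ** P\<^sub>2) *v v) (P\<^sub>2 *v x) (P\<^sub>2 *v y)"
    if "t \<ge> 0" "x - \<phi> t x = P\<^sub>1 *v x" "y - \<phi> t y = P\<^sub>1 *v y" "P\<^sub>1 *v x = P\<^sub>1 *v y" for t x y
  proof -
    have "P\<^sub>1 *v x + P\<^sub>2 *v y = y" unfolding that(4) by (rule P_sum)
    then have "(t, P\<^sub>1 *v x + P\<^sub>2 *v x) \<in> L\<^sub>0" "(t, P\<^sub>1 *v x + P\<^sub>2 *v y) \<in> L\<^sub>0"
      using that(1-3) by (simp_all only: L P_sum)
    then show ?thesis
      using cond_ii[rule_format, of t "P\<^sub>1 *v x" "P\<^sub>2 *v x" "P\<^sub>2 *v y"] that(1) unfolding X\<^sub>1 X\<^sub>2 Y\<^sub>2 by blast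
  qed
  have X1D: "x - \<phi> t x = P\<^sub>1 *v x" if "x - \<phi> t x \<in> range (\<lambda>v. P\<^sub>1 *v v)" for t x
    using that constraint_iff constraint_iff_X1 by simp
  interpret solvable_index_one_dae A B P\<^sub>1 P\<^sub>2 Q\<^sub>1 Q\<^sub>2 G f
  proof unfold_locales
    show "\<exists>x. x - \<phi> t x = z" if t: "t \<ge> 0" and z: "z \<in> range (\<lambda>v. P\<^sub>1 *v v)" for t z
    proof -
      obtain u where u: "u \<in> range (\<lambda>v. P\<^sub>2 *v v)" "(t, z + u) \<in> L\<^sub>0"
        using cond_i t z unfolding X\<^sub>1 X\<^sub>2 by blast
      then have "P\<^sub>1 *v (z + u) = z" using z X1_iff X2_iff by (simp add: matrix_vector_right_distrib)
      then show ?thesis using u(2) L by metis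
    qed
    show "x = y" if t: "t \<ge> 0" and x: "x - \<phi> t x \<in> range (\<lambda>v. P\<^sub>1 *v v)" and eq: "x - \<phi> t x = y - \<phi> t y" for t x y
    proof -
      have 1: "x - \<phi> t x = P\<^sub>1 *v x" "y - \<phi> t y = P\<^sub>1 *v y"
        using X1D[OF x] X1D[of y t] x eq by auto
      then have 2: "P\<^sub>1 *v x = P\<^sub>1 *v y" using eq by simp
      show ?thesis by (rule constraint_unique[OF t 1 2 bi[OF t 1 2]])
    qed
    show "v = 0" if t: "t \<ge> 0" and x: "x - \<phi> t x \<in> range (\<lambda>v. P\<^sub>1 *v v)" and v: "D\<phi> t x *v v = v" for t x v
      by (rule D\<phi>_injective_on_constraint[OF t bi[OF t X1D[OF x] X1D[OF x] refl] v])
  qed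
  have "\<exists>H. positive_selfadjoint_on X\<^sub>1 H \<and> (\<forall>b. dissipative_on t\<^sub>0 b H)"
    using cond_iii unfolding L_eq
    \<comment> \<open>the indexed facts are the conjuncts of the three growth conditions, flattened\<close>
  proof (elim disjE exE conjE, goal_cases)
    case (1 H)
    then show ?case using dissipative_of_sign[OF 1(1)[unfolded X\<^sub>1] t0 1(2)] by blast
  next
    case (2 S\<^sub>1 \<psi> Pi\<^sub>f e C H r)
    then show ?case
      using dissipative_of_split[OF 2(10)[unfolded X\<^sub>1] t0 2(1,2,6,12,13,11)] by blast
  next
    case (3 H R k U)
    then show ?case
      using dissipative_of_comparison[OF 3(1)[unfolded X\<^sub>1] t0 3(2-6,7)] by blast
  qed
  then obtain H where H: "positive_selfadjoint_on X\<^sub>1 H" "\<And>b. dissipative_on t\<^sub>0 b H" by blast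
  obtain x where x: "dae_global_solution A B f t\<^sub>0 x\<^sub>0 x"
    and x_unique: "\<And>y t. dae_global_solution A B f t\<^sub>0 x\<^sub>0 y \<Longrightarrow> t \<ge> t\<^sub>0 \<Longrightarrow> y t = x t"
    by (rule global_solution[OF t0 x0 H(1)[unfolded X\<^sub>1] H(2)]) blast
  have inj: "v = 0" if t: "t \<in> {t\<^sub>0..T}" and v: "D\<phi> t y *v v = v" for t y v
  proof (rule D\<phi>_injective[OF _ _ v])
    show "t \<ge> 0" using t t0 by simp
    have "P\<^sub>1 *v y \<in> X\<^sub>1" "P\<^sub>2 *v y \<in> X\<^sub>2" unfolding X\<^sub>1 X\<^sub>2 by blast+
    then show "invertible_op (range (\<lambda>v. P\<^sub>2 *v v)) (range (\<lambda>v. Q\<^sub>2 *v v))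
      (\<lambda>v. ((d_dx (\<lambda>\<tau> x. Q\<^sub>2 *v f \<tau> x) t y - B) ** P\<^sub>2) *v v)"
      using inv t P_sum[of y] unfolding X\<^sub>2 Y\<^sub>2 by metis
  qed
  have "(\<lambda>N. MAX i\<in>{0..N}. norm (P\<^sub>1 *v x (grid_point t\<^sub>0 T N i) - zs N i)) \<longlonglongrightarrow> 0 \<and>
        (\<lambda>N. MAX i\<in>{0..N}. norm (P\<^sub>2 *v x (grid_point t\<^sub>0 T N i) - us N i)) \<longlonglongrightarrow> 0"
    if m: "\<forall>N\<ge>1. method_seqs B P\<^sub>1 P\<^sub>2 Q\<^sub>1 Q\<^sub>2 G f t\<^sub>0 T x\<^sub>0 N (zs N) (us N) (xs N)" for zs us xs
  proof -
    have ev: "\<forall>\<^sub>F N in sequentially. \<forall>i\<le>N. norm (P\<^sub>1 *v x (grid_point t\<^sub>0 T N i) - zs N i) < e \<and>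
      norm (P\<^sub>2 *v x (grid_point t\<^sub>0 T N i) - us N i) < e" if "e > 0" for e
      by (rule method_converges[OF t0 T x inj _ that]) (use m in auto)
    show ?thesis
    proof (intro conjI Max_tendsto_0)
      fix e :: real assume "e > 0"
      from ev[OF this] show "\<forall>\<^sub>F N in sequentially. \<forall>i\<le>N. norm (P\<^sub>1 *v x (grid_point t\<^sub>0 T N i) - zs N i) < e"
        and "\<forall>\<^sub>F N in sequentially. \<forall>i\<le>N. norm (P\<^sub>2 *v x (grid_point t\<^sub>0 T N i) - us N i) < e"
        by (auto elim: eventually_mono)
    qed auto
  qed
  then show ?thesis using x x_unique by blast
qed

end
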